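(* For all $k\geq1$, $\epsilon_1>0$, $\epsilon_2:\mathbb{N}\to(0,1]$, and $\ell_0,t_0\geq1$, there are $N,T,L\geq1$ such that the following holds. Suppose $H=(V,F)$ is a $3$-graph with $|V|\geq N$ and $\mathrm{VC}_2(H)<k$. Then there exist $t_0\leq t\leq T$, $\ell_0\leq\ell\leq L$, and a $(t,\ell,\epsilon_1,\epsilon_2(\ell))$-decomposition of $V$ which is $(\epsilon_1,\epsilon_2(\ell))$-regular and $\epsilon_1$-homogeneous with respect to $H$.
   Context: For distinct $x,y,z$ write $xy=\{x,y\}$, $xyz=\{x,y,z\}$; $[n]=\{1,\dots,n\}$. $K_2[X,Y]=\{xy: x\in X,y\in Y,x\neq y\}$. A $3$-graph is a pair $H=(V,F)$ with $V$ a finite set and $F\subseteq\binom{V}{3}$. $\mathrm{VC}_2(H)$ is the largest $k$ for which there are $b_1,\dots,b_k,c_1,\dots,c_k\in V$ and, for each $S\subseteq[k]^2$, $a_S\in V$, such that $\{a_S,b_i,c_j\}\in F$ if and only if $(i,j)\in S$. A bipartite graph $(U\cup W,E)$ with $|E|=d|U||W|$ has $\mathrm{disc}_2(\epsilon)$ if for all $U'\subseteq U$, $W'\subseteq W$, $\big||E\cap K_2[U',W']|-d|U'||W'|\big|\leq\epsilon|U||W|$; it has $\mathrm{disc}_2(\epsilon;d')$ if moreover $\big||E|-d'|U||W|\big|\leq\epsilon|U||W|$. For a graph $G$, $K_3^{(2)}(G)$ is the set of vertex sets of triangles of $G$. If $G=(V_1\cup V_2\cup V_3,E)$ is a $3$-partite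 graph and $H'=(V_1\cup V_2\cup V_3,F')$ is a $3$-graph with $F'\subseteq K_3^{(2)}(G)$ and $|F'|=d_3|K_3^{(2)}(G)|$, then $(H',G)$ has $\mathrm{disc}_{2,3}(\epsilon_1,\epsilon_2)$ if there is $d_2\in(0,1]$ such that each bipartite graph $G[V_i,V_j]$ ($1\leq i<j\leq3$) has $\mathrm{disc}_2(\epsilon_2;d_2)$ and for every (not necessarily induced) subgraph $G'\subseteq G$, $\big||F'\cap K_3^{(2)}(G')|-d_3|K_3^{(2)}(G')|\big|\leq\epsilon_1d_2^3|V_1||V_2||V_3|$. A $(t,\ell,\epsilon_1,\epsilon_2)$-decomposition $\mathcal{P}$ of a set $V$ consists of a partition $V=V_1\cup\dots\cup V_t$ with $|V_1|\leq\dots\leq|V_t|\leq|V_1|+1$ and for each $ij\in\binom{[t]}{2}$ a partition $K_2[V_i,V_j]=\bigcup_{\alpha\leq\ell}P_{ij}^\alpha$, such that for all but at most $\epsilon_1|V|^3$ triples $xyz\in\binom V3$ there are $ijk\in\binom{[t]}{3}$ and $\alpha,\beta,\gamma\in[\ell]$ with $xy\in P^\alpha_{ij}$, $xz\in P^\beta_{ik}$, $yz\in P^\gamma_{jk}$, and each of $P^\alpha_{ij},P^\beta_{ik},P^\gamma_{jk}$ (as bipartite graphs) has $\mathrm{disc}_2(\epsilon_2;1/\ell)$. A triad of $\mathcal{P}$ is a $3$-partite graph $G_{ijk}^{\alpha,\beta,\gamma}=(V_i\cup V_j\cup V_k,P_{ij}^\alpha\cup P_{ik}^\beta\cup P_{jk}^\gamma)$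 with $ijk\in\binom{[t]}{3}$, $\alpha,\beta,\gamma\in[\ell]$. For $H=(V,F)$, a triad $G$ of $\mathcal{P}$ has $\mathrm{disc}_{2,3}(\epsilon_1,\epsilon_2)$ with respect to $H$ if $(H',G)$ does, where $H'=(V_i\cup V_j\cup V_k,F\cap K_3^{(2)}(G))$. $\mathcal{P}$ is $(\epsilon_1,\epsilon_2)$-regular with respect to $H$ if all but at most $\epsilon_1|V|^3$ triples $xyz\in\binom V3$ lie in $K_3^{(2)}(G)$ for some triad $G$ of $\mathcal{P}$ that has $\mathrm{disc}_{2,3}(\epsilon_1,\epsilon_2)$ with respect to $H$. $\mathcal{P}$ is $\mu$-homogeneous with respect to $H$ if at least $(1-\mu)\binom{|V|}{3}$ triples $xyz\in\binom V3$ lie in $K_3^{(2)}(G)$ for some triad $G$ of $\mathcal{P}$ with $|F\cap K_3^{(2)}(G)|/|K_3^{(2)}(G)|\in[0,\mu)\cup(1-\mu,1]$. *)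

theory Defs
  imports Complex_Main "HOL-Library.Disjoint_Sets" "HOL-Library.Ramsey"
begin

text \<open>
  Graphs are represented by their edge sets, edges being two-element sets of vertices; the vertex
  classes are passed separately wherever they matter. The library constant \<^const>\<open>nsets\<close>
  provides the set \<open>nsets V r\<close> of all \<open>r\<close>-element subsets of \<open>V\<close>.
\<close>

definition K2 :: "'a set \<Rightarrow> 'a set \<Rightarrow> 'a set set" where
  "K2 X Y = {{x, y} | x y. x \<in> X \<and> y \<in> Y \<and> x \<noteq> y}"

definition three_graph :: "'a set \<Rightarrow> 'a set set \<Rightarrow> bool" where
  "three_graph V F \<longleftrightarrow> finite V \<and> F \<subseteq> nsets V 3"

definition VC2_realised :: "'a set \<Rightarrow> 'a set set \<Rightarrow> nat \<Rightarrow> bool" where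
  "VC2_realised V F k \<longleftrightarrow>
     (\<exists>(b :: nat \<Rightarrow> 'a) (c :: nat \<Rightarrow> 'a) (a :: (nat \<times> nat) set \<Rightarrow> 'a).
        (\<forall>i\<in>{1..k}. b i \<in> V) \<and> (\<forall>j\<in>{1..k}. c j \<in> V) \<and>
        (\<forall>S. S \<subseteq> {1..k} \<times> {1..k} \<longrightarrow>
           a S \<in> V \<and> (\<forall>i\<in>{1..k}. \<forall>j\<in>{1..k}. {a S, b i, c j} \<in> F \<longleftrightarrow> (i, j) \<in> S)))"

text \<open>
  The supremum below is a maximum for every 3-graph with nonempty vertex set, by the two lemmas
  that follow.
\<close>

definition VC2 :: "'a set \<Rightarrow> 'a set set \<Rightarrow> nat" where
  "VC2 V F = Sup {k. VC2_realised V F k}"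

lemma finite_VC2_realised:
  assumes "finite V"
  shows "finite {k. VC2_realised V F k}"
proof -
  have "k \<le> card V" if "VC2_realised V F k" for k
  proof -
    from that obtain b c a where *: "(\<forall>i\<in>{1..k}. b i \<in> V) \<and> (\<forall>j\<in>{1..k}. c j \<in> V) \<and>
        (\<forall>S. S \<subseteq> {1..k} \<times> {1..k} \<longrightarrow> a S \<in> V \<and>
        (\<forall>i\<in>{1..k}. \<forall>j\<in>{1..k}. {a S, b i, c j} \<in> F \<longleftrightarrow> (i, j) \<in> S))"
      unfolding VC2_realised_def by (elim exE) (rule that)
    have b: "\<forall>i\<in>{1..k}. b i \<in> V" using * by (rule conjunct1)
    have r: "{a S, b i, c j} \<in> F \<longleftrightarrow> (i, j) \<in> S"
      if "S \<subseteq> {1..k} \<times> {1..k}" "i \<in> {1..k}" "j \<in> {1..k}" for S i j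
      using *[THEN conjunct2, THEN conjunct2, THEN spec[of _ S]] that by simp
    have "inj_on b {1..k}"
    proof (rule inj_onI)
      fix i i' assume i: "i \<in> {1..k}" "i' \<in> {1..k}" "b i = b i'"
      then have S: "{(i, i)} \<subseteq> {1..k} \<times> {1..k}" by simp
      have "(i', i) \<in> {(i, i)}"
        using r[OF S i(1) i(1)] unfolding i(3) r[OF S i(2) i(1)] by (rule iffD2) (rule singletonI)
      then show "i = i'" by simp
    qed
    then have "card {1..k} \<le> card V"
      by (rule card_inj_on_le) (use b assms in blast)+
    then show ?thesis by simp
  qed
  then have "{k. VC2_realised V F k} \<subseteq> {..card V}" by blast
  then show ?thesis by (rule finite_subset) simp
qed

lemma VC2_realised_0:
  assumes "V \<noteq> {}"
  shows "VC2_realised V F 0"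
proof -
  obtain v where "v \<in> V" using assms by blast
  then show ?thesis
    unfolding VC2_realised_def
    by (intro exI[of _ "\<lambda>_. v"]) (simp add: \<open>v \<in> V\<close>)
qed

definition bip_density :: "'a set \<Rightarrow> 'a set \<Rightarrow> 'a set set \<Rightarrow> real" where
  "bip_density U W E = real (card E) / (real (card U) * real (card W))"

text \<open>
  If one of the vertex classes is empty then \<open>E\<close> is empty as well, and the conditions hold for
  every value of the density, in particular for the value 0 given by division by 0. The same
  remark applies to the relative density \<open>d3\<close> below when there are no triangles.
\<close>

definition disc2 :: "'a set \<Rightarrow> 'a set \<Rightarrow> 'a set set \<Rightarrow> real \<Rightarrow> bool" where
  "disc2 U W E \<epsilon> \<longleftrightarrow>
     (\<forall>U' W'. U' \<subseteq> U \<longrightarrow> W' \<subseteq> W \<longrightarrow>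
        \<bar>real (card (E \<inter> K2 U' W')) - bip_density U W E * real (card U') * real (card W')\<bar>
          \<le> \<epsilon> * real (card U) * real (card W))"

definition disc2_dens :: "'a set \<Rightarrow> 'a set \<Rightarrow> 'a set set \<Rightarrow> real \<Rightarrow> real \<Rightarrow> bool" where
  "disc2_dens U W E \<epsilon> d' \<longleftrightarrow> disc2 U W E \<epsilon> \<and>
     \<bar>real (card E) - d' * real (card U) * real (card W)\<bar> \<le> \<epsilon> * real (card U) * real (card W)"

definition K3 :: "'a set set \<Rightarrow> 'a set set" where
  "K3 E = {{x, y, z} | x y z. x \<noteq> y \<and> x \<noteq> z \<and> y \<noteq> z \<and>
                          {x, y} \<in> E \<and> {x, z} \<in> E \<and> {y, z} \<in> E}"

definition tri_density :: "'a set set \<Rightarrow> 'a set set \<Rightarrow> real" where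
  "tri_density F E = real (card (F \<inter> K3 E)) / real (card (K3 E))"

text \<open>
  \<open>disc23 X Y Z E F' \<epsilon>1 \<epsilon>2\<close> is meant for a 3-partite graph with vertex classes \<open>X, Y, Z\<close> and
  edge set \<open>E\<close>, and for \<open>F' \<subseteq> K3 E\<close>. Subgraphs are quantified through their edge sets, since
  the set of triangles depends only on these.
\<close>

definition disc23 ::
  "'a set \<Rightarrow> 'a set \<Rightarrow> 'a set \<Rightarrow> 'a set set \<Rightarrow> 'a set set \<Rightarrow> real \<Rightarrow> real \<Rightarrow> bool" where
  "disc23 X Y Z E F' \<epsilon>1 \<epsilon>2 \<longleftrightarrow>
     (let d3 = tri_density F' E in
      \<exists>d2::real. 0 < d2 \<and> d2 \<le> 1 \<and>
        disc2_dens X Y (E \<inter> K2 X Y) \<epsilon>2 d2 \<and>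
        disc2_dens X Z (E \<inter> K2 X Z) \<epsilon>2 d2 \<and>
        disc2_dens Y Z (E \<inter> K2 Y Z) \<epsilon>2 d2 \<and>
        (\<forall>E'. E' \<subseteq> E \<longrightarrow>
           \<bar>real (card (F' \<inter> K3 E')) - d3 * real (card (K3 E'))\<bar>
             \<le> \<epsilon>1 * d2 ^ 3 * real (card X) * real (card Y) * real (card Z)))"

text \<open>
  A decomposition is given by its vertex classes \<open>Vs 1, \<dots>, Vs t\<close> and the graphs
  \<open>P {i, j} \<alpha>\<close> for \<open>\<alpha> = 1, \<dots>, l\<close>. The graphs are indexed by the unordered pair \<open>{i, j}\<close>, so
  that the indices of a triad may be listed in any order. As usual for equitable partitions in
  this setting, parts are not required to be nonempty.
\<close>

definition decomposition ::
  "'a set \<Rightarrow> nat \<Rightarrow> nat \<Rightarrow> real \<Rightarrow> real \<Rightarrow> (nat \<Rightarrow> 'a set) \<Rightarrow> (nat set \<Rightarrow> nat \<Rightarrow> 'a set set) \<Rightarrow> bool" where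
  "decomposition V t l \<epsilon>1 \<epsilon>2 Vs P \<longleftrightarrow>
     (\<Union>i\<in>{1..t}. Vs i) = V \<and> disjoint_family_on Vs {1..t} \<and>
     (\<forall>i\<in>{1..t}. \<forall>j\<in>{1..t}. i \<le> j \<longrightarrow> card (Vs i) \<le> card (Vs j)) \<and>
     card (Vs t) \<le> card (Vs 1) + 1 \<and>
     (\<forall>i\<in>{1..t}. \<forall>j\<in>{1..t}. i \<noteq> j \<longrightarrow>
        (\<Union>\<alpha>\<in>{1..l}. P {i, j} \<alpha>) = K2 (Vs i) (Vs j) \<and> disjoint_family_on (P {i, j}) {1..l}) \<and>
     real (card {e \<in> nsets V 3. \<not> (\<exists>x y z i j k \<alpha> \<beta> \<gamma>.
        e = {x, y, z} \<and> {i, j, k} \<in> nsets {1..t} 3 \<and>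
        \<alpha> \<in> {1..l} \<and> \<beta> \<in> {1..l} \<and> \<gamma> \<in> {1..l} \<and>
        {x, y} \<in> P {i, j} \<alpha> \<and> {x, z} \<in> P {i, k} \<beta> \<and> {y, z} \<in> P {j, k} \<gamma> \<and>
        disc2_dens (Vs i) (Vs j) (P {i, j} \<alpha>) \<epsilon>2 (1 / real l) \<and>
        disc2_dens (Vs i) (Vs k) (P {i, k} \<beta>) \<epsilon>2 (1 / real l) \<and>
        disc2_dens (Vs j) (Vs k) (P {j, k} \<gamma>) \<epsilon>2 (1 / real l))})
       \<le> \<epsilon>1 * real (card V) ^ 3"

definition triad ::
  "nat \<Rightarrow> nat \<Rightarrow> (nat \<Rightarrow> 'a set) \<Rightarrow> (nat set \<Rightarrow> nat \<Rightarrow> 'a set set) \<Rightarrow>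
   'a set \<Rightarrow> 'a set \<Rightarrow> 'a set \<Rightarrow> 'a set set \<Rightarrow> bool" where
  "triad t l Vs P X Y Z E \<longleftrightarrow>
     (\<exists>i j k \<alpha> \<beta> \<gamma>. {i, j, k} \<in> nsets {1..t} 3 \<and>
        \<alpha> \<in> {1..l} \<and> \<beta> \<in> {1..l} \<and> \<gamma> \<in> {1..l} \<and>
        X = Vs i \<and> Y = Vs j \<and> Z = Vs k \<and>
        E = P {i, j} \<alpha> \<union> P {i, k} \<beta> \<union> P {j, k} \<gamma>)"

definition regular_wrt ::
  "'a set \<Rightarrow> 'a set set \<Rightarrow> nat \<Rightarrow> nat \<Rightarrow> (nat \<Rightarrow> 'a set) \<Rightarrow> (nat set \<Rightarrow> nat \<Rightarrow> 'a set set) \<Rightarrow>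
   real \<Rightarrow> real \<Rightarrow> bool" where
  "regular_wrt V F t l Vs P \<epsilon>1 \<epsilon>2 \<longleftrightarrow>
     real (card {e \<in> nsets V 3. \<not> (\<exists>X Y Z E. triad t l Vs P X Y Z E \<and> e \<in> K3 E \<and>
                                      disc23 X Y Z E (F \<inter> K3 E) \<epsilon>1 \<epsilon>2)})
       \<le> \<epsilon>1 * real (card V) ^ 3"

definition homogeneous_wrt ::
  "'a set \<Rightarrow> 'a set set \<Rightarrow> nat \<Rightarrow> nat \<Rightarrow> (nat \<Rightarrow> 'a set) \<Rightarrow> (nat set \<Rightarrow> nat \<Rightarrow> 'a set set) \<Rightarrow>
   real \<Rightarrow> bool" where
  "homogeneous_wrt V F t l Vs P \<mu> \<longleftrightarrow>
     real (card {e \<in> nsets V 3. \<exists>X Y Z E. triad t l Vs P X Y Z E \<and> e \<in> K3 E \<and>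
                                  tri_density F E \<in> {0..<\<mu>} \<union> {1 - \<mu><..1}})
       \<ge> (1 - \<mu>) * real (card V choose 3)"

end

theory Submission
  imports Defs "HOL-Analysis.Convex"
begin

text \<open>
  Regularity of a triad follows from near homogeneity once the three bipartite graphs are
  quasirandom, so no hypergraph regularity lemma is needed: it suffices to colour the pairs by a
  bounded number of quasirandom colours of density \<open>1 / l\<close> in such a way that \<open>F\<close> is nearly
  determined by the colours of the three pairs of a triple.

  Weak regularity with respect to binary relations gives a bounded pair colouring for which the
  conditional expectation \<open>g\<close> of the indicator of \<open>F\<close> has the same pattern counts as \<open>F\<close>, up to a
  small error. Were \<open>g\<close> often away from 0 and 1, Sidorenko's inequality for the weight
  \<open>g * (1 - g)\<close> would produce all the patterns in the definition of \<open>VC2\<close>. Hence \<open>g\<close> is mostly close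
  to 0 or 1, and \<open>F\<close> is determined by the colours up to few triples.

  A strong graph regularity lemma makes this colouring quasirandom on most pairs of parts of an
  equitable partition, and random splitting of the colour classes achieves the common density
  \<open>1 / l\<close>; on each pair of parts only boundedly many of the \<open>l\<close> new colours are mixtures of several
  old ones.
\<close>

subsection \<open>Conditional expectations and regularity\<close>

text \<open>The obstacle is the order in which the constants are chosen. The quasirandomness
  \<open>\<epsilon>2 l\<close> may be tiny compared with \<open>1 / l\<close>, so \<open>l\<close>
  has to be fixed before any regularity is asked for. This is possible because the number
  \<open>m\<close> of old colours depends only on \<open>k\<close> and \<open>\<epsilon>1\<close>:
  on each pair of parts at most \<open>m\<close> of the \<open>l\<close> new colours are mixtures,
  so \<open>l\<close> only has to be large compared with \<open>m / \<epsilon>1\<close>, whatever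
  the number of parts turns out to be. Then \<open>\<epsilon>2 l\<close> is a constant, and the
  regularity of the old colouring, the bound on the number of parts, the error of the random
  splitting and finally \<open>N\<close> are chosen in this order. In particular one value of
  \<open>l\<close> serves all hypergraphs and is also the bound \<open>L\<close>.

  Binary relations are the right test sets in the first step because two different triples of a
  complete tripartite pattern share at most two vertices: when one factor of a pattern count is
  exchanged, all other factors see at most two of its three variables.\<close>

text \<open>
  \<open>cell \<Omega> S \<omega>\<close> is the atom of \<open>\<omega>\<close> in the algebra of subsets of \<open>\<Omega>\<close> generated by \<open>S\<close>, and \<open>cexp\<close> is
  the conditional expectation with respect to this algebra and the uniform measure.
\<close>

definition cell :: "'o set \<Rightarrow> 'o set set \<Rightarrow> 'o \<Rightarrow> 'o set" where
  "cell \<Omega> S \<omega> = {\<omega>' \<in> \<Omega>. \<forall>B\<in>S. \<omega>' \<in> B \<longleftrightarrow> \<omega> \<in> B}"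

definition cexp :: "'o set \<Rightarrow> 'o set set \<Rightarrow> ('o \<Rightarrow> real) \<Rightarrow> 'o \<Rightarrow> real" where
  "cexp \<Omega> S f \<omega> = (\<Sum>\<omega>'\<in>cell \<Omega> S \<omega>. f \<omega>') / real (card (cell \<Omega> S \<omega>))"

definition energy :: "'o set \<Rightarrow> 'o set set \<Rightarrow> ('o \<Rightarrow> real) \<Rightarrow> real" where
  "energy \<Omega> S f = (\<Sum>\<omega>\<in>\<Omega>. (cexp \<Omega> S f \<omega>)\<^sup>2)"

lemma finite_cell: "finite \<Omega> \<Longrightarrow> finite (cell \<Omega> S \<omega>)"
  by (simp add: cell_def)

lemma self_in_cell: "\<omega> \<in> \<Omega> \<Longrightarrow> \<omega> \<in> cell \<Omega> S \<omega>"
  by (simp add: cell_def)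

lemma cell_eq: "\<omega>' \<in> cell \<Omega> S \<omega> \<Longrightarrow> cell \<Omega> S \<omega>' = cell \<Omega> S \<omega>"
  by (auto simp: cell_def)

lemma cell_antimono: "S \<subseteq> S' \<Longrightarrow> cell \<Omega> S' \<omega> \<subseteq> cell \<Omega> S \<omega>"
  by (auto simp: cell_def)

lemma cexp_cong_cell: "\<omega>' \<in> cell \<Omega> S \<omega> \<Longrightarrow> cexp \<Omega> S f \<omega>' = cexp \<Omega> S f \<omega>"
  by (simp add: cexp_def cell_eq)

lemma card_cell_pos: "finite \<Omega> \<Longrightarrow> \<omega> \<in> \<Omega> \<Longrightarrow> 0 < card (cell \<Omega> S \<omega>)"
  using self_in_cell finite_cell by (metis card_gt_0_iff empty_iff)

text \<open>That two points share a cell is a symmetric relation, so the double sum can be swapped;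
  afterwards \<open>h\<close> and the size of the cell are constant in the inner sum. Thus
  \<open>cexp\<close> is the orthogonal projection onto the functions that are constant on
  cells.\<close>

lemma sum_cexp_mult:
  assumes "finite \<Omega>"
    and h: "\<And>\<omega> \<omega>'. \<omega> \<in> \<Omega> \<Longrightarrow> \<omega>' \<in> cell \<Omega> S \<omega> \<Longrightarrow> h \<omega>' = h \<omega>"
  shows "(\<Sum>\<omega>\<in>\<Omega>. cexp \<Omega> S f \<omega> * h \<omega>) = (\<Sum>\<omega>\<in>\<Omega>. f \<omega> * h \<omega>)"
proof -
  let ?c = "\<lambda>\<omega>. real (card (cell \<Omega> S \<omega>))"
  have "(\<Sum>\<omega>\<in>\<Omega>. cexp \<Omega> S f \<omega> * h \<omega>) = (\<Sum>\<omega>\<in>\<Omega>. \<Sum>\<omega>'\<in>cell \<Omega> S \<omega>. f \<omega>' * h \<omega> / ?c \<omega>)"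
    by (simp add: cexp_def sum_divide_distrib sum_distrib_right)
  also have "\<dots> = (\<Sum>\<omega>\<in>\<Omega>. \<Sum>\<omega>' | \<omega>' \<in> \<Omega> \<and> (\<forall>B\<in>S. \<omega>' \<in> B \<longleftrightarrow> \<omega> \<in> B). f \<omega>' * h \<omega> / ?c \<omega>)"
    by (simp add: cell_def)
  also have "\<dots> = (\<Sum>\<omega>'\<in>\<Omega>. \<Sum>\<omega> | \<omega> \<in> \<Omega> \<and> (\<forall>B\<in>S. \<omega>' \<in> B \<longleftrightarrow> \<omega> \<in> B). f \<omega>' * h \<omega> / ?c \<omega>)"
    using assms(1) by (rule sum.swap_restrict[OF _ assms(1)])
  also have "\<dots> = (\<Sum>\<omega>'\<in>\<Omega>. \<Sum>\<omega>\<in>cell \<Omega> S \<omega>'. f \<omega>' * h \<omega>' / ?c \<omega>')"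
  proof (rule sum.cong[OF refl])
    fix \<omega>' assume w: "\<omega>' \<in> \<Omega>"
    have "{\<omega> \<in> \<Omega>. \<forall>B\<in>S. \<omega>' \<in> B \<longleftrightarrow> \<omega> \<in> B} = cell \<Omega> S \<omega>'" by (auto simp: cell_def)
    moreover have "f \<omega>' * h \<omega> / ?c \<omega> = f \<omega>' * h \<omega>' / ?c \<omega>'" if "\<omega> \<in> cell \<Omega> S \<omega>'" for \<omega>
      using h[OF w that] cell_eq[OF that] by simp
    ultimately show "(\<Sum>\<omega> | \<omega> \<in> \<Omega> \<and> (\<forall>B\<in>S. \<omega>' \<in> B \<longleftrightarrow> \<omega> \<in> B). f \<omega>' * h \<omega> / ?c \<omega>) =
        (\<Sum>\<omega>\<in>cell \<Omega> S \<omega>'. f \<omega>' * h \<omega>' / ?c \<omega>')"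
      by (metis (no_types, lifting) sum.cong)
  qed
  also have "\<dots> = (\<Sum>\<omega>'\<in>\<Omega>. f \<omega>' * h \<omega>')"
    by (rule sum.cong[OF refl]) (use card_cell_pos[OF assms(1)] in simp)
  finally show ?thesis .
qed

lemma cexp_bounds:
  assumes "finite \<Omega>" "\<And>\<omega>. \<omega> \<in> \<Omega> \<Longrightarrow> 0 \<le> f \<omega> \<and> f \<omega> \<le> 1" "\<omega> \<in> \<Omega>"
  shows "0 \<le> cexp \<Omega> S f \<omega>" "cexp \<Omega> S f \<omega> \<le> 1"
proof -
  have b: "0 \<le> f \<omega>' \<and> f \<omega>' \<le> 1" if "\<omega>' \<in> cell \<Omega> S \<omega>" for \<omega>'
    using assms(2) that by (auto simp: cell_def)
  show "0 \<le> cexp \<Omega> S f \<omega>" unfolding cexp_def using b by (simp add: sum_nonneg)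
  have "(\<Sum>\<omega>'\<in>cell \<Omega> S \<omega>. f \<omega>') \<le> real (card (cell \<Omega> S \<omega>)) * 1"
    using b by (intro sum_bounded_above) auto
  then show "cexp \<Omega> S f \<omega> \<le> 1"
    unfolding cexp_def using card_cell_pos[OF assms(1,3), of S] by simp
qed

lemma energy_bounds:
  assumes "finite \<Omega>" "\<And>\<omega>. \<omega> \<in> \<Omega> \<Longrightarrow> 0 \<le> f \<omega> \<and> f \<omega> \<le> 1"
  shows "0 \<le> energy \<Omega> S f" "energy \<Omega> S f \<le> real (card \<Omega>)"
proof -
  show "0 \<le> energy \<Omega> S f" by (simp add: energy_def sum_nonneg)
  have "energy \<Omega> S f \<le> real (card \<Omega>) * 1" unfolding energy_def
    using cexp_bounds[OF assms] by (intro sum_bounded_above) (simp add: power_le_one)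
  then show "energy \<Omega> S f \<le> real (card \<Omega>)" by simp
qed

text \<open>Pythagoras: the expectation over the coarse family \<open>S\<close> is the projection of
  the one over \<open>S'\<close>, so the inner product of the two is
  \<open>energy \<Omega> S f\<close>.\<close>

lemma energy_diff:
  assumes "finite \<Omega>" "S \<subseteq> S'"
  shows "(\<Sum>\<omega>\<in>\<Omega>. (cexp \<Omega> S' f \<omega> - cexp \<Omega> S f \<omega>)\<^sup>2) = energy \<Omega> S' f - energy \<Omega> S f"
proof -
  have "(\<Sum>\<omega>\<in>\<Omega>. cexp \<Omega> S' f \<omega> * cexp \<Omega> S f \<omega>) = (\<Sum>\<omega>\<in>\<Omega>. f \<omega> * cexp \<Omega> S f \<omega>)"
  proof (rule sum_cexp_mult[OF assms(1)])
    fix \<omega> \<omega>' assume "\<omega>' \<in> cell \<Omega> S' \<omega>"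
    then have "\<omega>' \<in> cell \<Omega> S \<omega>" using cell_antimono[OF assms(2)] by blast
    then show "cexp \<Omega> S f \<omega>' = cexp \<Omega> S f \<omega>" by (rule cexp_cong_cell)
  qed
  also have "\<dots> = (\<Sum>\<omega>\<in>\<Omega>. cexp \<Omega> S f \<omega> * cexp \<Omega> S f \<omega>)"
    by (rule sum_cexp_mult[symmetric, OF assms(1)]) (rule cexp_cong_cell)
  finally have "(\<Sum>\<omega>\<in>\<Omega>. cexp \<Omega> S' f \<omega> * cexp \<Omega> S f \<omega>) = energy \<Omega> S f"
    by (simp add: energy_def power2_eq_square)
  moreover have "(\<Sum>\<omega>\<in>\<Omega>. (cexp \<Omega> S' f \<omega> - cexp \<Omega> S f \<omega>)\<^sup>2) =
     energy \<Omega> S' f + energy \<Omega> S f - 2 * (\<Sum>\<omega>\<in>\<Omega>. cexp \<Omega> S' f \<omega> * cexp \<Omega> S f \<omega>)"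
    by (simp add: energy_def power2_diff sum.distrib sum_subtractf sum_distrib_left mult.assoc)
  ultimately show ?thesis by simp
qed

section \<open>Energy increment, weak and strong regularity\<close>

lemma sum_sq_le:
  fixes g :: "'o \<Rightarrow> real"
  assumes "finite A"
  shows "(\<Sum>\<omega>\<in>A. g \<omega>)\<^sup>2 \<le> real (card A) * (\<Sum>\<omega>\<in>A. (g \<omega>)\<^sup>2)"
  using Cauchy_Schwarz_ineq_sum[of "\<lambda>_. 1" g A] by simp

text \<open>
  Intersections of three members of \<open>\<G>\<close> cover both uses: three binary relations on the three
  pairs of coordinates of a triple, and two vertex sets together with a colour.
\<close>

definition cut_regular :: "'o set \<Rightarrow> 'o set set \<Rightarrow> ('o \<Rightarrow> real) \<Rightarrow> 'o set set \<Rightarrow> real \<Rightarrow> bool" where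
  "cut_regular \<Omega> \<G> f S \<eta> \<longleftrightarrow> (\<forall>B1\<in>\<G>. \<forall>B2\<in>\<G>. \<forall>B3\<in>\<G>.
     \<bar>\<Sum>\<omega>\<in>\<Omega> \<inter> (B1 \<inter> B2 \<inter> B3). f \<omega> - cexp \<Omega> S f \<omega>\<bar> \<le> \<eta> * real (card \<Omega>))"

text \<open>Adjoin the three sets that violate regularity. Their intersection is then a union of new
  cells, on which \<open>f\<close> and its new expectation have the same sum, so the discrepancy is
  one between the two expectations. Cauchy-Schwarz turns it into a gain of energy.\<close>

lemma energy_increment:
  assumes "finite \<Omega>" "\<Omega> \<noteq> {}" "\<eta> > 0" "\<not> cut_regular \<Omega> \<G> f S \<eta>" "finite S" "S \<subseteq> \<G>"
  shows "\<exists>S'. S \<subseteq> S' \<and> S' \<subseteq> \<G> \<and> finite S' \<and> card S' \<le> card S + 3 \<and>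
    energy \<Omega> S' f \<ge> energy \<Omega> S f + \<eta>\<^sup>2 * real (card \<Omega>)"
proof -
  obtain B1 B2 B3 where B: "B1 \<in> \<G>" "B2 \<in> \<G>" "B3 \<in> \<G>" and
    big: "\<bar>\<Sum>\<omega>\<in>\<Omega> \<inter> (B1 \<inter> B2 \<inter> B3). f \<omega> - cexp \<Omega> S f \<omega>\<bar> > \<eta> * real (card \<Omega>)"
    using assms(4) unfolding cut_regular_def by (auto simp: not_le)
  define S' where "S' = S \<union> {B1, B2, B3}"
  define B where "B = B1 \<inter> B2 \<inter> B3"
  have sub: "S \<subseteq> S'" by (auto simp: S'_def)
  have "card {B1, B2, B3} \<le> 3" by (simp add: card_insert_if)
  then have card: "card S' \<le> card S + 3"
    unfolding S'_def using card_Un_le[of S "{B1, B2, B3}"] by linarith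
  let ?h = "\<lambda>\<omega>. of_bool (\<omega> \<in> B) :: real"
  have "(\<Sum>\<omega>\<in>\<Omega>. cexp \<Omega> S' f \<omega> * ?h \<omega>) = (\<Sum>\<omega>\<in>\<Omega>. f \<omega> * ?h \<omega>)"
    by (rule sum_cexp_mult[OF assms(1)]) (auto simp: cell_def S'_def B_def)
  then have eq: "(\<Sum>\<omega>\<in>\<Omega> \<inter> B. cexp \<Omega> S' f \<omega>) = (\<Sum>\<omega>\<in>\<Omega> \<inter> B. f \<omega>)"
    using assms(1) by (simp add: sum.inter_restrict of_bool_def if_distrib cong: if_cong)
  have "\<eta> * real (card \<Omega>) < \<bar>\<Sum>\<omega>\<in>\<Omega> \<inter> B. cexp \<Omega> S' f \<omega> - cexp \<Omega> S f \<omega>\<bar>"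
    using big by (simp add: sum_subtractf eq B_def[symmetric])
  then have "(\<eta> * real (card \<Omega>))\<^sup>2 \<le> (\<Sum>\<omega>\<in>\<Omega> \<inter> B. cexp \<Omega> S' f \<omega> - cexp \<Omega> S f \<omega>)\<^sup>2"
    using assms(3) power_mono[of "\<eta> * real (card \<Omega>)" "\<bar>\<Sum>\<omega>\<in>\<Omega> \<inter> B. cexp \<Omega> S' f \<omega> - cexp \<Omega> S f \<omega>\<bar>" 2]
    by simp
  also have "\<dots> \<le> real (card (\<Omega> \<inter> B)) * (\<Sum>\<omega>\<in>\<Omega> \<inter> B. (cexp \<Omega> S' f \<omega> - cexp \<Omega> S f \<omega>)\<^sup>2)"
    using assms(1) by (intro sum_sq_le) auto
  also have "\<dots> \<le> real (card \<Omega>) * (\<Sum>\<omega>\<in>\<Omega>. (cexp \<Omega> S' f \<omega> - cexp \<Omega> S f \<omega>)\<^sup>2)"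
    using assms(1) by (intro mult_mono sum_mono2 of_nat_mono card_mono sum_nonneg) auto
  also have "\<dots> = real (card \<Omega>) * (energy \<Omega> S' f - energy \<Omega> S f)"
    by (simp add: energy_diff[OF assms(1) sub])
  finally have "real (card \<Omega>) * (\<eta>\<^sup>2 * real (card \<Omega>)) \<le> real (card \<Omega>) * (energy \<Omega> S' f - energy \<Omega> S f)"
    by (simp add: power2_eq_square algebra_simps)
  moreover have "real (card \<Omega>) > 0" using assms(1,2) by (simp add: card_gt_0_iff)
  ultimately have "\<eta>\<^sup>2 * real (card \<Omega>) \<le> energy \<Omega> S' f - energy \<Omega> S f" by simp
  then show ?thesis using sub card assms B by (intro exI[of _ S']) (auto simp: S'_def)
qed

text \<open>Each violation gains energy \<open>\<eta>\<^sup>2 * card \<Omega>\<close> at the price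
  of at most three new sets, and the energy never exceeds \<open>card \<Omega>\<close>, so the
  refinement stops.\<close>

lemma weak_regularity:
  assumes "finite \<Omega>" "\<Omega> \<noteq> {}" "\<And>\<omega>. \<omega> \<in> \<Omega> \<Longrightarrow> 0 \<le> f \<omega> \<and> f \<omega> \<le> 1" "\<eta> > 0" "finite S" "S \<subseteq> \<G>"
  shows "\<exists>S'. S \<subseteq> S' \<and> S' \<subseteq> \<G> \<and> finite S' \<and> card S' \<le> card S + 3 * nat \<lceil>2 / \<eta>\<^sup>2\<rceil> \<and>
    cut_regular \<Omega> \<G> f S' \<eta>"
proof (rule ccontr)
  assume neg: "\<not> ?thesis"
  \<comment> \<open>With 2 in the numerator, \<open>J\<close> increments would give energy at least
    \<open>2 * card \<Omega>\<close>, which contradicts the bound strictly.\<close>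
  define J where "J = nat \<lceil>2 / \<eta>\<^sup>2\<rceil>"
  have "\<exists>S'. S \<subseteq> S' \<and> S' \<subseteq> \<G> \<and> finite S' \<and> card S' \<le> card S + 3 * j \<and>
      energy \<Omega> S' f \<ge> real j * \<eta>\<^sup>2 * real (card \<Omega>)" if "j \<le> J" for j
    using that
  proof (induction j)
    case 0
    then show ?case using assms energy_bounds(1)[OF assms(1,3)] by (intro exI[of _ S]) auto
  next
    case (Suc j)
    then obtain S1 where S1: "S \<subseteq> S1" "S1 \<subseteq> \<G>" "finite S1" "card S1 \<le> card S + 3 * j"
      "energy \<Omega> S1 f \<ge> real j * \<eta>\<^sup>2 * real (card \<Omega>)" by auto
    have "\<not> cut_regular \<Omega> \<G> f S1 \<eta>" using neg S1 Suc.prems unfolding J_def[symmetric] by auto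
    from energy_increment[OF assms(1,2,4) this S1(3,2)] obtain S2 where
      "S1 \<subseteq> S2" "S2 \<subseteq> \<G>" "finite S2" "card S2 \<le> card S1 + 3"
      "energy \<Omega> S2 f \<ge> energy \<Omega> S1 f + \<eta>\<^sup>2 * real (card \<Omega>)" by blast
    then show ?case using S1 by (intro exI[of _ S2]) (auto simp: algebra_simps)
  qed
  then obtain S' where "energy \<Omega> S' f \<ge> real J * \<eta>\<^sup>2 * real (card \<Omega>)" by blast
  moreover have "energy \<Omega> S' f \<le> real (card \<Omega>)" by (rule energy_bounds[OF assms(1,3)])
  moreover have "real (card \<Omega>) > 0" using assms(1,2) by (simp add: card_gt_0_iff)
  ultimately have "real J * \<eta>\<^sup>2 \<le> 1"
    by (metis mult.commute mult.right_neutral mult_le_cancel_left_pos order_trans)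
  moreover have "real J \<ge> 2 / \<eta>\<^sup>2" unfolding J_def by linarith
  ultimately show False using assms(4) by (simp add: field_simps)
qed

text \<open>
  The uniformity \<open>\<eta>\<close> may depend on the coarse family \<open>S\<close>, because the energies of a chain of
  weakly regular families cannot jump by more than \<open>\<delta>\<close> more than \<open>1 / \<delta>\<close> times.
\<close>

lemma strong_regularity:
  fixes \<eta> :: "nat \<Rightarrow> real" and \<delta> :: real
  assumes "\<And>s. \<eta> s > 0" "\<delta> > 0"
  shows "\<exists>K. \<forall>(\<Omega> :: 'o set) f \<G>. finite \<Omega> \<longrightarrow> \<Omega> \<noteq> {} \<longrightarrow> (\<forall>\<omega>\<in>\<Omega>. 0 \<le> f \<omega> \<and> f \<omega> \<le> 1) \<longrightarrow>
    (\<exists>S S'. S \<subseteq> S' \<and> S' \<subseteq> \<G> \<and> finite S' \<and> card S \<le> K \<and> cut_regular \<Omega> \<G> f S' (\<eta> (card S)) \<and>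
       (\<Sum>\<omega>\<in>\<Omega>. (cexp \<Omega> S' f \<omega> - cexp \<Omega> S f \<omega>)\<^sup>2) \<le> \<delta> * real (card \<Omega>))"
proof -
  define good :: "'o set \<Rightarrow> ('o \<Rightarrow> real) \<Rightarrow> 'o set set \<Rightarrow> nat \<Rightarrow> bool" where
    "good \<Omega> f \<G> K \<longleftrightarrow> (\<exists>S S'. S \<subseteq> S' \<and> S' \<subseteq> \<G> \<and> finite S' \<and> card S \<le> K \<and> cut_regular \<Omega> \<G> f S' (\<eta> (card S)) \<and>
       (\<Sum>\<omega>\<in>\<Omega>. (cexp \<Omega> S' f \<omega> - cexp \<Omega> S f \<omega>)\<^sup>2) \<le> \<delta> * real (card \<Omega>))" for \<Omega> f \<G> K
  \<comment> \<open>The bound \<open>K\<close> depends on \<open>j\<close> alone. The second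
    alternative is the chain of families built so far; it becomes impossible once
    \<open>j * \<delta>\<close> exceeds 1.\<close>
  have "\<exists>K. \<forall>(\<Omega> :: 'o set) f \<G>. finite \<Omega> \<longrightarrow> \<Omega> \<noteq> {} \<longrightarrow> (\<forall>\<omega>\<in>\<Omega>. 0 \<le> f \<omega> \<and> f \<omega> \<le> 1) \<longrightarrow>
     good \<Omega> f \<G> K \<or> (\<exists>S. S \<subseteq> \<G> \<and> finite S \<and> card S \<le> K \<and> energy \<Omega> S f \<ge> real j * \<delta> * real (card \<Omega>))" for j
  proof (induction j)
    case 0
    show ?case using energy_bounds(1) by (intro exI[of _ 0] allI impI disjI2 exI[of _ "{}"]) auto
  next
    case (Suc j)
    then obtain K where K: "\<And>(\<Omega> :: 'o set) f \<G>. finite \<Omega> \<Longrightarrow> \<Omega> \<noteq> {} \<Longrightarrow> (\<forall>\<omega>\<in>\<Omega>. 0 \<le> f \<omega> \<and> f \<omega> \<le> 1) \<Longrightarrow>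
     good \<Omega> f \<G> K \<or> (\<exists>S. S \<subseteq> \<G> \<and> finite S \<and> card S \<le> K \<and> energy \<Omega> S f \<ge> real j * \<delta> * real (card \<Omega>))" by blast
    \<comment> \<open>Of the current family only \<open>card S \<le> K\<close> is known, while the
      cost of the next refinement depends on \<open>card S\<close> through \<open>\<eta>\<close>;
      the sum covers every possible size.\<close>
    define K' where "K' = K + (\<Sum>s\<le>K. 3 * nat \<lceil>2 / (\<eta> s)\<^sup>2\<rceil>)"
    show ?case
    proof (intro exI[of _ K'] allI impI)
      fix \<Omega> :: "'o set" and f :: "'o \<Rightarrow> real" and \<G>
      assume O: "finite \<Omega>" "\<Omega> \<noteq> {}" and f: "\<forall>\<omega>\<in>\<Omega>. 0 \<le> f \<omega> \<and> f \<omega> \<le> 1"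
      from K[OF O f, of \<G>] show "good \<Omega> f \<G> K' \<or> (\<exists>S. S \<subseteq> \<G> \<and> finite S \<and> card S \<le> K' \<and>
          energy \<Omega> S f \<ge> real (Suc j) * \<delta> * real (card \<Omega>))"
      proof
        assume "good \<Omega> f \<G> K"
        moreover have "K \<le> K'" by (simp add: K'_def)
        ultimately have "good \<Omega> f \<G> K'" unfolding good_def using order_trans by blast
        then show ?thesis ..
      next
        assume "\<exists>S. S \<subseteq> \<G> \<and> finite S \<and> card S \<le> K \<and> energy \<Omega> S f \<ge> real j * \<delta> * real (card \<Omega>)"
        then obtain S where S: "S \<subseteq> \<G>" "finite S" "card S \<le> K" "energy \<Omega> S f \<ge> real j * \<delta> * real (card \<Omega>)"
          by blast
        from weak_regularity[OF O _ assms(1)[of "card S"] S(2,1), of f] f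
        obtain S' where S': "S \<subseteq> S'" "S' \<subseteq> \<G>" "finite S'"
          "card S' \<le> card S + 3 * nat \<lceil>2 / (\<eta> (card S))\<^sup>2\<rceil>" "cut_regular \<Omega> \<G> f S' (\<eta> (card S))" by blast
        have "3 * nat \<lceil>2 / (\<eta> (card S))\<^sup>2\<rceil> \<le> (\<Sum>s\<le>K. 3 * nat \<lceil>2 / (\<eta> s)\<^sup>2\<rceil>)"
          using S(3) by (intro member_le_sum) auto
        then have c': "card S' \<le> K'" using S'(4) S(3) by (simp add: K'_def)
        show ?thesis
        proof (cases "energy \<Omega> S' f - energy \<Omega> S f \<le> \<delta> * real (card \<Omega>)")
          case True
          then have "good \<Omega> f \<G> K'" unfolding good_def
            using S S' energy_diff[OF O(1) S'(1), of f]
            by (intro exI[of _ S] exI[of _ S']) (auto simp: K'_def)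
          then show ?thesis ..
        next
          case False
          then have "energy \<Omega> S' f \<ge> real (Suc j) * \<delta> * real (card \<Omega>)"
            using S(4) by (simp add: algebra_simps)
          then show ?thesis using S' c' by blast
        qed
      qed
    qed
  qed
  from this[of "nat \<lceil>2 / \<delta>\<rceil>"] obtain K where K: "\<And>(\<Omega> :: 'o set) f \<G>. finite \<Omega> \<Longrightarrow> \<Omega> \<noteq> {} \<Longrightarrow>
      (\<forall>\<omega>\<in>\<Omega>. 0 \<le> f \<omega> \<and> f \<omega> \<le> 1) \<Longrightarrow> good \<Omega> f \<G> K \<or>
      (\<exists>S. S \<subseteq> \<G> \<and> finite S \<and> card S \<le> K \<and> energy \<Omega> S f \<ge> real (nat \<lceil>2 / \<delta>\<rceil>) * \<delta> * real (card \<Omega>))"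
    by blast
  have "good \<Omega> f \<G> K" if O: "finite \<Omega>" "\<Omega> \<noteq> {}" and f: "\<forall>\<omega>\<in>\<Omega>. 0 \<le> f \<omega> \<and> f \<omega> \<le> 1" for \<Omega> f \<G>
  proof (rule ccontr)
    assume "\<not> good \<Omega> f \<G> K"
    then obtain S where S: "energy \<Omega> S f \<ge> real (nat \<lceil>2 / \<delta>\<rceil>) * \<delta> * real (card \<Omega>)" using K[OF O f] by blast
    have "real (nat \<lceil>2 / \<delta>\<rceil>) \<ge> 2 / \<delta>" by linarith
    then have "real (nat \<lceil>2 / \<delta>\<rceil>) * \<delta> \<ge> 2"
      using assms(2) by (simp only: pos_divide_le_eq)
    then have "real (nat \<lceil>2 / \<delta>\<rceil>) * \<delta> * real (card \<Omega>) \<ge> 2 * real (card \<Omega>)" by (intro mult_right_mono) auto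
    moreover have "energy \<Omega> S f \<le> real (card \<Omega>)" using energy_bounds(2)[OF O(1)] f by blast
    moreover have "real (card \<Omega>) > 0" using O by (simp add: card_gt_0_iff)
    ultimately show False using S by linarith
  qed
  then show ?thesis unfolding good_def by blast
qed

subsection \<open>Counting complete tripartite patterns\<close>

text \<open>Induction on the exponent; the step is Chebyshev's sum inequality for the equally
  ordered sequences \<open>a ^ r\<close> and \<open>a\<close>, proved by summing
  \<open>(a i ^ r - a j ^ r) * (a i - a j) \<ge> 0\<close> over all pairs.\<close>

lemma power_mean:
  fixes a :: "'b \<Rightarrow> real"
  assumes "finite X" "X \<noteq> {}" "\<And>x. x \<in> X \<Longrightarrow> 0 \<le> a x"
  shows "real (card X) * ((\<Sum>x\<in>X. a x) / real (card X)) ^ r \<le> (\<Sum>x\<in>X. a x ^ r)"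
proof (induction r)
  case (Suc r)
  let ?n = "real (card X)"
  have n: "?n > 0" using assms by (simp add: card_gt_0_iff)
  have "0 \<le> (a i ^ r - a j ^ r) * (a i - a j)" if "i \<in> X" "j \<in> X" for i j
    using assms(3)[OF that(1)] assms(3)[OF that(2)] power_mono[of "a i" "a j" r] power_mono[of "a j" "a i" r]
    by (cases "a i \<le> a j") (auto intro: mult_nonpos_nonpos)
  then have "0 \<le> (\<Sum>i\<in>X. \<Sum>j\<in>X. (a i ^ r - a j ^ r) * (a i - a j))"
    by (intro sum_nonneg) auto
  also have "\<dots> = (\<Sum>i\<in>X. \<Sum>j\<in>X. a i ^ Suc r) + (\<Sum>i\<in>X. \<Sum>j\<in>X. a j ^ Suc r)
      - (\<Sum>i\<in>X. \<Sum>j\<in>X. a i ^ r * a j) - (\<Sum>i\<in>X. \<Sum>j\<in>X. a j ^ r * a i)"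
    by (simp add: sum.distrib sum_subtractf algebra_simps)
  also have "(\<Sum>i\<in>X. \<Sum>j\<in>X. a j ^ r * a i) = (\<Sum>i\<in>X. \<Sum>j\<in>X. a i ^ r * a j)"
    by (rule sum.swap)
  also have "(\<Sum>i\<in>X. \<Sum>j\<in>X. a i ^ r * a j) = (\<Sum>i\<in>X. a i ^ r) * (\<Sum>i\<in>X. a i)"
    by (simp add: sum_product)
  also have "(\<Sum>i\<in>X. \<Sum>j\<in>X. a i ^ Suc r) = ?n * (\<Sum>i\<in>X. a i ^ Suc r)"
    by (simp add: sum_distrib_left)
  also have "(\<Sum>i\<in>X. \<Sum>j\<in>X. a j ^ Suc r) = ?n * (\<Sum>i\<in>X. a i ^ Suc r)"
    by simp
  finally have cheb: "(\<Sum>i\<in>X. a i ^ r) * (\<Sum>i\<in>X. a i) \<le> ?n * (\<Sum>i\<in>X. a i ^ Suc r)"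
    by linarith
  have "?n * ((\<Sum>x\<in>X. a x) / ?n) ^ Suc r = (?n * ((\<Sum>x\<in>X. a x) / ?n) ^ r) * ((\<Sum>x\<in>X. a x) / ?n)"
    by simp
  also have "\<dots> \<le> (\<Sum>x\<in>X. a x ^ r) * ((\<Sum>x\<in>X. a x) / ?n)"
    using Suc.IH assms(3) by (intro mult_right_mono) (auto simp: sum_nonneg)
  also have "\<dots> \<le> (\<Sum>x\<in>X. a x ^ Suc r)"
    using cheb n by (simp add: pos_divide_le_eq mult.commute)
  finally show ?case .
qed simp

lemma sum_PiE_split:
  assumes "s \<in> I"
  shows "(\<Sum>a\<in>PiE I (\<lambda>_. V). \<phi> a) = (\<Sum>a\<in>PiE (I - {s}) (\<lambda>_. V). \<Sum>x\<in>V. \<phi> (a(s := x)))"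
proof -
  have I: "insert s (I - {s}) = I" using assms by auto
  have "PiE I (\<lambda>_. V) = (\<lambda>(y, g). g(s := y)) ` (V \<times> PiE (I - {s}) (\<lambda>_. V))"
    using PiE_insert_eq[of s "I - {s}" "\<lambda>_. V"] I by simp
  moreover have "inj_on (\<lambda>(y, g). g(s := y)) (V \<times> PiE (I - {s}) (\<lambda>_. V))"
    using inj_combinator[of s "I - {s}" "\<lambda>_. V"] by simp
  ultimately have "(\<Sum>a\<in>PiE I (\<lambda>_. V). \<phi> a) = (\<Sum>(y, g)\<in>V \<times> PiE (I - {s}) (\<lambda>_. V). \<phi> (g(s := y)))"
    by (simp add: sum.reindex case_prod_unfold)
  also have "\<dots> = (\<Sum>y\<in>V. \<Sum>g\<in>PiE (I - {s}) (\<lambda>_. V). \<phi> (g(s := y)))"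
    by (simp add: sum.cartesian_product)
  finally show ?thesis by (subst sum.swap)
qed

lemma sum_Times: "(\<Sum>p\<in>A \<times> B. g p) = (\<Sum>x\<in>A. \<Sum>y\<in>B. g (x, y))"
  by (subst sum.cartesian_product) simp

text \<open>One vertex is replaced by the class \<open>I\<close>. For fixed \<open>y\<close> the sum
  over \<open>a\<close> factorises into a power of the degree of \<open>y\<close>, and the power
  mean inequality is applied to these degrees.\<close>

lemma sum_prod_blowup:
  fixes h :: "'x \<Rightarrow> 'y \<Rightarrow> real"
  assumes "finite X" "X \<noteq> {}" "finite Y" "Y \<noteq> {}" "finite I"
    and "\<And>x y. x \<in> X \<Longrightarrow> y \<in> Y \<Longrightarrow> 0 \<le> h x y"
  shows "real (card X) ^ card I * real (card Y) *
      ((\<Sum>y\<in>Y. \<Sum>x\<in>X. h x y) / (real (card X) * real (card Y))) ^ card I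
    \<le> (\<Sum>y\<in>Y. \<Sum>a\<in>PiE I (\<lambda>_. X). \<Prod>s\<in>I. h (a s) y)"
proof -
  have X: "real (card X) > 0" using assms by (simp add: card_gt_0_iff)
  have "(\<Sum>y\<in>Y. \<Sum>a\<in>PiE I (\<lambda>_. X). \<Prod>s\<in>I. h (a s) y) = (\<Sum>y\<in>Y. (\<Sum>x\<in>X. h x y) ^ card I)"
    using prod_sum_PiE[of I "\<lambda>_. X" "\<lambda>_ x. h x y" for y] assms(1,5) by simp
  moreover have "real (card Y) * ((\<Sum>y\<in>Y. \<Sum>x\<in>X. h x y) / real (card Y)) ^ card I \<le> (\<Sum>y\<in>Y. (\<Sum>x\<in>X. h x y) ^ card I)"
    using assms by (intro power_mean) (auto simp: sum_nonneg)
  ultimately show ?thesis using X by (simp add: power_divide power_mult_distrib)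
qed

text \<open>
  A weighted count of the copies in \<open>V\<close> of the complete tripartite 3-graph with vertex classes
  \<open>I\<close>, \<open>J\<close>, \<open>K\<close>.
\<close>

definition pcount :: "'a set \<Rightarrow> 's set \<Rightarrow> 'i set \<Rightarrow> 'j set \<Rightarrow>
    ('s \<times> 'i \<times> 'j \<Rightarrow> 'a \<Rightarrow> 'a \<Rightarrow> 'a \<Rightarrow> real) \<Rightarrow> real" where
  "pcount V I J K p = (\<Sum>a\<in>PiE I (\<lambda>_. V). \<Sum>b\<in>PiE J (\<lambda>_. V). \<Sum>c\<in>PiE K (\<lambda>_. V).
     \<Prod>e\<in>I \<times> J \<times> K. p e (a (fst e)) (b (fst (snd e))) (c (snd (snd e))))"

text \<open>
  Sidorenko's inequality for complete tripartite 3-graphs: the three classes are blown up one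
  after the other, each time by the power mean inequality.
\<close>

lemma pcount_lower:
  fixes w :: "'a \<Rightarrow> 'a \<Rightarrow> 'a \<Rightarrow> real"
  assumes fin: "finite V" "V \<noteq> {}" "finite I" "finite J" "finite K"
    and w: "\<And>x y z. x \<in> V \<Longrightarrow> y \<in> V \<Longrightarrow> z \<in> V \<Longrightarrow> 0 \<le> w x y z"
  shows "real (card V) ^ (card I + card J + card K) *
      ((\<Sum>x\<in>V. \<Sum>y\<in>V. \<Sum>z\<in>V. w x y z) / real (card V) ^ 3) ^ (card I * card J * card K)
    \<le> pcount V I J K (\<lambda>_. w)"
proof -
  let ?n = "real (card V)"
  let ?PI = "PiE I (\<lambda>_. V)" and ?PJ = "PiE J (\<lambda>_. V)" and ?PK = "PiE K (\<lambda>_. V)"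
  define A where "A = (\<Sum>x\<in>V. \<Sum>y\<in>V. \<Sum>z\<in>V. w x y z) / ?n ^ 3"
  have n: "?n > 0" using fin by (simp add: card_gt_0_iff)
  have A0: "A \<ge> 0" unfolding A_def using w by (intro divide_nonneg_nonneg sum_nonneg) auto
  have ne: "?PJ \<noteq> {}" "?PK \<noteq> {}" "finite ?PJ" "finite ?PK" using fin by (auto simp: PiE_eq_empty_iff finite_PiE)
  have cJ: "real (card ?PJ) = ?n ^ card J" and cK: "real (card ?PK) = ?n ^ card K"
    using fin by (auto simp: card_PiE)
  have inV: "c j \<in> V" if "c \<in> ?PK" "j \<in> K" for c j using that by (rule PiE_mem)
  have inV': "b j \<in> V" if "b \<in> ?PJ" "j \<in> J" for b j using that by (rule PiE_mem)
  \<comment> \<open>In \<open>S3\<close> only the third class is blown up, in \<open>S2\<close> the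
    third and the second; each lower bound supplies the mean value for the next blow-up.\<close>
  define S3 where "S3 = (\<Sum>(x, y)\<in>V \<times> V. \<Sum>c\<in>?PK. \<Prod>j\<in>K. w x y (c j))"
  define S2 where "S2 = (\<Sum>(x, c)\<in>V \<times> ?PK. \<Sum>b\<in>?PJ. \<Prod>i\<in>J. \<Prod>j\<in>K. w x (b i) (c j))"
  have T: "(\<Sum>x\<in>V. \<Sum>y\<in>V. \<Sum>z\<in>V. w x y z) = A * ?n ^ 3" using n by (simp add: A_def)
  moreover have "(\<Sum>x\<in>V. \<Sum>y\<in>V. \<Sum>z\<in>V. w x y z) = (\<Sum>y\<in>V \<times> V. sum (w (fst y) (snd y)) V)"
    by (simp add: sum_Times)
  ultimately have T': "(\<Sum>y\<in>V \<times> V. sum (w (fst y) (snd y)) V) = A * ?n ^ 3" by simp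
  have "?n ^ card K * (?n * ?n) * ((A * ?n ^ 3) / (?n * (?n * ?n))) ^ card K \<le> S3"
    using sum_prod_blowup[of V "V \<times> V" K "\<lambda>z (x, y). w x y z"] fin w T'
    by (simp add: S3_def case_prod_unfold card_cartesian_product mem_Times_iff)
  moreover have "(A * ?n ^ 3) / (?n * (?n * ?n)) = A" using n by (simp add: power3_eq_cube)
  ultimately have S3: "?n ^ card K * (?n * ?n) * A ^ card K \<le> S3" by simp
  have S3_eq: "(\<Sum>xc\<in>V \<times> ?PK. \<Sum>y\<in>V. \<Prod>j\<in>K. w (fst xc) y (snd xc j)) = S3"
  proof -
    have "(\<Sum>xc\<in>V \<times> ?PK. \<Sum>y\<in>V. \<Prod>j\<in>K. w (fst xc) y (snd xc j)) = (\<Sum>x\<in>V. \<Sum>c\<in>?PK. \<Sum>y\<in>V. \<Prod>j\<in>K. w x y (c j))"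
      by (simp add: sum_Times)
    also have "\<dots> = (\<Sum>x\<in>V. \<Sum>y\<in>V. \<Sum>c\<in>?PK. \<Prod>j\<in>K. w x y (c j))"
      by (intro sum.cong refl sum.swap)
    finally show ?thesis by (simp add: S3_def sum_Times)
  qed
  have "?n ^ card J * (?n * ?n ^ card K) * (S3 / (?n * (?n * ?n ^ card K))) ^ card J \<le> S2"
    using sum_prod_blowup[of V "V \<times> ?PK" J "\<lambda>y xc. \<Prod>j\<in>K. w (fst xc) y (snd xc j)"] fin w ne cK inV
    by (simp add: S2_def case_prod_unfold card_cartesian_product S3_eq prod_nonneg mem_Times_iff)
  moreover have "A ^ card K \<le> S3 / (?n * (?n * ?n ^ card K))"
    using S3 n by (simp add: pos_le_divide_eq ac_simps)
  then have "(A ^ card K) ^ card J \<le> (S3 / (?n * (?n * ?n ^ card K))) ^ card J"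
    using A0 by (intro power_mono) auto
  ultimately have S2: "?n ^ card J * (?n * ?n ^ card K) * (A ^ card K) ^ card J \<le> S2"
    using n by (elim order_trans[rotated]) (intro mult_left_mono, auto)
  have S2_eq: "(\<Sum>bc\<in>?PJ \<times> ?PK. \<Sum>x\<in>V. \<Prod>i\<in>J. \<Prod>j\<in>K. w x (fst bc i) (snd bc j)) = S2"
  proof -
    have "(\<Sum>bc\<in>?PJ \<times> ?PK. \<Sum>x\<in>V. \<Prod>i\<in>J. \<Prod>j\<in>K. w x (fst bc i) (snd bc j)) =
      (\<Sum>b\<in>?PJ. \<Sum>c\<in>?PK. \<Sum>x\<in>V. \<Prod>i\<in>J. \<Prod>j\<in>K. w x (b i) (c j))"
      by (simp add: sum_Times)
    also have "\<dots> = (\<Sum>b\<in>?PJ. \<Sum>x\<in>V. \<Sum>c\<in>?PK. \<Prod>i\<in>J. \<Prod>j\<in>K. w x (b i) (c j))"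
      by (intro sum.cong refl sum.swap)
    also have "\<dots> = (\<Sum>x\<in>V. \<Sum>b\<in>?PJ. \<Sum>c\<in>?PK. \<Prod>i\<in>J. \<Prod>j\<in>K. w x (b i) (c j))"
      by (rule sum.swap)
    also have "\<dots> = (\<Sum>x\<in>V. \<Sum>c\<in>?PK. \<Sum>b\<in>?PJ. \<Prod>i\<in>J. \<Prod>j\<in>K. w x (b i) (c j))"
      by (intro sum.cong refl sum.swap)
    finally show ?thesis by (simp add: S2_def sum_Times)
  qed
  have pc: "pcount V I J K (\<lambda>_. w) = (\<Sum>bc\<in>?PJ \<times> ?PK. \<Sum>a\<in>?PI. \<Prod>s\<in>I. \<Prod>i\<in>J. \<Prod>j\<in>K. w (a s) (fst bc i) (snd bc j))"
  proof -
    have "pcount V I J K (\<lambda>_. w) = (\<Sum>a\<in>?PI. \<Sum>b\<in>?PJ. \<Sum>c\<in>?PK. \<Prod>s\<in>I. \<Prod>i\<in>J. \<Prod>j\<in>K. w (a s) (b i) (c j))"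
      by (simp add: pcount_def prod.cartesian_product case_prod_unfold)
    also have "\<dots> = (\<Sum>b\<in>?PJ. \<Sum>a\<in>?PI. \<Sum>c\<in>?PK. \<Prod>s\<in>I. \<Prod>i\<in>J. \<Prod>j\<in>K. w (a s) (b i) (c j))"
      by (rule sum.swap)
    also have "\<dots> = (\<Sum>b\<in>?PJ. \<Sum>c\<in>?PK. \<Sum>a\<in>?PI. \<Prod>s\<in>I. \<Prod>i\<in>J. \<Prod>j\<in>K. w (a s) (b i) (c j))"
      by (intro sum.cong refl sum.swap)
    finally show ?thesis by (simp add: sum_Times)
  qed
  have "?n ^ card I * (?n ^ card J * ?n ^ card K) * (S2 / (?n * (?n ^ card J * ?n ^ card K))) ^ card I \<le> pcount V I J K (\<lambda>_.
      w)"
    using sum_prod_blowup[of V "?PJ \<times> ?PK" I "\<lambda>x bc. \<Prod>i\<in>J. \<Prod>j\<in>K. w x (fst bc i) (snd bc j)"] fin w ne cK cJ inV inV'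
    by (simp add: pc card_cartesian_product S2_eq prod_nonneg mem_Times_iff)
  moreover have "(A ^ card K) ^ card J \<le> S2 / (?n * (?n ^ card J * ?n ^ card K))"
    using S2 n by (simp add: pos_le_divide_eq ac_simps)
  then have "((A ^ card K) ^ card J) ^ card I \<le> (S2 / (?n * (?n ^ card J * ?n ^ card K))) ^ card I"
    using A0 by (intro power_mono) auto
  ultimately have "?n ^ card I * (?n ^ card J * ?n ^ card K) * ((A ^ card K) ^ card J) ^ card I \<le> pcount V I J K (\<lambda>_. w)"
    using n by (elim order_trans[rotated]) (intro mult_left_mono, auto)
  then show ?thesis unfolding A_def[symmetric]
    by (simp add: power_add power_mult[symmetric] ac_simps)
qed

text \<open>
  When all variables except \<open>a s0\<close>, \<open>b i0\<close>, \<open>c j0\<close> are fixed, every other factor depends on at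
  most two of these three, so that only binary test functions occur.
\<close>

lemma pcount_step:
  fixes d :: "'a \<Rightarrow> 'a \<Rightarrow> 'a \<Rightarrow> real" and r :: "'s \<times> 'i \<times> 'j \<Rightarrow> 'a \<Rightarrow> 'a \<Rightarrow> 'a \<Rightarrow> real"
  assumes fin: "finite V" "finite I" "finite J" "finite K" and e0: "s0 \<in> I" "i0 \<in> J" "j0 \<in> K"
    and r: "\<And>e x y z. e \<in> I \<times> J \<times> K \<Longrightarrow> x \<in> V \<Longrightarrow> y \<in> V \<Longrightarrow> z \<in> V \<Longrightarrow> 0 \<le> r e x y z \<and> r e x y z \<le> 1"
    and test: "\<And>u v w :: 'a \<Rightarrow> 'a \<Rightarrow> real. (\<And>x y. x \<in> V \<Longrightarrow> y \<in> V \<Longrightarrow>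
        0 \<le> u x y \<and> u x y \<le> 1 \<and> 0 \<le> v x y \<and> v x y \<le> 1 \<and> 0 \<le> w x y \<and> w x y \<le> 1) \<Longrightarrow>
      \<bar>\<Sum>x\<in>V. \<Sum>y\<in>V. \<Sum>z\<in>V. d x y z * (u x y * v x z * w y z)\<bar> \<le> \<beta> * real (card V) ^ 3"
  shows "\<bar>\<Sum>a\<in>PiE I (\<lambda>_. V). \<Sum>b\<in>PiE J (\<lambda>_. V). \<Sum>c\<in>PiE K (\<lambda>_. V). d (a s0) (b i0) (c j0) *
     (\<Prod>e\<in>I \<times> J \<times> K - {(s0, i0, j0)}. r e (a (fst e)) (b (fst (snd e))) (c (snd (snd e))))\<bar>
     \<le> \<beta> * real (card V) ^ (card I + card J + card K)"
proof -
  let ?n = "real (card V)"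
  let ?PI = "PiE (I - {s0}) (\<lambda>_. V)" and ?PJ = "PiE (J - {i0}) (\<lambda>_. V)" and ?PK = "PiE (K - {j0}) (\<lambda>_. V)"
  define \<Phi> where "\<Phi> a b c = d (a s0) (b i0) (c j0) *
     (\<Prod>e\<in>I \<times> J \<times> K - {(s0, i0, j0)}. r e (a (fst e)) (b (fst (snd e))) (c (snd (snd e))))" for a b c
  define \<Psi> where "\<Psi> a b c x y z = \<Phi> (a(s0 := x)) (b(i0 := y)) (c(j0 := z))" for a b c x y z
  have "(\<Sum>a\<in>PiE I (\<lambda>_. V). \<Sum>b\<in>PiE J (\<lambda>_. V). \<Sum>c\<in>PiE K (\<lambda>_. V). \<Phi> a b c) =
     (\<Sum>a\<in>?PI. \<Sum>x\<in>V. \<Sum>b\<in>?PJ. \<Sum>y\<in>V. \<Sum>c\<in>?PK. \<Sum>z\<in>V. \<Psi> a b c x y z)"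
    unfolding \<Psi>_def
    by (simp only: sum_PiE_split[OF e0(1)] sum_PiE_split[OF e0(2)] sum_PiE_split[OF e0(3)])
  also have "\<dots> = (\<Sum>a\<in>?PI. \<Sum>b\<in>?PJ. \<Sum>x\<in>V. \<Sum>y\<in>V. \<Sum>c\<in>?PK. \<Sum>z\<in>V. \<Psi> a b c x y z)"
    by (intro sum.cong refl sum.swap)
  also have "\<dots> = (\<Sum>a\<in>?PI. \<Sum>b\<in>?PJ. \<Sum>x\<in>V. \<Sum>c\<in>?PK. \<Sum>y\<in>V. \<Sum>z\<in>V. \<Psi> a b c x y z)"
    by (intro sum.cong refl sum.swap)
  also have "\<dots> = (\<Sum>a\<in>?PI. \<Sum>b\<in>?PJ. \<Sum>c\<in>?PK. \<Sum>x\<in>V. \<Sum>y\<in>V. \<Sum>z\<in>V. \<Psi> a b c x y z)"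
    by (intro sum.cong refl sum.swap)
  finally have eq: "(\<Sum>a\<in>PiE I (\<lambda>_. V). \<Sum>b\<in>PiE J (\<lambda>_. V). \<Sum>c\<in>PiE K (\<lambda>_. V). \<Phi> a b c) =
     (\<Sum>a\<in>?PI. \<Sum>b\<in>?PJ. \<Sum>c\<in>?PK. \<Sum>x\<in>V. \<Sum>y\<in>V. \<Sum>z\<in>V. \<Psi> a b c x y z)" .
  have inner: "\<bar>\<Sum>x\<in>V. \<Sum>y\<in>V. \<Sum>z\<in>V. \<Psi> a b c x y z\<bar> \<le> \<beta> * ?n ^ 3"
    if abc: "a \<in> ?PI" "b \<in> ?PJ" "c \<in> ?PK" for a b c
  proof -
    \<comment> \<open>The remaining triples are sorted by the first coordinate in which they differ
      from \<open>(s0, i0, j0)\<close>. The factors in \<open>?W\<close> do not see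
      \<open>x\<close>, those in \<open>?Vv\<close> do not see \<open>y\<close>, and those in
      \<open>?U\<close> do not see \<open>z\<close>.\<close>
    let ?W = "(I - {s0}) \<times> J \<times> K" and ?Vv = "{s0} \<times> (J - {i0}) \<times> K" and ?U = "{s0} \<times> {i0} \<times> (K - {j0})"
    define u where "u x y = (\<Prod>e\<in>?U. r e x y (c (snd (snd e))))" for x y
    define v where "v x z = (\<Prod>e\<in>?Vv. r e x (b (fst (snd e))) ((c(j0 := z)) (snd (snd e))))" for x z
    define w where "w y z = (\<Prod>e\<in>?W. r e (a (fst e)) ((b(i0 := y)) (fst (snd e))) ((c(j0 := z)) (snd (snd e))))" for y z
    have in_a: "a s \<in> V" if "s \<in> I" "s \<noteq> s0" for s using abc(1) that by (auto dest: PiE_mem)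
    have in_b: "b s \<in> V" if "s \<in> J" "s \<noteq> i0" for s using abc(2) that by (auto dest: PiE_mem)
    have in_c: "c s \<in> V" if "s \<in> K" "s \<noteq> j0" for s using abc(3) that by (auto dest: PiE_mem)
    have split: "I \<times> J \<times> K - {(s0, i0, j0)} = (?W \<union> ?Vv) \<union> ?U" using e0 by auto
    have "\<Psi> a b c x y z = d x y z * (u x y * v x z * w y z)" for x y z
    proof -
      let ?R = "\<lambda>e. r e ((a(s0 := x)) (fst e)) ((b(i0 := y)) (fst (snd e))) ((c(j0 := z)) (snd (snd e)))"
      have "prod ?R (I \<times> J \<times> K - {(s0, i0, j0)}) = prod ?R ?W * prod ?R ?Vv * prod ?R ?U"
        unfolding split using fin by (subst prod.union_disjoint; (subst prod.union_disjoint)?) auto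
      moreover have "prod ?R ?W = w y z" unfolding w_def by (rule prod.cong) auto
      moreover have "prod ?R ?Vv = v x z" unfolding v_def by (rule prod.cong) auto
      moreover have "prod ?R ?U = u x y" unfolding u_def by (rule prod.cong) auto
      ultimately show ?thesis by (simp add: \<Psi>_def \<Phi>_def ac_simps)
    qed
    moreover have "0 \<le> u x y \<and> u x y \<le> 1 \<and> 0 \<le> v x y \<and> v x y \<le> 1 \<and> 0 \<le> w x y \<and> w x y \<le> 1"
      if xy: "x \<in> V" "y \<in> V" for x y
    proof -
      have U: "0 \<le> r e x y (c (snd (snd e))) \<and> r e x y (c (snd (snd e))) \<le> 1" if "e \<in> ?U" for e
      proof -
        from that obtain j where j: "e = (s0, i0, j)" "j \<in> K" "j \<noteq> j0" by auto
        then show ?thesis using xy in_c[of j] e0 by (intro r) auto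
      qed
      have Vv: "0 \<le> r e x (b (fst (snd e))) ((c(j0 := y)) (snd (snd e))) \<and>
          r e x (b (fst (snd e))) ((c(j0 := y)) (snd (snd e))) \<le> 1" if "e \<in> ?Vv" for e
      proof -
        from that obtain i j where j: "e = (s0, i, j)" "j \<in> K" "i \<in> J" "i \<noteq> i0" by auto
        then show ?thesis using xy in_c[of j] in_b[of i] e0 by (intro r) auto
      qed
      have W: "0 \<le> r e (a (fst e)) ((b(i0 := x)) (fst (snd e))) ((c(j0 := y)) (snd (snd e))) \<and>
          r e (a (fst e)) ((b(i0 := x)) (fst (snd e))) ((c(j0 := y)) (snd (snd e))) \<le> 1" if "e \<in> ?W" for e
      proof -
        from that obtain s i j where j: "e = (s, i, j)" "j \<in> K" "i \<in> J" "s \<in> I" "s \<noteq> s0" by auto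
        then show ?thesis using xy in_c[of j] in_b[of i] in_a[of s] e0 by (intro r) auto
      qed
      show ?thesis unfolding u_def v_def w_def
        by (intro conjI prod_nonneg prod_le_1) (use U Vv W in blast)+
    qed
    ultimately show ?thesis using test[of u v w] by simp
  qed
  have "\<bar>\<Sum>a\<in>?PI. \<Sum>b\<in>?PJ. \<Sum>c\<in>?PK. \<Sum>x\<in>V. \<Sum>y\<in>V. \<Sum>z\<in>V. \<Psi> a b c x y z\<bar> \<le>
      (\<Sum>a\<in>?PI. \<Sum>b\<in>?PJ. \<Sum>c\<in>?PK. \<beta> * ?n ^ 3)"
    by (intro sum_abs[THEN order_trans] sum_mono inner)
  also have "\<dots> = real (card ?PI) * real (card ?PJ) * real (card ?PK) * (\<beta> * ?n ^ 3)"
    by simp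
  also have "\<dots> = ?n ^ (card I - 1) * ?n ^ (card J - 1) * ?n ^ (card K - 1) * (\<beta> * ?n ^ 3)"
    using fin e0 by (simp add: card_PiE)
  also have "\<dots> = \<beta> * (?n ^ Suc (card I - 1) * ?n ^ Suc (card J - 1) * ?n ^ Suc (card K - 1))"
    by (simp add: power3_eq_cube)
  also have "\<dots> = \<beta> * ?n ^ (card I + card J + card K)"
  proof -
    have "card I > 0" "card J > 0" "card K > 0" using fin e0 by (auto simp: card_gt_0_iff)
    then show ?thesis by (simp del: power_Suc add: power_add)
  qed
  finally show ?thesis unfolding eq[symmetric] \<Phi>_def .
qed

text \<open>A hybrid argument: the factors \<open>p e\<close> are replaced by \<open>q e\<close> one
  at a time, and each exchange is an instance of \<open>pcount_step\<close> with \<open>d\<close>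
  the difference of the two factors.\<close>

lemma pcount_diff:
  fixes p q :: "'s \<times> 'i \<times> 'j \<Rightarrow> 'a \<Rightarrow> 'a \<Rightarrow> 'a \<Rightarrow> real"
  assumes fin: "finite V" "finite I" "finite J" "finite K"
    and p: "\<And>e x y z. e \<in> I \<times> J \<times> K \<Longrightarrow> x \<in> V \<Longrightarrow> y \<in> V \<Longrightarrow> z \<in> V \<Longrightarrow> 0 \<le> p e x y z \<and> p e x y z \<le> 1"
    and q: "\<And>e x y z. e \<in> I \<times> J \<times> K \<Longrightarrow> x \<in> V \<Longrightarrow> y \<in> V \<Longrightarrow> z \<in> V \<Longrightarrow> 0 \<le> q e x y z \<and> q e x y z \<le> 1"
    and test: "\<And>e u v w. e \<in> I \<times> J \<times> K \<Longrightarrow> (\<And>x y. x \<in> V \<Longrightarrow> y \<in> V \<Longrightarrow>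
        0 \<le> u x y \<and> u x y \<le> 1 \<and> 0 \<le> v x y \<and> v x y \<le> 1 \<and> 0 \<le> w x y \<and> w x y \<le> 1) \<Longrightarrow>
      \<bar>\<Sum>x\<in>V. \<Sum>y\<in>V. \<Sum>z\<in>V. (p e x y z - q e x y z) * (u x y * v x z * w y z)\<bar> \<le> \<beta> * real (card V) ^ 3"
  shows "\<bar>pcount V I J K p - pcount V I J K q\<bar>
    \<le> real (card I * card J * card K) * \<beta> * real (card V) ^ (card I + card J + card K)"
proof -
  let ?E = "I \<times> J \<times> K"
  let ?M = "\<beta> * real (card V) ^ (card I + card J + card K)"
  define hyb where "hyb E' e = (if e \<in> E' then q e else p e)" for E' e
  have "\<bar>pcount V I J K p - pcount V I J K (hyb E')\<bar> \<le> real (card E') * ?M" if "finite E'" "E' \<subseteq> ?E" for E'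
    using that
  proof (induction E' rule: finite_induct)
    case empty
    have "hyb {} = p" by (auto simp: hyb_def)
    then show ?case by simp
  next
    case (insert e0 E')
    obtain s0 i0 j0 where e0: "e0 = (s0, i0, j0)" by (metis prod_cases3)
    have e0E: "e0 \<in> ?E" and mem: "s0 \<in> I" "i0 \<in> J" "j0 \<in> K" using insert.prems e0 by auto
    have finE: "finite ?E" using fin by auto
    let ?v = "\<lambda>r a b c e. r e (a (fst e)) (b (fst (snd e))) (c (snd (snd e)))"
    have *: "(\<Prod>e\<in>?E. ?v (hyb E') a b c e) - (\<Prod>e\<in>?E. ?v (hyb (insert e0 E')) a b c e) =
       (p e0 (a s0) (b i0) (c j0) - q e0 (a s0) (b i0) (c j0)) * (\<Prod>e\<in>?E - {e0}. ?v (hyb E') a b c e)" for a b c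
    proof -
      have "(\<Prod>e\<in>?E - {e0}. ?v (hyb (insert e0 E')) a b c e) = (\<Prod>e\<in>?E - {e0}. ?v (hyb E') a b c e)"
        by (rule prod.cong) (auto simp: hyb_def)
      then show ?thesis using insert.hyps(2)
        by (simp add: prod.remove[OF finE e0E] hyb_def e0 left_diff_distrib)
    qed
    have "pcount V I J K (hyb E') - pcount V I J K (hyb (insert e0 E')) =
      (\<Sum>a\<in>PiE I (\<lambda>_. V). \<Sum>b\<in>PiE J (\<lambda>_. V). \<Sum>c\<in>PiE K (\<lambda>_. V).
        (p e0 (a s0) (b i0) (c j0) - q e0 (a s0) (b i0) (c j0)) * (\<Prod>e\<in>?E - {(s0, i0, j0)}. ?v (hyb E') a b c e))"
      unfolding pcount_def sum_subtractf[symmetric] * by (simp add: e0)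
    also have "\<bar>\<dots>\<bar> \<le> ?M"
      using p q by (intro pcount_step[where d = "\<lambda>x y z. p e0 x y z - q e0 x y z"] fin mem test e0E)
        (auto simp: hyb_def)
    finally have "\<bar>pcount V I J K (hyb E') - pcount V I J K (hyb (insert e0 E'))\<bar> \<le> ?M" .
    moreover have "\<bar>pcount V I J K p - pcount V I J K (hyb E')\<bar> \<le> real (card E') * ?M"
      using insert by auto
    ultimately have "\<bar>pcount V I J K p - pcount V I J K (hyb (insert e0 E'))\<bar> \<le> real (card E') * ?M + ?M"
      by linarith
    then show ?case using insert.hyps by (simp add: algebra_simps)
  qed
  from this[of ?E] have "\<bar>pcount V I J K p - pcount V I J K (hyb ?E)\<bar> \<le> real (card ?E) * ?M"
    using fin by simp
  moreover have "pcount V I J K (hyb ?E) = pcount V I J K q"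
    unfolding pcount_def by (intro sum.cong refl prod.cong) (simp add: hyb_def)
  ultimately show ?thesis by (simp add: card_cartesian_product mult.assoc)
qed

subsection \<open>Bounded VC2-dimension and binary relations\<close>

text \<open>A linear function on a cube is maximal at a vertex, namely the one that is 1 exactly
  where the coefficient is positive.\<close>

lemma sum_fractional_le:
  fixes c :: "'a \<Rightarrow> 'b \<Rightarrow> real"
  assumes "\<And>U. (\<Sum>x\<in>X. \<Sum>y\<in>Y. c x y * of_bool ((x, y) \<in> U)) \<le> B"
    and "\<And>x y. x \<in> X \<Longrightarrow> y \<in> Y \<Longrightarrow> 0 \<le> u x y \<and> u x y \<le> 1"
  shows "(\<Sum>x\<in>X. \<Sum>y\<in>Y. c x y * u x y) \<le> B"
proof -
  have "(\<Sum>x\<in>X. \<Sum>y\<in>Y. c x y * u x y) \<le> (\<Sum>x\<in>X. \<Sum>y\<in>Y. c x y * of_bool ((x, y) \<in> {(x, y). c x y > 0}))"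
  proof (intro sum_mono)
    fix x y assume "x \<in> X" "y \<in> Y"
    from assms(2)[OF this] show "c x y * u x y \<le> c x y * of_bool ((x, y) \<in> {(x, y). c x y > 0})"
      by (auto simp: mult_le_0_iff mult_left_le)
  qed
  also have "\<dots> \<le> B" by (rule assms(1))
  finally show ?thesis .
qed

text \<open>The sum is linear in each of \<open>u\<close>, \<open>v\<close>, \<open>w\<close>
  separately, so the three sets are replaced by fractional functions in turn. The variable on which
  the current function does not depend is summed innermost and becomes part of the
  coefficient.\<close>

lemma cut_fractional_le:
  fixes d :: "'a \<Rightarrow> 'a \<Rightarrow> 'a \<Rightarrow> real"
  assumes cut: "\<And>U1 U2 U3. (\<Sum>x\<in>V. \<Sum>y\<in>V. \<Sum>z\<in>V. d x y z *
      (of_bool ((x, y) \<in> U1) * of_bool ((x, z) \<in> U2) * of_bool ((y, z) \<in> U3))) \<le> B"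
    and b: "\<And>x y. x \<in> V \<Longrightarrow> y \<in> V \<Longrightarrow>
      0 \<le> u x y \<and> u x y \<le> 1 \<and> 0 \<le> v x y \<and> v x y \<le> 1 \<and> 0 \<le> w x y \<and> w x y \<le> 1"
  shows "(\<Sum>x\<in>V. \<Sum>y\<in>V. \<Sum>z\<in>V. d x y z * (u x y * v x z * w y z)) \<le> B"
proof -
  have 1: "(\<Sum>x\<in>V. \<Sum>y\<in>V. \<Sum>z\<in>V. d x y z * (u x y * of_bool ((x, z) \<in> U2) * of_bool ((y, z) \<in> U3))) \<le> B"
    for U2 U3
  proof -
    have "(\<Sum>x\<in>V. \<Sum>y\<in>V. (\<Sum>z\<in>V. d x y z * (of_bool ((x, z) \<in> U2) * of_bool ((y, z) \<in> U3))) * u x y) \<le> B"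
    proof (rule sum_fractional_le)
      show "(\<Sum>x\<in>V. \<Sum>y\<in>V. (\<Sum>z\<in>V. d x y z * (of_bool ((x, z) \<in> U2) * of_bool ((y, z) \<in> U3))) *
          of_bool ((x, y) \<in> U)) \<le> B" for U
        using cut[of U U2 U3] unfolding sum_distrib_right by (simp only: ac_simps)
    qed (use b in auto)
    then show ?thesis unfolding sum_distrib_right by (simp only: ac_simps)
  qed
  have swap: "(\<Sum>x\<in>V. \<Sum>z\<in>V. \<Sum>y\<in>V. \<phi> x y z) = (\<Sum>x\<in>V. \<Sum>y\<in>V. \<Sum>z\<in>V. \<phi> x y z)" for \<phi> :: "'a \<Rightarrow> 'a \<Rightarrow> 'a \<Rightarrow> real"
    by (intro sum.cong refl sum.swap)
  have 2: "(\<Sum>x\<in>V. \<Sum>y\<in>V. \<Sum>z\<in>V. d x y z * (u x y * v x z * of_bool ((y, z) \<in> U3))) \<le> B" for U3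
  proof -
    have "(\<Sum>x\<in>V. \<Sum>z\<in>V. (\<Sum>y\<in>V. d x y z * (u x y * of_bool ((y, z) \<in> U3))) * v x z) \<le> B"
    proof (rule sum_fractional_le)
      show "(\<Sum>x\<in>V. \<Sum>z\<in>V. (\<Sum>y\<in>V. d x y z * (u x y * of_bool ((y, z) \<in> U3))) * of_bool ((x, z) \<in> U)) \<le> B" for U
        using 1[of U U3] unfolding sum_distrib_right by (subst swap) (simp only: ac_simps)
    qed (use b in auto)
    then show ?thesis unfolding sum_distrib_right by (subst swap) (simp only: ac_simps)
  qed
  have swap': "(\<Sum>y\<in>V. \<Sum>z\<in>V. \<Sum>x\<in>V. \<phi> x y z) = (\<Sum>x\<in>V. \<Sum>y\<in>V. \<Sum>z\<in>V. \<phi> x y z)" for \<phi> :: "'a \<Rightarrow> 'a \<Rightarrow> 'a \<Rightarrow> real"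
  proof -
    have "(\<Sum>y\<in>V. \<Sum>z\<in>V. \<Sum>x\<in>V. \<phi> x y z) = (\<Sum>y\<in>V. \<Sum>x\<in>V. \<Sum>z\<in>V. \<phi> x y z)"
      by (intro sum.cong refl sum.swap)
    also have "\<dots> = (\<Sum>x\<in>V. \<Sum>y\<in>V. \<Sum>z\<in>V. \<phi> x y z)" by (rule sum.swap)
    finally show ?thesis .
  qed
  have "(\<Sum>y\<in>V. \<Sum>z\<in>V. (\<Sum>x\<in>V. d x y z * (u x y * v x z)) * w y z) \<le> B"
  proof (rule sum_fractional_le)
    show "(\<Sum>y\<in>V. \<Sum>z\<in>V. (\<Sum>x\<in>V. d x y z * (u x y * v x z)) * of_bool ((y, z) \<in> U)) \<le> B" for U
      using 2[of U] unfolding sum_distrib_right by (subst swap') (simp only: ac_simps)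
  qed (use b in auto)
  then show ?thesis unfolding sum_distrib_right by (subst swap'[symmetric]) (simp only: ac_simps)
qed

text \<open>A nonzero term would be a realisation: the first class is indexed by the sets
  \<open>S\<close> themselves, so \<open>a\<close> supplies the vertices \<open>a S\<close>. As
  \<open>VC2_realised\<close> does not ask for distinct vertices, degenerate maps contribute nothing
  either and no error term arises from them.\<close>

lemma pcount_pattern_eq_0:
  assumes "finite V" "\<not> VC2_realised V F k"
    and "\<And>S i j x y z. p (S, i, j) x y z = (if (i, j) \<in> S then of_bool ({x, y, z} \<in> F) else 1 - of_bool ({x, y, z} \<in> F))"
  shows "pcount V (Pow ({1..k} \<times> {1..k})) {1..k} {1..k} p = 0"
proof -
  let ?I = "Pow ({1..k} \<times> {1..k})"
  have "(\<Prod>e\<in>?I \<times> {1..k} \<times> {1..k}. p e (a (fst e)) (b (fst (snd e))) (c (snd (snd e)))) = 0"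
    if abc: "a \<in> PiE ?I (\<lambda>_. V)" "b \<in> PiE {1..k} (\<lambda>_. V)" "c \<in> PiE {1..k} (\<lambda>_. V)" for a b c
  proof (rule ccontr)
    assume "\<not> ?thesis"
    then have nz: "p (S, i, j) (a S) (b i) (c j) \<noteq> 0" if "S \<subseteq> {1..k} \<times> {1..k}" "i \<in> {1..k}" "j \<in> {1..k}" for S i j
      using that by (auto simp: prod_zero_iff)
    have "{a S, b i, c j} \<in> F \<longleftrightarrow> (i, j) \<in> S" if "S \<subseteq> {1..k} \<times> {1..k}" "i \<in> {1..k}" "j \<in> {1..k}" for S i j
      using nz[OF that] unfolding assms(3) by (auto split: if_splits)
    moreover have "a S \<in> V" if "S \<subseteq> {1..k} \<times> {1..k}" for S using PiE_mem[OF abc(1)] that by auto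
    moreover have "\<forall>i\<in>{1..k}. b i \<in> V" "\<forall>i\<in>{1..k}. c i \<in> V" using abc(2,3) PiE_mem by blast+
    ultimately have "VC2_realised V F k" unfolding VC2_realised_def by blast
    then show False using assms(2) by blast
  qed
  then show ?thesis unfolding pcount_def by (intro sum.neutral ballI)
qed

definition pair_cylinders :: "('a \<times> 'a \<times> 'a) set set" where
  "pair_cylinders = range (\<lambda>U. {(x, y, z). (x, y) \<in> U}) \<union> range (\<lambda>U. {(x, y, z). (x, z) \<in> U}) \<union>
     range (\<lambda>U. {(x, y, z). (y, z) \<in> U})"

definition edge_ind :: "'a set set \<Rightarrow> 'a \<times> 'a \<times> 'a \<Rightarrow> real" where
  "edge_ind F = (\<lambda>(x, y, z). of_bool ({x, y, z} \<in> F))"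

text \<open>
  The patterns forbidden by \<open>\<not> VC2_realised V F k\<close> have count 0. Replacing the indicator \<open>f\<close> of
  \<open>F\<close> by its conditional expectation \<open>g\<close> hardly changes this count, while every factor \<open>g\<close> or
  \<open>1 - g\<close> is at least \<open>g * (1 - g)\<close>; hence the mean of \<open>g * (1 - g)\<close> is small.
\<close>

lemma VC2_cexp_near_01:
  fixes V :: "'a set"
  assumes V: "finite V" "V \<noteq> {}" and nr: "\<not> VC2_realised V F k" and \<delta>: "\<delta> > 0"
    and M: "M = card (Pow ({1..k} \<times> {1..k})) * k * k"
    and reg: "cut_regular (V \<times> V \<times> V) pair_cylinders (edge_ind F) S (\<delta> ^ M / (2 * real (M + 1)))"
  shows "(\<Sum>\<omega>\<in>V \<times> V \<times> V. cexp (V \<times> V \<times> V) S (edge_ind F) \<omega> * (1 - cexp (V \<times> V \<times> V) S (edge_ind F) \<omega>))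
    \<le> \<delta> * real (card V) ^ 3"
proof -
  let ?\<Omega> = "V \<times> V \<times> V" and ?n = "real (card V)"
  let ?I = "Pow ({1..k} \<times> {1..k})" and ?J = "{1..k}"
  \<comment> \<open>\<open>M\<close> is the number of triples of the pattern, hence the number of
    exchanged factors. The constant keeps their total error \<open>M * \<eta>\<close> below
    \<open>\<delta> ^ M\<close>, which is Sidorenko's lower bound for weights of mean
    \<open>\<delta>\<close>; the summand 1 keeps the denominator positive for
    \<open>M = 0\<close>.\<close>
  define \<eta> where "\<eta> = \<delta> ^ M / (2 * real (M + 1))"
  define f where "f = edge_ind F"
  define g where "g = cexp ?\<Omega> S f"
  define d where "d x y z = f (x, y, z) - g (x, y, z)" for x y z
  define p where "p e x y z = (if (fst (snd e), snd (snd e)) \<in> fst e then f (x, y, z) else 1 - f (x, y, z))"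
    for e :: "(nat \<times> nat) set \<times> nat \<times> nat" and x y z
  define q where "q e x y z = (if (fst (snd e), snd (snd e)) \<in> fst e then g (x, y, z) else 1 - g (x, y, z))"
    for e :: "(nat \<times> nat) set \<times> nat \<times> nat" and x y z
  define w where "w x y z = g (x, y, z) * (1 - g (x, y, z))" for x y z
  define A where "A = (\<Sum>x\<in>V. \<Sum>y\<in>V. \<Sum>z\<in>V. w x y z) / ?n ^ 3"
  define s where "s = card ?I + card ?J + card ?J"
  have n: "?n > 0" using V by (simp add: card_gt_0_iff)
  have cO: "real (card ?\<Omega>) = ?n ^ 3" by (simp add: card_cartesian_product power3_eq_cube)
  have f01: "0 \<le> f \<omega> \<and> f \<omega> \<le> 1" for \<omega> by (simp add: f_def edge_ind_def case_prod_unfold)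
  have g01: "0 \<le> g (x, y, z) \<and> g (x, y, z) \<le> 1" if "x \<in> V" "y \<in> V" "z \<in> V" for x y z
    unfolding g_def using cexp_bounds[of ?\<Omega> f "(x, y, z)" S] f01 that V by auto
  have cut: "\<bar>\<Sum>x\<in>V. \<Sum>y\<in>V. \<Sum>z\<in>V. d x y z * (of_bool ((x, y) \<in> U1) * of_bool ((x, z) \<in> U2) * of_bool ((y, z) \<in> U3))\<bar>
      \<le> \<eta> * ?n ^ 3" for U1 U2 U3
  proof -
    let ?B1 = "{(x, y, z). (x, y) \<in> U1}" and ?B2 = "{(x, y, z). (x, z) \<in> U2}" and ?B3 = "{(x, y, z). (y, z) \<in> U3}"
    have "?B1 \<in> pair_cylinders" "?B2 \<in> pair_cylinders" "?B3 \<in> pair_cylinders"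
      unfolding pair_cylinders_def by blast+
    then have "\<bar>\<Sum>\<omega>\<in>?\<Omega> \<inter> (?B1 \<inter> ?B2 \<inter> ?B3). f \<omega> - g \<omega>\<bar> \<le> \<eta> * ?n ^ 3"
      using reg unfolding cut_regular_def f_def[symmetric] g_def[symmetric] \<eta>_def[symmetric] cO by blast
    moreover have "(\<Sum>\<omega>\<in>?\<Omega> \<inter> (?B1 \<inter> ?B2 \<inter> ?B3). f \<omega> - g \<omega>) =
      (\<Sum>\<omega>\<in>?\<Omega>. if \<omega> \<in> ?B1 \<inter> ?B2 \<inter> ?B3 then f \<omega> - g \<omega> else 0)"
      using V by (intro sum.inter_restrict) auto
    moreover have "\<dots> = (\<Sum>x\<in>V. \<Sum>y\<in>V. \<Sum>z\<in>V. d x y z * (of_bool ((x, y) \<in> U1) * of_bool ((x, z) \<in> U2) * of_bool ((y, z) \<in> U3)))"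
      unfolding sum_Times by (intro sum.cong refl) (auto simp: d_def)
    ultimately show ?thesis by simp
  qed
  have test: "\<bar>\<Sum>x\<in>V. \<Sum>y\<in>V. \<Sum>z\<in>V. d x y z * (u x y * v x z * w y z)\<bar> \<le> \<eta> * ?n ^ 3"
    if "\<And>x y. x \<in> V \<Longrightarrow> y \<in> V \<Longrightarrow> 0 \<le> u x y \<and> u x y \<le> 1 \<and> 0 \<le> v x y \<and> v x y \<le> 1 \<and> 0 \<le> w x y \<and> w x y \<le> 1"
    for u v w
  proof -
    have "(\<Sum>x\<in>V. \<Sum>y\<in>V. \<Sum>z\<in>V. d x y z * (u x y * v x z * w y z)) \<le> \<eta> * ?n ^ 3"
    proof (rule cut_fractional_le)
      show "(\<Sum>x\<in>V. \<Sum>y\<in>V. \<Sum>z\<in>V. d x y z * (of_bool ((x, y) \<in> U1) * of_bool ((x, z) \<in> U2) * of_bool ((y, z) \<in> U3))) \<le> \<eta> * ?n ^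
          3"
        for U1 U2 U3 using cut[of U1 U2 U3] by linarith
    qed (rule that)
    moreover have "(\<Sum>x\<in>V. \<Sum>y\<in>V. \<Sum>z\<in>V. - d x y z * (u x y * v x z * w y z)) \<le> \<eta> * ?n ^ 3"
    proof (rule cut_fractional_le)
      show "(\<Sum>x\<in>V. \<Sum>y\<in>V. \<Sum>z\<in>V. - d x y z * (of_bool ((x, y) \<in> U1) * of_bool ((x, z) \<in> U2) * of_bool ((y, z) \<in> U3))) \<le> \<eta> * ?n
          ^ 3"
        for U1 U2 U3 using cut[of U1 U2 U3] unfolding mult_minus_left sum_negf by linarith
    qed (rule that)
    ultimately show ?thesis by (simp add: sum_negf abs_le_iff)
  qed
  have "\<bar>pcount V ?I ?J ?J p - pcount V ?I ?J ?J q\<bar>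
      \<le> real (card ?I * card ?J * card ?J) * \<eta> * ?n ^ (card ?I + card ?J + card ?J)"
  proof (rule pcount_diff)
    fix e :: "(nat \<times> nat) set \<times> nat \<times> nat" and u v w :: "'a \<Rightarrow> 'a \<Rightarrow> real"
    assume *: "\<And>x y. x \<in> V \<Longrightarrow> y \<in> V \<Longrightarrow>
        0 \<le> u x y \<and> u x y \<le> 1 \<and> 0 \<le> v x y \<and> v x y \<le> 1 \<and> 0 \<le> w x y \<and> w x y \<le> 1"
    show "\<bar>\<Sum>x\<in>V. \<Sum>y\<in>V. \<Sum>z\<in>V. (p e x y z - q e x y z) * (u x y * v x z * w y z)\<bar> \<le> \<eta> * ?n ^ 3"
    proof (cases "(fst (snd e), snd (snd e)) \<in> fst e")
      case True
      then have "p e x y z - q e x y z = d x y z" for x y z by (simp add: p_def q_def d_def)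
      then show ?thesis using test[of u v w] * by simp
    next
      case False
      then have "p e x y z - q e x y z = - d x y z" for x y z by (simp add: p_def q_def d_def)
      then show ?thesis using test[of u v w] * by (simp add: sum_negf)
    qed
  qed (use V f01 g01 in \<open>auto simp: p_def q_def\<close>)
  moreover have "pcount V ?I ?J ?J p = 0"
    by (rule pcount_pattern_eq_0[OF V(1) nr]) (simp add: p_def f_def edge_ind_def)
  moreover have "pcount V ?I ?J ?J (\<lambda>_. w) \<le> pcount V ?I ?J ?J q"
    unfolding pcount_def
  proof (intro sum_mono prod_mono)
    fix a b c e assume abc: "a \<in> PiE ?I (\<lambda>_. V)" "b \<in> PiE ?J (\<lambda>_. V)" "c \<in> PiE ?J (\<lambda>_. V)" "e \<in> ?I \<times> ?J \<times> ?J"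
    define x y z where "x = a (fst e)" and "y = b (fst (snd e))" and "z = c (snd (snd e))"
    have "x \<in> V" "y \<in> V" "z \<in> V"
      unfolding x_def y_def z_def using PiE_mem[OF abc(1), of "fst e"] PiE_mem[OF abc(2), of "fst (snd e)"]
        PiE_mem[OF abc(3), of "snd (snd e)"] abc(4) by (simp_all only: mem_Times_iff)
    then have "0 \<le> g (x, y, z) \<and> g (x, y, z) \<le> 1" by (rule g01)
    then show "0 \<le> w (a (fst e)) (b (fst (snd e))) (c (snd (snd e))) \<and>
        w (a (fst e)) (b (fst (snd e))) (c (snd (snd e))) \<le> q e (a (fst e)) (b (fst (snd e))) (c (snd (snd e)))"
      unfolding x_def[symmetric] y_def[symmetric] z_def[symmetric] w_def q_def
      by (auto simp: mult_left_le mult_left_le_one_le)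
  qed
  moreover have "?n ^ (card ?I + card ?J + card ?J) * A ^ (card ?I * card ?J * card ?J) \<le> pcount V ?I ?J ?J (\<lambda>_. w)"
    unfolding A_def using V g01 by (intro pcount_lower) (auto simp: w_def)
  moreover have cM: "card ?I * card ?J * card ?J = M" using M by simp
  ultimately have "?n ^ s * A ^ M \<le> real M * \<eta> * ?n ^ s"
    unfolding s_def cM by linarith
  then have "A ^ M \<le> real M * \<eta>" using n by (simp add: mult.commute)
  also have "\<dots> < \<delta> ^ M"
    using \<delta> by (simp add: \<eta>_def field_simps add_nonneg_pos)
  finally have "A < \<delta>" using \<delta> by (intro power_less_imp_less_base[of A M \<delta>]) auto
  then have "(\<Sum>x\<in>V. \<Sum>y\<in>V. \<Sum>z\<in>V. w x y z) \<le> \<delta> * ?n ^ 3"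
    using n by (simp add: A_def pos_divide_less_eq)
  then show ?thesis unfolding sum_Times w_def g_def f_def .
qed

section \<open>Rounding the conditional expectation to a function of pair colours\<close>

text \<open>The rounded function \<open>h\<close> is constant on cells, so in the sum of
  \<open>f + h - 2 * f * h\<close>, which counts the errors, \<open>f\<close> may be replaced by its
  expectation \<open>g\<close>. Then \<open>g + h - 2 * g * h\<close> is the minimum of
  \<open>g\<close> and \<open>1 - g\<close>, which is at most
  \<open>2 * g * (1 - g)\<close>.\<close>

lemma cexp_rounding_error:
  assumes "finite \<Omega>" "\<And>\<omega>. \<omega> \<in> \<Omega> \<Longrightarrow> f \<omega> = 0 \<or> f \<omega> = (1::real)"
  shows "real (card {\<omega> \<in> \<Omega>. (f \<omega> = 1) \<noteq> (cexp \<Omega> S f \<omega> \<ge> 1 / 2)})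
    \<le> 2 * (\<Sum>\<omega>\<in>\<Omega>. cexp \<Omega> S f \<omega> * (1 - cexp \<Omega> S f \<omega>))"
proof -
  let ?g = "cexp \<Omega> S f"
  define h :: "'a \<Rightarrow> real" where "h \<omega> = of_bool (?g \<omega> \<ge> 1 / 2)" for \<omega>
  have f01: "0 \<le> f \<omega> \<and> f \<omega> \<le> 1" if "\<omega> \<in> \<Omega>" for \<omega> using assms(2)[OF that] by auto
  have "real (card {\<omega> \<in> \<Omega>. (f \<omega> = 1) \<noteq> (?g \<omega> \<ge> 1 / 2)}) = (\<Sum>\<omega>\<in>\<Omega>. of_bool ((f \<omega> = 1) \<noteq> (?g \<omega> \<ge> 1 / 2)))"
    using assms(1) by (simp add: of_bool_def sum.If_cases Int_def)
  also have "\<dots> = (\<Sum>\<omega>\<in>\<Omega>. f \<omega> * 1 + h \<omega> - 2 * (f \<omega> * h \<omega>))"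
    using assms(2) by (intro sum.cong) (auto simp: h_def)
  also have "\<dots> = (\<Sum>\<omega>\<in>\<Omega>. f \<omega> * 1) + (\<Sum>\<omega>\<in>\<Omega>. h \<omega>) - 2 * (\<Sum>\<omega>\<in>\<Omega>. f \<omega> * h \<omega>)"
    by (simp add: sum.distrib sum_subtractf sum_distrib_left)
  also have "(\<Sum>\<omega>\<in>\<Omega>. f \<omega> * 1) = (\<Sum>\<omega>\<in>\<Omega>. ?g \<omega> * 1)"
    by (rule sum_cexp_mult[symmetric]) (use assms in auto)
  also have "(\<Sum>\<omega>\<in>\<Omega>. f \<omega> * h \<omega>) = (\<Sum>\<omega>\<in>\<Omega>. ?g \<omega> * h \<omega>)"
    by (rule sum_cexp_mult[symmetric]) (use assms in \<open>auto simp: h_def cexp_cong_cell\<close>)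
  also have "(\<Sum>\<omega>\<in>\<Omega>. ?g \<omega> * 1) + (\<Sum>\<omega>\<in>\<Omega>. h \<omega>) - 2 * (\<Sum>\<omega>\<in>\<Omega>. ?g \<omega> * h \<omega>) =
      (\<Sum>\<omega>\<in>\<Omega>. ?g \<omega> + h \<omega> - 2 * (?g \<omega> * h \<omega>))"
    by (simp add: sum.distrib sum_subtractf sum_distrib_left)
  also have "\<dots> \<le> (\<Sum>\<omega>\<in>\<Omega>. 2 * (?g \<omega> * (1 - ?g \<omega>)))"
  proof (rule sum_mono)
    fix \<omega> assume "\<omega> \<in> \<Omega>"
    then have g: "0 \<le> ?g \<omega>" "?g \<omega> \<le> 1" using cexp_bounds[OF assms(1) f01] by auto
    show "?g \<omega> + h \<omega> - 2 * (?g \<omega> * h \<omega>) \<le> 2 * (?g \<omega> * (1 - ?g \<omega>))"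
    proof (cases "?g \<omega> \<ge> 1 / 2")
      case True
      then have "0 \<le> (2 * ?g \<omega> - 1) * (1 - ?g \<omega>)" using g by (intro mult_nonneg_nonneg) auto
      then show ?thesis using True by (simp add: h_def algebra_simps)
    next
      case False
      then have "0 \<le> ?g \<omega> * (1 - 2 * ?g \<omega>)" using g by (intro mult_nonneg_nonneg) auto
      then show ?thesis using False by (simp add: h_def algebra_simps)
    qed
  qed
  finally show ?thesis by (simp add: sum_distrib_left)
qed

text \<open>One labelling serves all three pairs of coordinates: \<open>\<tau> x y\<close> encodes
  the set of those \<open>B \<in> S\<close> whose binary relation \<open>u B\<close> contains
  \<open>(x, y)\<close>, regardless of which coordinates \<open>B\<close> looks at.\<close>

lemma pair_cylinders_labelling:
  assumes "S \<subseteq> pair_cylinders" "finite S"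
  shows "\<exists>\<tau> :: 'a \<Rightarrow> 'a \<Rightarrow> nat. (\<forall>x y. \<tau> x y < 2 ^ card S) \<and>
    (\<forall>x y z x' y' z'. \<tau> x y = \<tau> x' y' \<longrightarrow> \<tau> x z = \<tau> x' z' \<longrightarrow> \<tau> y z = \<tau> y' z' \<longrightarrow>
       (\<forall>B\<in>S. (x, y, z) \<in> B \<longleftrightarrow> (x', y', z') \<in> B))"
proof -
  have "\<exists>U. (\<forall>x y z. (x, y, z) \<in> B \<longleftrightarrow> (x, y) \<in> U) \<or> (\<forall>x y z. (x, y, z) \<in> B \<longleftrightarrow> (x, z) \<in> U) \<or>
      (\<forall>x y z. (x, y, z) \<in> B \<longleftrightarrow> (y, z) \<in> U)" if "B \<in> S" for B
  proof -
    have "B \<in> pair_cylinders" using assms(1) that by blast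
    then show ?thesis unfolding pair_cylinders_def by (elim UnE rangeE) (simp; blast)+
  qed
  then obtain u where u: "\<And>B. B \<in> S \<Longrightarrow> (\<forall>x y z. (x, y, z) \<in> B \<longleftrightarrow> (x, y) \<in> u B) \<or>
      (\<forall>x y z. (x, y, z) \<in> B \<longleftrightarrow> (x, z) \<in> u B) \<or> (\<forall>x y z. (x, y, z) \<in> B \<longleftrightarrow> (y, z) \<in> u B)" by metis
  have "card (Pow S) = 2 ^ card S" using assms(2) by (rule card_Pow)
  then obtain enc :: "('a \<times> 'a \<times> 'a) set set \<Rightarrow> nat" where enc: "bij_betw enc (Pow S) {0..<2 ^ card S}"
    using ex_bij_betw_finite_nat[of "Pow S"] assms(2) by auto
  define \<tau> where "\<tau> x y = enc {B \<in> S. (x, y) \<in> u B}" for x y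
  have lt: "\<tau> x y < 2 ^ card S" for x y
    using bij_betw_apply[OF enc, of "{B \<in> S. (x, y) \<in> u B}"] by (auto simp: \<tau>_def)
  have eq: "(x, y) \<in> u B \<longleftrightarrow> (x', y') \<in> u B" if "\<tau> x y = \<tau> x' y'" "B \<in> S" for x y x' y' B
  proof -
    have "{B \<in> S. (x, y) \<in> u B} = {B \<in> S. (x', y') \<in> u B}"
      using bij_betw_imp_inj_on[OF enc] that(1) unfolding \<tau>_def by (auto dest!: inj_onD)
    then show ?thesis using that(2) by blast
  qed
  have same: "(x, y, z) \<in> B \<longleftrightarrow> (x', y', z') \<in> B"
    if "\<tau> x y = \<tau> x' y'" "\<tau> x z = \<tau> x' z'" "\<tau> y z = \<tau> y' z'" "B \<in> S" for x y z x' y' z' B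
    using u[OF that(4)]
  proof (elim disjE)
    assume "\<forall>x y z. (x, y, z) \<in> B \<longleftrightarrow> (x, y) \<in> u B"
    then show ?thesis using eq[OF that(1,4)] by simp
  next
    assume "\<forall>x y z. (x, y, z) \<in> B \<longleftrightarrow> (x, z) \<in> u B"
    then show ?thesis using eq[OF that(2,4)] by simp
  next
    assume "\<forall>x y z. (x, y, z) \<in> B \<longleftrightarrow> (y, z) \<in> u B"
    then show ?thesis using eq[OF that(3,4)] by simp
  qed
  show ?thesis by (intro exI[of _ \<tau>] conjI allI impI ballI) (rule lt | rule same, assumption+)+
qed

text \<open>The conditional expectation over a weakly regular family of cylinders is a function of
  the three labels, and \<open>D\<close> collects the label triples where it is at least 1/2.
  Forbidden patterns make this rounding accurate.\<close>

lemma VC2_binary_approximation: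
  fixes \<delta> :: real
  assumes \<delta>: "\<delta> > 0"
  shows "\<exists>m::nat. \<forall>(V :: 'a set) F. finite V \<longrightarrow> V \<noteq> {} \<longrightarrow> \<not> VC2_realised V F k \<longrightarrow>
    (\<exists>(\<tau> :: 'a \<Rightarrow> 'a \<Rightarrow> nat) D. (\<forall>x y. \<tau> x y < m) \<and>
       real (card {(x, y, z) \<in> V \<times> V \<times> V. ({x, y, z} \<in> F) \<noteq> ((\<tau> x y, \<tau> x z, \<tau> y z) \<in> D)})
         \<le> \<delta> * real (card V) ^ 3)"
proof -
  define M where "M = card (Pow ({1..k} \<times> {1..k})) * k * k"
  \<comment> \<open>Half of \<open>\<delta>\<close>, since rounding costs twice the mean of
    \<open>g * (1 - g)\<close>.\<close>
  define \<eta> where "\<eta> = (\<delta> / 2) ^ M / (2 * real (M + 1))"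
  define K where "K = 3 * nat \<lceil>2 / \<eta>\<^sup>2\<rceil>"
  have \<eta>: "\<eta> > 0" using \<delta> by (simp add: \<eta>_def)
  show ?thesis
  proof (intro exI[of _ "2 ^ K"] allI impI)
    fix V :: "'a set" and F
    assume V: "finite V" "V \<noteq> {}" and nr: "\<not> VC2_realised V F k"
    let ?\<Omega> = "V \<times> V \<times> V"
    let ?f = "edge_ind F"
    have f: "0 \<le> ?f \<omega> \<and> ?f \<omega> \<le> 1" "?f \<omega> = 0 \<or> ?f \<omega> = 1" for \<omega> by (auto simp: edge_ind_def case_prod_unfold)
    obtain S where S: "S \<subseteq> pair_cylinders" "finite S" "card S \<le> K" "cut_regular ?\<Omega> pair_cylinders ?f S \<eta>"
      using weak_regularity[of ?\<Omega> ?f \<eta> "{}" pair_cylinders] V f \<eta> unfolding K_def by auto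
    let ?g = "cexp ?\<Omega> S ?f"
    obtain \<tau> :: "'a \<Rightarrow> 'a \<Rightarrow> nat" where \<tau>: "\<And>x y. \<tau> x y < 2 ^ card S"
      "\<And>x y z x' y' z' B. \<tau> x y = \<tau> x' y' \<Longrightarrow> \<tau> x z = \<tau> x' z' \<Longrightarrow> \<tau> y z = \<tau> y' z' \<Longrightarrow> B \<in> S \<Longrightarrow>
       (x, y, z) \<in> B \<longleftrightarrow> (x', y', z') \<in> B"
      using pair_cylinders_labelling[OF S(1,2)] by metis
    define D where "D = {(\<tau> x y, \<tau> x z, \<tau> y z) | x y z. (x, y, z) \<in> ?\<Omega> \<and> ?g (x, y, z) \<ge> 1 / 2}"
    have D: "(\<tau> x y, \<tau> x z, \<tau> y z) \<in> D \<longleftrightarrow> ?g (x, y, z) \<ge> 1 / 2" if "(x, y, z) \<in> ?\<Omega>" for x y z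
    proof
      assume "(\<tau> x y, \<tau> x z, \<tau> y z) \<in> D"
      then obtain x' y' z' where *: "\<tau> x y = \<tau> x' y'" "\<tau> x z = \<tau> x' z'" "\<tau> y z = \<tau> y' z'"
        "(x', y', z') \<in> ?\<Omega>" "?g (x', y', z') \<ge> 1 / 2" by (auto simp: D_def)
      have "(x, y, z) \<in> cell ?\<Omega> S (x', y', z')"
        using that \<tau>(2)[OF *(1-3)] by (auto simp: cell_def)
      then show "?g (x, y, z) \<ge> 1 / 2" using *(5) cexp_cong_cell by metis
    qed (use that in \<open>auto simp: D_def\<close>)
    have "{(x, y, z) \<in> ?\<Omega>. ({x, y, z} \<in> F) \<noteq> ((\<tau> x y, \<tau> x z, \<tau> y z) \<in> D)} =
        {\<omega> \<in> ?\<Omega>. (?f \<omega> = 1) \<noteq> (?g \<omega> \<ge> 1 / 2)}"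
      using D by (auto simp: edge_ind_def)
    then have "real (card {(x, y, z) \<in> ?\<Omega>. ({x, y, z} \<in> F) \<noteq> ((\<tau> x y, \<tau> x z, \<tau> y z) \<in> D)})
        \<le> 2 * (\<Sum>\<omega>\<in>?\<Omega>. ?g \<omega> * (1 - ?g \<omega>))"
      using cexp_rounding_error[of ?\<Omega> ?f S] V f by simp
    also have "\<dots> \<le> 2 * (\<delta> / 2 * real (card V) ^ 3)"
      using VC2_cexp_near_01[OF V nr _ M_def S(4)[unfolded \<eta>_def]] \<delta> by simp
    finally have "real (card {(x, y, z) \<in> ?\<Omega>. ({x, y, z} \<in> F) \<noteq> ((\<tau> x y, \<tau> x z, \<tau> y z) \<in> D)})
        \<le> \<delta> * real (card V) ^ 3" by simp
    moreover have "\<tau> x y < 2 ^ K" for x y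
      using order_less_le_trans[OF \<tau>(1) power_increasing[OF S(3), of "2::nat"]] by simp
    ultimately show "\<exists>(\<tau> :: 'a \<Rightarrow> 'a \<Rightarrow> nat) D. (\<forall>x y. \<tau> x y < 2 ^ K) \<and>
       real (card {(x, y, z) \<in> V \<times> V \<times> V. ({x, y, z} \<in> F) \<noteq> ((\<tau> x y, \<tau> x z, \<tau> y z) \<in> D)})
         \<le> \<delta> * real (card V) ^ 3" by blast
  qed
qed

subsection \<open>Equitable regular partitions\<close>

lemma sorted_enumeration:
  fixes q :: "'a \<Rightarrow> nat"
  assumes "finite V"
  shows "\<exists>\<sigma>. bij_betw \<sigma> {..<card V} V \<and> (\<forall>i j. i \<le> j \<longrightarrow> j < card V \<longrightarrow> q (\<sigma> i) \<le> q (\<sigma> j))"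
proof -
  obtain xs where xs: "set xs = V" "distinct xs" using finite_distinct_list[OF assms] by blast
  define ys where "ys = sort_key q xs"
  have ys: "set ys = V" "distinct ys" "sorted (map q ys)" by (simp_all add: ys_def xs)
  then have len: "length ys = card V" using distinct_card by metis
  have "bij_betw ((!) ys) {..<card V} V" using bij_betw_nth[OF ys(2)] ys(1) len by auto
  moreover have "q (ys ! i) \<le> q (ys ! j)" if "i \<le> j" "j < card V" for i j
    using sorted_nth_mono[OF ys(3) that(1)] that len by simp
  ultimately show ?thesis by blast
qed

text \<open>
  Sort \<open>V\<close> by the label \<open>q\<close> and cut it into intervals of nearly equal length: an interval that
  is not constant for \<open>q\<close> contains a jump of the sorted labels.
\<close>

lemma equitable_partition:
  fixes q :: "'a \<Rightarrow> nat"
  assumes V: "finite V" and t: "1 \<le> t" "t \<le> card V" and q: "\<And>x. x \<in> V \<Longrightarrow> q x < R"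
  shows "\<exists>\<pi>::'a \<Rightarrow> nat. (\<forall>x\<in>V. \<pi> x \<in> {1..t}) \<and>
    (\<forall>i\<in>{1..t}. card V div t \<le> card {x \<in> V. \<pi> x = i} \<and> card {x \<in> V. \<pi> x = i} \<le> card V div t + 1) \<and>
    (\<forall>i\<in>{1..t}. \<forall>j\<in>{1..t}. i \<le> j \<longrightarrow> card {x \<in> V. \<pi> x = i} \<le> card {x \<in> V. \<pi> x = j}) \<and>
    card {i \<in> {1..t}. \<exists>x\<in>V. \<exists>y\<in>V. \<pi> x = i \<and> \<pi> y = i \<and> q x \<noteq> q y} \<le> R"
proof -
  let ?n = "card V"
  define s r where "s = ?n div t" and "r = ?n mod t"
  \<comment> \<open>The right end of the \<open>i\<close>-th interval. By truncated subtraction only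
    the last \<open>r\<close> intervals receive an extra element, so the sizes are nondecreasing, as
    \<open>decomposition\<close> demands.\<close>
  define p where "p i = i * s + (i - (t - r))" for i
  have r: "r < t" using t by (simp add: r_def)
  have p0: "p 0 = 0" and pt: "p t = ?n" using r by (auto simp: p_def s_def r_def)
  have pS: "p (Suc i) = p i + s + (if i \<ge> t - r then 1 else 0)" for i by (auto simp: p_def)
  have pmono: "p i \<le> p j" if "i \<le> j" for i j using that unfolding p_def by (intro add_mono mult_right_mono diff_le_mono) auto
  obtain \<sigma> where \<sigma>: "bij_betw \<sigma> {..<?n} V" and sort: "\<And>i j. i \<le> j \<Longrightarrow> j < ?n \<Longrightarrow> q (\<sigma> i) \<le> q (\<sigma> j)"
    using sorted_enumeration[OF V, of q] by blast
  define \<iota> where "\<iota> j = (LEAST i. j < p i)" for j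
  have \<iota>: "\<iota> j \<in> {1..t} \<and> p (\<iota> j - 1) \<le> j \<and> j < p (\<iota> j)" if "j < ?n" for j
  proof -
    have ex: "j < p t" using that pt by simp
    have 1: "j < p (\<iota> j)" unfolding \<iota>_def using ex by (rule LeastI)
    have 2: "\<iota> j \<le> t" unfolding \<iota>_def using ex by (rule Least_le)
    have 3: "\<iota> j \<noteq> 0" using 1 p0 by (metis not_less_zero)
    have "\<not> j < p (\<iota> j - 1)" unfolding \<iota>_def by (rule not_less_Least) (use 3 in \<open>simp add: \<iota>_def\<close>)
    then show ?thesis using 1 2 3 by auto
  qed
  have \<iota>_iff: "\<iota> j = i \<longleftrightarrow> p (i - 1) \<le> j \<and> j < p i" if "j < ?n" "i \<in> {1..t}" for i j
  proof
    assume *: "p (i - 1) \<le> j \<and> j < p i"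
    have "\<not> \<iota> j < i" using \<iota>[OF that(1)] * pmono[of "\<iota> j" "i - 1"] by fastforce
    moreover have "\<not> i < \<iota> j" using \<iota>[OF that(1)] * pmono[of i "\<iota> j - 1"] by fastforce
    ultimately show "\<iota> j = i" by simp
  qed (use \<iota> that in auto)
  define \<pi> where "\<pi> x = \<iota> (inv_into {..<?n} \<sigma> x)" for x
  have \<pi>\<sigma>: "\<pi> (\<sigma> j) = \<iota> j" if "j < ?n" for j
    using \<sigma> that by (simp add: \<pi>_def bij_betw_inv_into_left)
  have ex\<sigma>: "\<exists>j<?n. x = \<sigma> j" if "x \<in> V" for x using \<sigma> that by (auto simp: bij_betw_def)
  have \<sigma>V: "\<sigma> j \<in> V" if "j < ?n" for j using \<sigma> that by (auto simp: bij_betw_def)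
  have pn: "p i \<le> ?n" if "i \<le> t" for i using pmono[OF that] pt by simp
  have part: "{x \<in> V. \<pi> x = i} = \<sigma> ` {p (i - 1)..<p i}" if i: "i \<in> {1..t}" for i
  proof (intro equalityI subsetI)
    fix x assume "x \<in> {x \<in> V. \<pi> x = i}"
    then have x: "x \<in> V" "\<pi> x = i" by auto
    then obtain j where "j < ?n" "x = \<sigma> j" using ex\<sigma> by blast
    then have "j < ?n" "x = \<sigma> j" "\<iota> j = i" using \<pi>\<sigma> x by auto
    then show "x \<in> \<sigma> ` {p (i - 1)..<p i}" using \<iota>_iff[OF _ i] by auto
  next
    fix x assume "x \<in> \<sigma> ` {p (i - 1)..<p i}"
    then obtain j where j: "x = \<sigma> j" "p (i - 1) \<le> j" "j < p i" by auto
    then have "j < ?n" using pn[of i] i by auto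
    then show "x \<in> {x \<in> V. \<pi> x = i}" using j \<iota>_iff[OF _ i, of j] \<pi>\<sigma> \<sigma>V by auto
  qed
  have cpart: "card {x \<in> V. \<pi> x = i} = s + (if i - 1 \<ge> t - r then 1 else 0)" if i: "i \<in> {1..t}" for i
  proof -
    have "{p (i - 1)..<p i} \<subseteq> {..<?n}" using pn[of i] i by auto
    then have "inj_on \<sigma> {p (i - 1)..<p i}" using \<sigma> by (meson bij_betw_def inj_on_subset)
    then have "card {x \<in> V. \<pi> x = i} = p i - p (i - 1)" using part[OF i] by (simp add: card_image)
    moreover have "p i = p (i - 1) + s + (if i - 1 \<ge> t - r then 1 else 0)" using pS[of "i - 1"] i by simp
    ultimately show ?thesis by simp
  qed
  define Imp where "Imp = {i \<in> {1..t}. \<exists>x\<in>V. \<exists>y\<in>V. \<pi> x = i \<and> \<pi> y = i \<and> q x \<noteq> q y}"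
  \<comment> \<open>The last label in the interval. It is strictly increasing along the intervals
    that are not constant for \<open>q\<close>, so there are at most \<open>R\<close> of
    them.\<close>
  define \<phi> where "\<phi> i = q (\<sigma> (p i - 1))" for i
  have s1: "s \<ge> 1" using t by (simp add: s_def div_greater_zero_iff Suc_leI)
  have plt: "p (i - 1) < p i" if "i \<ge> 1" for i using pS[of "i - 1"] s1 that by simp
  have jump: "q (\<sigma> (p (i - 1))) < \<phi> i" if imp_i: "i \<in> Imp" for i
  proof -
    have i: "i \<in> {1..t}" using imp_i by (simp add: Imp_def)
    obtain x' y' where "x' \<in> V" "y' \<in> V" "\<pi> x' = i" "\<pi> y' = i" "q x' \<noteq> q y'"
      using imp_i unfolding Imp_def by blast
    then obtain x y where xy: "x \<in> V" "y \<in> V" "\<pi> x = i" "\<pi> y = i" "q x < q y"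
      by (metis neq_iff)
    obtain j k where jk: "j < ?n" "k < ?n" "x = \<sigma> j" "y = \<sigma> k" using xy ex\<sigma> by metis
    then have j: "p (i - 1) \<le> j" "j < p i" and k: "p (i - 1) \<le> k" "k < p i"
      using xy \<iota>_iff[OF _ i] \<pi>\<sigma> by auto
    have "p i - 1 < ?n" using pn[of i] plt[of i] i by auto
    then have "q (\<sigma> (p (i - 1))) \<le> q x" "q y \<le> \<phi> i"
      unfolding \<phi>_def jk(3,4) using j k jk by (auto intro!: sort)
    then show ?thesis using xy by simp
  qed
  have "\<phi> i < \<phi> i'" if "i \<in> Imp" "i' \<in> Imp" "i < i'" for i i'
  proof -
    have i: "i \<in> {1..t}" "i' \<in> {1..t}" using that by (auto simp: Imp_def)
    have "i \<le> i' - 1" using that by linarith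
    then have "p i - 1 \<le> p (i' - 1)" using pmono[of i "i' - 1"] by linarith
    moreover have "p (i' - 1) < ?n" using plt[of i'] pn[of i'] i by auto
    ultimately have "\<phi> i \<le> q (\<sigma> (p (i' - 1)))" unfolding \<phi>_def by (rule sort)
    then show ?thesis using jump[OF that(2)] by simp
  qed
  then have "inj_on \<phi> Imp" by (intro inj_onI) (metis neq_iff)
  moreover have "\<phi> ` Imp \<subseteq> {..<R}"
  proof
    fix v assume "v \<in> \<phi> ` Imp"
    then obtain i where i: "i \<in> {1..t}" "v = \<phi> i" by (auto simp: Imp_def)
    then have "p i - 1 < ?n" using plt[of i] pn[of i] by auto
    then show "v \<in> {..<R}" using q[OF \<sigma>V] i by (simp add: \<phi>_def)
  qed
  ultimately have "card Imp \<le> R" using card_inj_on_le[of \<phi> Imp "{..<R}"] by simp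
  moreover have "\<pi> x \<in> {1..t}" if "x \<in> V" for x using ex\<sigma>[OF that] \<pi>\<sigma> \<iota> by auto
  ultimately show ?thesis using cpart by (intro exI[of _ \<pi>]) (auto simp: Imp_def s_def[symmetric])
qed

section \<open>Regular pairs and a regularity lemma for pair colourings\<close>

definition pair_dens :: "'a set \<Rightarrow> 'a set \<Rightarrow> ('a \<Rightarrow> 'a \<Rightarrow> nat) \<Rightarrow> nat \<Rightarrow> real" where
  "pair_dens X Y \<tau> c = real (card {(x, y) \<in> X \<times> Y. \<tau> x y = c}) / (real (card X) * real (card Y))"

definition reg_pair :: "real \<Rightarrow> 'a set \<Rightarrow> 'a set \<Rightarrow> ('a \<Rightarrow> 'a \<Rightarrow> nat) \<Rightarrow> bool" where
  "reg_pair \<epsilon> X Y \<tau> \<longleftrightarrow> (\<forall>c U W. U \<subseteq> X \<longrightarrow> W \<subseteq> Y \<longrightarrow>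
     \<bar>real (card {(x, y) \<in> U \<times> W. \<tau> x y = c}) - pair_dens X Y \<tau> c * real (card U) * real (card W)\<bar>
       \<le> \<epsilon> * real (card X) * real (card Y))"

lemma card_filter_Times:
  assumes "finite U" "finite W"
  shows "real (card {(x, y) \<in> U \<times> W. Q x y}) = (\<Sum>p\<in>U \<times> W. of_bool (Q (fst p) (snd p)))"
proof -
  have "{(x, y) \<in> U \<times> W. Q x y} = {p \<in> U \<times> W. Q (fst p) (snd p)}" by auto
  then show ?thesis using assms by (simp add: of_bool_def sum.If_cases Int_def)
qed

definition part :: "'a set \<Rightarrow> ('a \<Rightarrow> nat) \<Rightarrow> nat \<Rightarrow> 'a set" where
  "part V \<pi> i = {x \<in> V. \<pi> x = i}"

text \<open>Exceptional pairs of indices are ordered because \<open>\<tau> x y\<close> and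
  \<open>\<tau> y x\<close> may differ.\<close>

definition regular_partition :: "real \<Rightarrow> 'a set \<Rightarrow> ('a \<Rightarrow> 'a \<Rightarrow> nat) \<Rightarrow> nat \<Rightarrow> ('a \<Rightarrow> nat) \<Rightarrow> bool" where
  "regular_partition \<epsilon> V \<tau> t \<pi> \<longleftrightarrow> (\<forall>x\<in>V. \<pi> x \<in> {1..t}) \<and>
     (\<forall>i\<in>{1..t}. card V div t \<le> card (part V \<pi> i) \<and> card (part V \<pi> i) \<le> card V div t + 1) \<and>
     (\<forall>i\<in>{1..t}. \<forall>j\<in>{1..t}. i \<le> j \<longrightarrow> card (part V \<pi> i) \<le> card (part V \<pi> j)) \<and>
     real (card {(i, j) \<in> {1..t} \<times> {1..t}. \<not> reg_pair \<epsilon> (part V \<pi> i) (part V \<pi> j) \<tau>}) \<le> \<epsilon> * real t ^ 2"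

definition vertex_cylinders :: "('a \<times> 'a \<times> nat) set set" where
  "vertex_cylinders = range (\<lambda>A. A \<times> UNIV \<times> UNIV) \<union> range (\<lambda>A. UNIV \<times> A \<times> UNIV) \<union>
     range (\<lambda>c. UNIV \<times> UNIV \<times> {c})"

text \<open>One label per vertex covers both of its roles, as first and as second coordinate; a
  colour cylinder does not see the vertices at all.\<close>

lemma vertex_cylinders_labelling:
  assumes "S \<subseteq> vertex_cylinders" "finite S"
  shows "\<exists>q :: 'a \<Rightarrow> nat. (\<forall>x. q x < 2 ^ card S) \<and>
    (\<forall>x y x' y' c. q x = q x' \<longrightarrow> q y = q y' \<longrightarrow> (\<forall>B\<in>S. (x, y, c) \<in> B \<longleftrightarrow> (x', y', c) \<in> B))"
proof -
  have "\<exists>A. (\<forall>x y c. (x, y, c) \<in> B \<longleftrightarrow> x \<in> A) \<or> (\<forall>x y c. (x, y, c) \<in> B \<longleftrightarrow> y \<in> A) \<or>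
      (\<forall>x y x' y' c. (x, y, c) \<in> B \<longleftrightarrow> (x', y', c) \<in> B)" if "B \<in> S" for B
  proof -
    have "B \<in> vertex_cylinders" using assms(1) that by blast
    then show ?thesis unfolding vertex_cylinders_def by (elim UnE rangeE) (simp; blast)+
  qed
  then obtain u where u: "\<And>B. B \<in> S \<Longrightarrow> (\<forall>x y c. (x, y, c) \<in> B \<longleftrightarrow> x \<in> u B) \<or>
      (\<forall>x y c. (x, y, c) \<in> B \<longleftrightarrow> y \<in> u B) \<or> (\<forall>x y x' y' c. (x, y, c) \<in> B \<longleftrightarrow> (x', y', c) \<in> B)" by metis
  have "card (Pow S) = 2 ^ card S" using assms(2) by (rule card_Pow)
  then obtain enc :: "('a \<times> 'a \<times> nat) set set \<Rightarrow> nat" where enc: "bij_betw enc (Pow S) {0..<2 ^ card S}"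
    using ex_bij_betw_finite_nat[of "Pow S"] assms(2) by auto
  define q where "q x = enc {B \<in> S. x \<in> u B}" for x
  have lt: "q x < 2 ^ card S" for x
    using bij_betw_apply[OF enc, of "{B \<in> S. x \<in> u B}"] by (auto simp: q_def)
  have eq: "x \<in> u B \<longleftrightarrow> x' \<in> u B" if "q x = q x'" "B \<in> S" for x x' B
  proof -
    have "{B \<in> S. x \<in> u B} = {B \<in> S. x' \<in> u B}"
      using bij_betw_imp_inj_on[OF enc] that(1) unfolding q_def by (auto dest!: inj_onD)
    then show ?thesis using that(2) by blast
  qed
  have same: "(x, y, c) \<in> B \<longleftrightarrow> (x', y', c) \<in> B"
    if "q x = q x'" "q y = q y'" "B \<in> S" for x y x' y' c B
    using u[OF that(3)]
  proof (elim disjE)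
    assume "\<forall>x y c. (x, y, c) \<in> B \<longleftrightarrow> x \<in> u B"
    then show ?thesis using eq[OF that(1,3)] by simp
  next
    assume "\<forall>x y c. (x, y, c) \<in> B \<longleftrightarrow> y \<in> u B"
    then show ?thesis using eq[OF that(2,3)] by simp
  next
    assume "\<forall>x y x' y' c. (x, y, c) \<in> B \<longleftrightarrow> (x', y', c) \<in> B"
    then show ?thesis by iprover
  qed
  show ?thesis by (intro exI[of _ q] conjI allI impI ballI) (rule lt | rule same, assumption+)+
qed

text \<open>Any constants \<open>g c\<close> may stand in for the densities: the case
  \<open>U = X\<close>, \<open>W = Y\<close> shows that \<open>g c\<close> is within
  \<open>\<epsilon> / 2\<close> of the density, and the two errors add up.\<close>

lemma reg_pairI:
  assumes XY: "finite X" "finite Y" "X \<noteq> {}" "Y \<noteq> {}"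
    and g: "\<And>c U W. U \<subseteq> X \<Longrightarrow> W \<subseteq> Y \<Longrightarrow>
      \<bar>real (card {(x, y) \<in> U \<times> W. \<tau> x y = c}) - g c * real (card U) * real (card W)\<bar>
       \<le> \<epsilon> / 2 * (real (card X) * real (card Y))"
  shows "reg_pair \<epsilon> X Y \<tau>"
  unfolding reg_pair_def
proof (intro allI impI)
  fix c U W assume UW: "U \<subseteq> X" "W \<subseteq> Y"
  let ?a = "real (card X) * real (card Y)"
  have a: "?a > 0" using XY by (simp add: card_gt_0_iff)
  have d: "real (card {(x, y) \<in> X \<times> Y. \<tau> x y = c}) = pair_dens X Y \<tau> c * ?a"
    using a by (auto simp: pair_dens_def)
  have "\<bar>(pair_dens X Y \<tau> c - g c) * ?a\<bar> \<le> \<epsilon> / 2 * ?a"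
    using g[of X Y c] unfolding d by (simp add: algebra_simps)
  then have "\<bar>pair_dens X Y \<tau> c - g c\<bar> * ?a \<le> \<epsilon> / 2 * ?a" by (simp add: abs_mult)
  then have e: "\<bar>pair_dens X Y \<tau> c - g c\<bar> \<le> \<epsilon> / 2" using a mult_le_cancel_right_pos by blast
  then have e0: "0 \<le> \<epsilon> / 2" by linarith
  have b: "real (card U) * real (card W) \<le> ?a"
    using UW XY card_mono[of X U] card_mono[of Y W] by (intro mult_mono) auto
  have "\<bar>(pair_dens X Y \<tau> c - g c) * (real (card U) * real (card W))\<bar> \<le> \<epsilon> / 2 * ?a"
    using mult_mono[OF e b e0] by (simp add: abs_mult)
  then have "\<bar>pair_dens X Y \<tau> c * real (card U) * real (card W) - g c * real (card U) * real (card W)\<bar>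
      \<le> \<epsilon> / 2 * ?a" by (simp add: algebra_simps)
  with g[OF UW, of c] show "\<bar>real (card {(x, y) \<in> U \<times> W. \<tau> x y = c}) - pair_dens X Y \<tau> c * real (card U) * real (card W)\<bar>
       \<le> \<epsilon> * real (card X) * real (card Y)"
    unfolding mult.assoc[of \<epsilon>] by linarith
qed

text \<open>
  The regularity lemma for all colour classes of \<open>\<tau>\<close> at once. Strong regularity is applied to the
  indicator of \<open>\<tau> x y = c\<close> on triples \<open>(x, y, c)\<close>. On a pair of parts inside cells of the coarse
  family, this indicator is a constant plus a function that is small in \<open>L\<^sup>1\<close> for most pairs plus a
  function of cut norm tiny even compared with the size of a pair of parts.
\<close>

lemma graph_regularity:
  fixes \<epsilon> :: real
  assumes \<epsilon>: "\<epsilon> > 0" and m: "m \<ge> 1"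
  shows "\<exists>T. \<forall>(V :: 'a set) (\<tau> :: 'a \<Rightarrow> 'a \<Rightarrow> nat). finite V \<longrightarrow> T \<le> card V \<longrightarrow> V \<noteq> {} \<longrightarrow> (\<forall>x\<in>V. \<forall>y\<in>V. \<tau> x y < m) \<longrightarrow>
    (\<exists>t \<pi>. t0 \<le> t \<and> 1 \<le> t \<and> t \<le> T \<and> regular_partition \<epsilon> V \<tau> t \<pi>)"
proof -
  \<comment> \<open>At most \<open>2 ^ s\<close> parts meet several cells; with this many parts they
    are at most a fraction \<open>\<epsilon> / 4\<close> of all parts, and spoil at most
    \<open>\<epsilon> / 2 * t\<^sup>2\<close> pairs.\<close>
  define tt where "tt s = max (max t0 1) (nat \<lceil>4 * 2 ^ s / \<epsilon>\<rceil>)" for s :: nat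
  \<comment> \<open>The cut error is relative to \<open>m * n\<^sup>2\<close>, whereas a pair of
    parts has at least \<open>n\<^sup>2 / (4 * t\<^sup>2)\<close> elements; with this value the
    error is at most \<open>\<epsilon> / 4\<close> of the size of the pair.\<close>
  define \<eta> where "\<eta> s = \<epsilon> / (16 * real m * real (tt s) ^ 2)" for s
  \<comment> \<open>By Cauchy-Schwarz the difference of the two expectations has
    \<open>L\<^sup>1\<close> norm at most \<open>\<epsilon>\<^sup>2 / 32 * n\<^sup>2\<close>; by
    Markov's inequality it exceeds \<open>\<epsilon> / 4\<close> of the size of the pair on at most
    \<open>\<epsilon> / 2 * t\<^sup>2\<close> pairs of parts.\<close>
  define \<delta> where "\<delta> = (\<epsilon>\<^sup>2 / (32 * real m))\<^sup>2"
  have tt1: "tt s \<ge> 1" for s by (simp add: tt_def)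
  have "\<eta> s > 0" for s using \<epsilon> m tt1[of s] by (simp add: \<eta>_def)
  moreover have "\<delta> > 0" using \<epsilon> m by (simp add: \<delta>_def)
  ultimately have "\<exists>K. \<forall>(\<Omega> :: ('a \<times> 'a \<times> nat) set) f \<G>. finite \<Omega> \<longrightarrow> \<Omega> \<noteq> {} \<longrightarrow> (\<forall>\<omega>\<in>\<Omega>. 0 \<le> f \<omega> \<and> f \<omega> \<le> 1) \<longrightarrow>
    (\<exists>S S'. S \<subseteq> S' \<and> S' \<subseteq> \<G> \<and> finite S' \<and> card S \<le> K \<and> cut_regular \<Omega> \<G> f S' (\<eta> (card S)) \<and>
       (\<Sum>\<omega>\<in>\<Omega>. (cexp \<Omega> S' f \<omega> - cexp \<Omega> S f \<omega>)\<^sup>2) \<le> \<delta> * real (card \<Omega>))"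
    by (rule strong_regularity)
  then obtain K where K: "\<forall>(\<Omega> :: ('a \<times> 'a \<times> nat) set) f \<G>. finite \<Omega> \<longrightarrow> \<Omega> \<noteq> {} \<longrightarrow> (\<forall>\<omega>\<in>\<Omega>. 0 \<le> f \<omega> \<and> f \<omega> \<le> 1) \<longrightarrow>
    (\<exists>S S'. S \<subseteq> S' \<and> S' \<subseteq> \<G> \<and> finite S' \<and> card S \<le> K \<and> cut_regular \<Omega> \<G> f S' (\<eta> (card S)) \<and>
       (\<Sum>\<omega>\<in>\<Omega>. (cexp \<Omega> S' f \<omega> - cexp \<Omega> S f \<omega>)\<^sup>2) \<le> \<delta> * real (card \<Omega>))" ..
  define T where "T = (\<Sum>s\<le>K. tt s)"
  show ?thesis
  proof (rule exI[of _ T], intro allI impI)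
    fix V :: "'a set" and \<tau> :: "'a \<Rightarrow> 'a \<Rightarrow> nat"
    assume V: "finite V" "T \<le> card V" "V \<noteq> {}" and \<tau>: "\<forall>x\<in>V. \<forall>y\<in>V. \<tau> x y < m"
    let ?n = "real (card V)"
    let ?\<Omega> = "V \<times> V \<times> {..<m}"
    define f :: "'a \<times> 'a \<times> nat \<Rightarrow> real" where "f = (\<lambda>(x, y, c). of_bool (\<tau> x y = c))"
    have cO: "real (card ?\<Omega>) = real m * ?n\<^sup>2" by (simp add: card_cartesian_product power2_eq_square)
    have f: "\<forall>\<omega>\<in>?\<Omega>. 0 \<le> f \<omega> \<and> f \<omega> \<le> 1" by (auto simp: f_def)
    have "0 \<in> {..<m}" using m by simp
    then have "finite ?\<Omega>" "?\<Omega> \<noteq> {}" using V by blast+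
    from K[rule_format, where \<Omega> = ?\<Omega> and f = f and \<G> = vertex_cylinders, OF this f[rule_format]] obtain S S'
        where S: "S \<subseteq> S'" "S' \<subseteq> vertex_cylinders" "finite S'" "card S \<le> K"
      and reg: "cut_regular ?\<Omega> vertex_cylinders f S' (\<eta> (card S))"
      and l2: "(\<Sum>\<omega>\<in>?\<Omega>. (cexp ?\<Omega> S' f \<omega> - cexp ?\<Omega> S f \<omega>)\<^sup>2) \<le> \<delta> * real (card ?\<Omega>)" by blast
    have "S \<subseteq> vertex_cylinders" "finite S" using S finite_subset by auto
    from vertex_cylinders_labelling[OF this] obtain q :: "'a \<Rightarrow> nat" where q: "\<And>x. q x < 2 ^ card S"
      "\<And>x y x' y' c B. q x = q x' \<Longrightarrow> q y = q y' \<Longrightarrow> B \<in> S \<Longrightarrow> (x, y, c) \<in> B \<longleftrightarrow> (x', y', c) \<in> B" by metis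
    define t where "t = tt (card S)"
    have "t \<le> T" unfolding t_def T_def using S(4) by (intro member_le_sum) auto
    then have t: "1 \<le> t" "t \<le> card V" "t0 \<le> t" "t \<le> T" using V(2) tt1 by (auto simp: t_def tt_def)
    obtain \<pi> :: "'a \<Rightarrow> nat" where \<pi>: "\<forall>x\<in>V. \<pi> x \<in> {1..t}"
      and sz: "\<forall>i\<in>{1..t}. card V div t \<le> card {x \<in> V. \<pi> x = i} \<and> card {x \<in> V. \<pi> x = i} \<le> card V div t + 1"
      and srt: "\<forall>i\<in>{1..t}. \<forall>j\<in>{1..t}. i \<le> j \<longrightarrow> card {x \<in> V. \<pi> x = i} \<le> card {x \<in> V. \<pi> x = j}"
      and imp: "card {i \<in> {1..t}. \<exists>x\<in>V. \<exists>y\<in>V. \<pi> x = i \<and> \<pi> y = i \<and> q x \<noteq> q y} \<le> 2 ^ card S"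
      using equitable_partition[OF V(1) t(1,2), of q "2 ^ card S"] q(1) by blast
    define P where "P i = {x \<in> V. \<pi> x = i}" for i
    define Imp where "Imp = {i \<in> {1..t}. \<exists>x\<in>V. \<exists>y\<in>V. \<pi> x = i \<and> \<pi> y = i \<and> q x \<noteq> q y}"
    define g2 where "g2 \<omega> = cexp ?\<Omega> S' f \<omega> - cexp ?\<Omega> S f \<omega>" for \<omega>
    define w where "w i j = (\<Sum>\<omega>\<in>P i \<times> P j \<times> {..<m}. \<bar>g2 \<omega>\<bar>)" for i j
    define B2 where "B2 = {(i, j) \<in> {1..t} \<times> {1..t}. w i j > \<epsilon> / 4 * (real (card (P i)) * real (card (P j)))}"
    have finP: "finite (P i)" and PV: "P i \<subseteq> V" for i using V by (auto simp: P_def)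
    have half: "?n / (2 * real t) \<le> real (card (P i))" if "i \<in> {1..t}" for i
    proof -
      define s where "s = card V div t"
      have s: "s \<ge> 1" using t by (simp add: s_def div_greater_zero_iff Suc_leI)
      have "card V = t * s + card V mod t" by (simp add: s_def)
      also have "\<dots> \<le> t * s + t * 1" using t(1) by (intro add_left_mono) (simp add: less_imp_le)
      also have "\<dots> \<le> t * s + t * s" using s by (intro add_left_mono mult_left_mono) auto
      finally have "real (card V) \<le> real (2 * t * s)" by linarith
      then have "?n / (2 * real t) \<le> real s" using t(1) by (simp add: divide_le_eq mult.commute)
      also have "\<dots> \<le> real (card (P i))" using sz that by (simp add: s_def P_def)
      finally show ?thesis .
    qed
    have n: "?n > 0" using V by (simp add: card_gt_0_iff)
    have half2: "?n\<^sup>2 \<le> 4 * real t ^ 2 * (real (card (P i)) * real (card (P j)))" if "i \<in> {1..t}" "j \<in> {1..t}" for i j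
    proof -
      have "?n / (2 * real t) * (?n / (2 * real t)) \<le> real (card (P i)) * real (card (P j))"
        using half that n by (intro mult_mono) auto
      then show ?thesis using t(1) by (simp add: divide_le_eq power2_eq_square algebra_simps)
    qed
    have Pne: "P i \<noteq> {}" if "i \<in> {1..t}" for i
    proof
      assume "P i = {}"
      then show False using half[OF that] n t(1) by (simp add: divide_le_0_iff)
    qed
    have l1: "(\<Sum>\<omega>\<in>?\<Omega>. \<bar>g2 \<omega>\<bar>) \<le> \<epsilon>\<^sup>2 / 32 * ?n\<^sup>2"
    proof (rule power2_le_imp_le)
      have "(\<Sum>\<omega>\<in>?\<Omega>. \<bar>g2 \<omega>\<bar>)\<^sup>2 \<le> real (card ?\<Omega>) * (\<Sum>\<omega>\<in>?\<Omega>. \<bar>g2 \<omega>\<bar>\<^sup>2)"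
        using V by (intro sum_sq_le) auto
      also have "\<dots> \<le> real (card ?\<Omega>) * (\<delta> * real (card ?\<Omega>))"
        using l2 by (intro mult_left_mono) (auto simp: g2_def)
      also have "\<dots> = (\<epsilon>\<^sup>2 / 32 * ?n\<^sup>2)\<^sup>2"
        unfolding cO using m by (simp add: \<delta>_def power2_eq_square)
      finally show "(\<Sum>\<omega>\<in>?\<Omega>. \<bar>g2 \<omega>\<bar>)\<^sup>2 \<le> (\<epsilon>\<^sup>2 / 32 * ?n\<^sup>2)\<^sup>2" .
    qed simp
    have B2: "real (card B2) \<le> \<epsilon> / 2 * real t ^ 2"
    proof -
      have fB2: "finite B2" by (rule finite_subset[of _ "{1..t} \<times> {1..t}"]) (auto simp: B2_def)
      have "real (card B2) * (\<epsilon> / 4 * (?n\<^sup>2 / (4 * real t ^ 2))) = (\<Sum>(i, j)\<in>B2. \<epsilon> / 4 * (?n\<^sup>2 / (4 * real t ^ 2)))"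
        by (simp add: case_prod_unfold)
      also have "\<dots> \<le> (\<Sum>(i, j)\<in>B2. w i j)"
      proof (intro sum_mono, clarify)
        fix i j assume ij: "(i, j) \<in> B2"
        have "?n\<^sup>2 / (4 * real t ^ 2) \<le> real (card (P i)) * real (card (P j))"
          using half2[of i j] ij t(1) by (simp add: B2_def divide_le_eq mult.commute)
        then have "\<epsilon> / 4 * (?n\<^sup>2 / (4 * real t ^ 2)) \<le> \<epsilon> / 4 * (real (card (P i)) * real (card (P j)))"
          using \<epsilon> by (intro mult_left_mono) auto
        also have "\<dots> \<le> w i j" using ij by (auto simp: B2_def)
        finally show "\<epsilon> / 4 * (?n\<^sup>2 / (4 * real t ^ 2)) \<le> w i j" .
      qed
      also have "\<dots> = (\<Sum>ij\<in>B2. \<Sum>\<omega>\<in>P (fst ij) \<times> P (snd ij) \<times> {..<m}. \<bar>g2 \<omega>\<bar>)"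
        by (simp add: w_def case_prod_unfold)
      also have "\<dots> = (\<Sum>\<omega>\<in>(\<Union>ij\<in>B2. P (fst ij) \<times> P (snd ij) \<times> {..<m}). \<bar>g2 \<omega>\<bar>)"
        using fB2 finP by (intro sum.UNION_disjoint[symmetric]) (auto simp: P_def)
      also have "\<dots> \<le> (\<Sum>\<omega>\<in>?\<Omega>. \<bar>g2 \<omega>\<bar>)"
        using V by (intro sum_mono2) (auto simp: P_def)
      also have "\<dots> \<le> \<epsilon>\<^sup>2 / 32 * ?n\<^sup>2" by (rule l1)
      finally have "real (card B2) * (\<epsilon> / 4 * (?n\<^sup>2 / (4 * real t ^ 2))) \<le> \<epsilon>\<^sup>2 / 32 * ?n\<^sup>2" .
      then have "real (card B2) * (\<epsilon> * ?n\<^sup>2) \<le> (\<epsilon> / 2 * real t ^ 2) * (\<epsilon> * ?n\<^sup>2)"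
        using t(1) by (simp add: field_simps power2_eq_square)
      then show ?thesis using \<epsilon> n by (subst (asm) mult_le_cancel_right_pos) auto
    qed
    have good: "reg_pair \<epsilon> (P i) (P j) \<tau>"
      if ij: "i \<in> {1..t}" "j \<in> {1..t}" "i \<notin> Imp" "j \<notin> Imp" "(i, j) \<notin> B2" for i j
    proof -
      obtain x0 y0 where x0: "x0 \<in> P i" "y0 \<in> P j" using Pne ij by blast
      define g where "g c = (if c < m then cexp ?\<Omega> S f (x0, y0, c) else 0)" for c
      let ?a = "real (card (P i)) * real (card (P j))"
      have const: "cexp ?\<Omega> S f (x, y, c) = g c" if "x \<in> P i" "y \<in> P j" "c < m" for x y c
      proof -
        have q0: "q x = q x0" using ij(1,3) that(1) x0(1) unfolding Imp_def P_def by blast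
        have q1: "q y = q y0" using ij(2,4) that(2) x0(2) unfolding Imp_def P_def by blast
        have "(x, y, c) \<in> ?\<Omega>" using that PV by blast
        then have "(x, y, c) \<in> cell ?\<Omega> S (x0, y0, c)"
          using q(2)[OF q0 q1] by (simp add: cell_def)
        then show ?thesis using that(3) by (simp add: g_def cexp_cong_cell)
      qed
      show ?thesis
      proof (rule reg_pairI[where g = g])
        fix c U W assume UW: "U \<subseteq> P i" "W \<subseteq> P j"
        have finUW: "finite U" "finite W" using UW finP finite_subset by blast+
        show "\<bar>real (card {(x, y) \<in> U \<times> W. \<tau> x y = c}) - g c * real (card U) * real (card W)\<bar> \<le> \<epsilon> / 2 * ?a"
        proof (cases "c < m")
          case False
          have "U \<times> W \<subseteq> V \<times> V" using UW PV by blast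
          then have "{(x, y) \<in> U \<times> W. \<tau> x y = c} = {}" using \<tau> False by fastforce
          then have "card {(x, y) \<in> U \<times> W. \<tau> x y = c} = 0" by (simp only: card.empty)
          then show ?thesis using False \<epsilon> by (simp only: g_def) simp
        next
          case True
          have "real (card {(x, y) \<in> U \<times> W. \<tau> x y = c}) = (\<Sum>p\<in>U \<times> W. f (fst p, snd p, c))"
            unfolding card_filter_Times[OF finUW] by (simp add: f_def)
          moreover have "g c * real (card U) * real (card W) = (\<Sum>p\<in>U \<times> W. cexp ?\<Omega> S f (fst p, snd p, c))"
          proof -
            have "(\<Sum>p\<in>U \<times> W. cexp ?\<Omega> S f (fst p, snd p, c)) = (\<Sum>p\<in>U \<times> W. g c)"
              using UW True by (intro sum.cong) (auto intro!: const)
            then show ?thesis by (simp add: card_cartesian_product)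
          qed
          ultimately have "real (card {(x, y) \<in> U \<times> W. \<tau> x y = c}) - g c * real (card U) * real (card W)
             = (\<Sum>p\<in>U \<times> W. f (fst p, snd p, c) - cexp ?\<Omega> S' f (fst p, snd p, c)) + (\<Sum>p\<in>U \<times> W. g2 (fst p, snd p, c))"
            by (simp add: g2_def sum_subtractf)
          moreover have "\<bar>\<Sum>p\<in>U \<times> W. f (fst p, snd p, c) - cexp ?\<Omega> S' f (fst p, snd p, c)\<bar> \<le> \<epsilon> / 4 * ?a"
          proof -
            have "?\<Omega> \<inter> ((U \<times> UNIV \<times> UNIV) \<inter> (UNIV \<times> W \<times> UNIV) \<inter> (UNIV \<times> UNIV \<times> {c})) = (\<lambda>p. (fst p, snd p, c)) ` (U \<times> W)"
              using subset_trans[OF UW(1) PV] subset_trans[OF UW(2) PV] True by (auto simp: image_iff)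
            moreover have "\<bar>\<Sum>\<omega>\<in>?\<Omega> \<inter> ((U \<times> UNIV \<times> UNIV) \<inter> (UNIV \<times> W \<times> UNIV) \<inter> (UNIV \<times> UNIV \<times> {c})). f \<omega> - cexp ?\<Omega> S' f \<omega>\<bar>
               \<le> \<eta> (card S) * real (card ?\<Omega>)"
              using reg unfolding cut_regular_def vertex_cylinders_def by blast
            ultimately have "\<bar>\<Sum>p\<in>U \<times> W. f (fst p, snd p, c) - cexp ?\<Omega> S' f (fst p, snd p, c)\<bar> \<le> \<eta> (card S) * real (card ?\<Omega>)"
              by (simp add: sum.reindex inj_on_def)
            also have "\<dots> = \<epsilon> / (16 * real t ^ 2) * ?n\<^sup>2"
              unfolding cO \<eta>_def t_def[symmetric] using m by simp
            also have "\<dots> \<le> \<epsilon> / (16 * real t ^ 2) * (4 * real t ^ 2 * ?a)"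
              using half2[OF ij(1,2)] \<epsilon> by (intro mult_left_mono) auto
            also have "\<dots> = \<epsilon> / 4 * ?a" using t(1) by simp
            finally show ?thesis .
          qed
          moreover have "\<bar>\<Sum>p\<in>U \<times> W. g2 (fst p, snd p, c)\<bar> \<le> \<epsilon> / 4 * ?a"
          proof -
            have "\<bar>\<Sum>p\<in>U \<times> W. g2 (fst p, snd p, c)\<bar> \<le> (\<Sum>p\<in>U \<times> W. \<bar>g2 (fst p, snd p, c)\<bar>)" by (rule sum_abs)
            also have "\<dots> = (\<Sum>\<omega>\<in>(\<lambda>p. (fst p, snd p, c)) ` (U \<times> W). \<bar>g2 \<omega>\<bar>)"
              by (simp add: sum.reindex inj_on_def)
            also have "\<dots> \<le> w i j" unfolding w_def using UW finP True by (intro sum_mono2) auto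
            also have "\<dots> \<le> \<epsilon> / 4 * ?a" using ij by (auto simp: B2_def)
            finally show ?thesis .
          qed
          ultimately show ?thesis by linarith
        qed
      qed (use finP Pne ij in auto)
    qed
    have "{(i, j) \<in> {1..t} \<times> {1..t}. \<not> reg_pair \<epsilon> (P i) (P j) \<tau>} \<subseteq> Imp \<times> {1..t} \<union> {1..t} \<times> Imp \<union> B2"
      using good by blast
    moreover have fI: "finite Imp" by (simp add: Imp_def)
    moreover have "finite B2" by (rule finite_subset[of _ "{1..t} \<times> {1..t}"]) (auto simp: B2_def)
    ultimately have "card {(i, j) \<in> {1..t} \<times> {1..t}. \<not> reg_pair \<epsilon> (P i) (P j) \<tau>} \<le> card (Imp \<times> {1..t} \<union> {1..t} \<times> Imp \<union> B2)"
      by (intro card_mono) auto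
    also have "\<dots> \<le> card Imp * t + t * card Imp + card B2"
      using card_Un_le[of "Imp \<times> {1..t} \<union> {1..t} \<times> Imp" B2] card_Un_le[of "Imp \<times> {1..t}" "{1..t} \<times> Imp"]
      by (simp add: card_cartesian_product)
    finally have "real (card {(i, j) \<in> {1..t} \<times> {1..t}. \<not> reg_pair \<epsilon> (P i) (P j) \<tau>}) \<le>
        real (card Imp * t + t * card Imp + card B2)" by (simp only: of_nat_le_iff)
    also have "\<dots> = 2 * (real (card Imp) * real t) + real (card B2)" by simp
    finally have "real (card {(i, j) \<in> {1..t} \<times> {1..t}. \<not> reg_pair \<epsilon> (P i) (P j) \<tau>}) \<le>
        2 * (real (card Imp) * real t) + real (card B2)" .
    moreover have "real (card Imp) * real t \<le> \<epsilon> / 4 * real t * real t"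
    proof (rule mult_right_mono)
      have "real (card Imp) \<le> 2 ^ card S"
        using imp unfolding Imp_def[symmetric] by (metis of_nat_le_iff of_nat_numeral of_nat_power)
      also have "4 * 2 ^ card S / \<epsilon> \<le> real t" unfolding t_def tt_def by linarith
      then have "2 ^ card S \<le> \<epsilon> / 4 * real t" using \<epsilon> by (simp add: field_simps)
      finally show "real (card Imp) \<le> \<epsilon> / 4 * real t" by simp
    qed simp
    ultimately have "real (card {(i, j) \<in> {1..t} \<times> {1..t}. \<not> reg_pair \<epsilon> (P i) (P j) \<tau>}) \<le> \<epsilon> * real t ^ 2"
      using B2 by (simp add: power2_eq_square)
    then have "regular_partition \<epsilon> V \<tau> t \<pi>"
      using \<pi> sz srt unfolding regular_partition_def part_def P_def by simp
    then show "\<exists>t \<pi>. t0 \<le> t \<and> 1 \<le> t \<and> t \<le> T \<and> regular_partition \<epsilon> V \<tau> t \<pi>"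
      using t by blast
  qed
qed

subsection \<open>Random rounding of colour weights\<close>

text \<open>By independence the coordinate \<open>e0\<close> can be averaged first;
  \<open>\<Phi>\<close> does not depend on it, and the fluctuation at \<open>e0\<close> has mean
  0.\<close>

lemma weighted_fluctuation_eq_0:
  fixes W :: "'e \<Rightarrow> 'c \<Rightarrow> real"
  assumes "finite E" "finite L" "e0 \<in> E" "\<alpha> \<in> L" "(\<Sum>a\<in>L. W e0 a) = 1"
    and \<Phi>: "\<And>\<kappa> a. \<Phi> (\<kappa>(e0 := a)) = \<Phi> \<kappa>"
  shows "(\<Sum>\<kappa>\<in>PiE E (\<lambda>_. L). (\<Prod>e\<in>E. W e (\<kappa> e)) * ((of_bool (\<kappa> e0 = \<alpha>) - W e0 \<alpha>) * \<Phi> \<kappa>)) = 0"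
proof -
  have prod: "(\<Prod>e\<in>E. W e ((\<kappa>(e0 := a)) e)) = W e0 a * (\<Prod>e\<in>E - {e0}. W e (\<kappa> e))" for \<kappa> a
  proof -
    have "(\<Prod>e\<in>E - {e0}. W e ((\<kappa>(e0 := a)) e)) = (\<Prod>e\<in>E - {e0}. W e (\<kappa> e))"
      by (rule prod.cong) auto
    then show ?thesis by (simp add: prod.remove[OF assms(1,3)])
  qed
  have z: "(\<Sum>a\<in>L. W e0 a * (of_bool (a = \<alpha>) - W e0 \<alpha>)) = 0"
  proof -
    have "(\<Sum>a\<in>L. W e0 a * (of_bool (a = \<alpha>) - W e0 \<alpha>)) =
        (\<Sum>a\<in>L. W e0 a * of_bool (a = \<alpha>)) - (\<Sum>a\<in>L. W e0 a) * W e0 \<alpha>"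
      by (simp add: right_diff_distrib sum_subtractf sum_distrib_right)
    also have "(\<Sum>a\<in>L. W e0 a * of_bool (a = \<alpha>)) = W e0 \<alpha>"
      using assms(2,4) by (simp add: of_bool_def if_distrib[of "\<lambda>x. _ * x"] cong: if_cong)
    finally show ?thesis using assms(5) by simp
  qed
  have "(\<Sum>\<kappa>\<in>PiE E (\<lambda>_. L). (\<Prod>e\<in>E. W e (\<kappa> e)) * ((of_bool (\<kappa> e0 = \<alpha>) - W e0 \<alpha>) * \<Phi> \<kappa>)) =
     (\<Sum>\<kappa>\<in>PiE (E - {e0}) (\<lambda>_. L). \<Sum>a\<in>L. (\<Prod>e\<in>E - {e0}. W e (\<kappa> e)) * \<Phi> \<kappa> * (W e0 a * (of_bool (a = \<alpha>) - W e0 \<alpha>)))"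
    unfolding sum_PiE_split[OF assms(3)] prod \<Phi> by (intro sum.cong refl) simp
  also have "\<dots> = 0" by (simp only: sum_distrib_left[symmetric] z) simp
  finally show ?thesis .
qed

text \<open>Cauchy-Schwarz twice: over \<open>y\<close>, which removes \<open>U'\<close>, and over
  the pairs \<open>(x, x')\<close>, which removes \<open>U\<close>. The right side is the sum of
  \<open>G\<close> over 4-cycles, so one quantity controls all cuts.\<close>

lemma cut_le_codegree:
  fixes G :: "'a \<Rightarrow> 'a \<Rightarrow> real"
  assumes "finite V" "U \<subseteq> V" "U' \<subseteq> V"
  shows "(\<Sum>x\<in>U. \<Sum>y\<in>U'. G x y) ^ 4 \<le> real (card V) ^ 4 * (\<Sum>x\<in>V. \<Sum>x'\<in>V. (\<Sum>y\<in>V. G x y * G x' y)\<^sup>2)"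
proof -
  let ?n = "real (card V)"
  have fin: "finite U" "finite U'" using assms finite_subset by auto
  have le: "real (card U) \<le> ?n" "real (card U') \<le> ?n" using assms by (auto intro: card_mono)
  define B where "B = (\<Sum>y\<in>V. (\<Sum>x\<in>U. G x y)\<^sup>2)"
  have "(\<Sum>x\<in>U. \<Sum>y\<in>U'. G x y)\<^sup>2 = (\<Sum>y\<in>U'. \<Sum>x\<in>U. G x y)\<^sup>2" by (simp add: sum.swap[of _ U' U])
  also have "\<dots> \<le> real (card U') * (\<Sum>y\<in>U'. (\<Sum>x\<in>U. G x y)\<^sup>2)" using fin by (intro sum_sq_le)
  also have "\<dots> \<le> ?n * B" unfolding B_def
    using assms le by (intro mult_mono sum_mono2) (auto simp: sum_nonneg)
  finally have 1: "(\<Sum>x\<in>U. \<Sum>y\<in>U'. G x y)\<^sup>2 \<le> ?n * B" .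
  have "B = (\<Sum>y\<in>V. \<Sum>x\<in>U. \<Sum>x'\<in>U. G x y * G x' y)" by (simp add: B_def power2_eq_square sum_product)
  also have "\<dots> = (\<Sum>x\<in>U. \<Sum>y\<in>V. \<Sum>x'\<in>U. G x y * G x' y)" by (rule sum.swap)
  also have "\<dots> = (\<Sum>x\<in>U. \<Sum>x'\<in>U. \<Sum>y\<in>V. G x y * G x' y)" by (intro sum.cong refl sum.swap)
  also have "\<dots> = (\<Sum>p\<in>U \<times> U. \<Sum>y\<in>V. G (fst p) y * G (snd p) y)" by (simp add: sum_Times)
  finally have "B\<^sup>2 \<le> real (card (U \<times> U)) * (\<Sum>p\<in>U \<times> U. (\<Sum>y\<in>V. G (fst p) y * G (snd p) y)\<^sup>2)"
    using fin by (simp only:) (intro sum_sq_le, auto)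
  also have "\<dots> \<le> ?n\<^sup>2 * (\<Sum>p\<in>V \<times> V. (\<Sum>y\<in>V. G (fst p) y * G (snd p) y)\<^sup>2)"
    using assms le by (intro mult_mono sum_mono2)
      (auto simp: sum_nonneg card_cartesian_product power2_eq_square intro: mult_mono)
  also have "\<dots> = ?n\<^sup>2 * (\<Sum>x\<in>V. \<Sum>x'\<in>V. (\<Sum>y\<in>V. G x y * G x' y)\<^sup>2)" by (simp add: sum_Times)
  finally have 2: "B\<^sup>2 \<le> ?n\<^sup>2 * (\<Sum>x\<in>V. \<Sum>x'\<in>V. (\<Sum>y\<in>V. G x y * G x' y)\<^sup>2)" .
  have "(\<Sum>x\<in>U. \<Sum>y\<in>U'. G x y) ^ 4 = ((\<Sum>x\<in>U. \<Sum>y\<in>U'. G x y)\<^sup>2)\<^sup>2" by (simp add: power_mult[symmetric])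
  also have "\<dots> \<le> (?n * B)\<^sup>2" using 1 by (intro power_mono) auto
  also have "\<dots> = ?n\<^sup>2 * B\<^sup>2" by (simp add: power_mult_distrib)
  also have "\<dots> \<le> ?n\<^sup>2 * (?n\<^sup>2 * (\<Sum>x\<in>V. \<Sum>x'\<in>V. (\<Sum>y\<in>V. G x y * G x' y)\<^sup>2))"
    using 2 by (intro mult_left_mono) auto
  also have "\<dots> = ?n ^ 4 * (\<Sum>x\<in>V. \<Sum>x'\<in>V. (\<Sum>y\<in>V. G x y * G x' y)\<^sup>2)"
    by (simp add: power2_eq_square power4_eq_xxxx)
  finally show ?thesis .
qed

text \<open>
  The colours \<open>\<kappa> e\<close> are chosen independently with distribution \<open>W e\<close>. The expectation of the product
  of the fluctuations at \<open>(x, y)\<close>, \<open>(x', y)\<close>, \<open>(x, y')\<close>, \<open>(x', y')\<close> vanishes unless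
  \<open>x = x'\<close> or \<open>y = y'\<close>.
\<close>

lemma rounding_second_moment:
  fixes W :: "'a \<times> 'a \<Rightarrow> 'c \<Rightarrow> real"
  assumes V: "finite V" and L: "finite L"
    and W: "\<And>e a. e \<in> V \<times> V \<Longrightarrow> a \<in> L \<Longrightarrow> 0 \<le> W e a" "\<And>e. e \<in> V \<times> V \<Longrightarrow> (\<Sum>a\<in>L. W e a) = 1"
  shows "\<exists>\<kappa>\<in>PiE (V \<times> V) (\<lambda>_. L). (\<forall>e\<in>V \<times> V. 0 < W e (\<kappa> e)) \<and>
    (\<Sum>\<alpha>\<in>L. \<Sum>x\<in>V. \<Sum>x'\<in>V. (\<Sum>y\<in>V. (of_bool (\<kappa> (x, y) = \<alpha>) - W (x, y) \<alpha>) * (of_bool (\<kappa> (x', y) = \<alpha>) - W (x', y) \<alpha>))\<^sup>2)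
      \<le> 2 * real (card L) * real (card V) ^ 3"
proof -
  let ?E = "V \<times> V" and ?n = "real (card V)"
  let ?K = "PiE ?E (\<lambda>_. L)"
  define wt where "wt \<kappa> = (\<Prod>e\<in>?E. W e (\<kappa> e))" for \<kappa>
  define g where "g \<kappa> \<alpha> x y = of_bool (\<kappa> (x, y) = \<alpha>) - W (x, y) \<alpha>" for \<kappa> \<alpha> x y
  define Z where "Z \<kappa> = (\<Sum>\<alpha>\<in>L. \<Sum>x\<in>V. \<Sum>x'\<in>V. (\<Sum>y\<in>V. g \<kappa> \<alpha> x y * g \<kappa> \<alpha> x' y)\<^sup>2)" for \<kappa>
  define C where "C = 2 * real (card L) * ?n ^ 3"
  have wt0: "0 \<le> wt \<kappa>" if "\<kappa> \<in> ?K" for \<kappa>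
    unfolding wt_def using W(1) PiE_mem[OF that] by (intro prod_nonneg) blast
  have wt1: "(\<Sum>\<kappa>\<in>?K. wt \<kappa>) = 1"
  proof -
    have "(\<Sum>\<kappa>\<in>?K. wt \<kappa>) = (\<Prod>e\<in>?E. \<Sum>a\<in>L. W e a)"
      unfolding wt_def using V L by (intro prod_sum_PiE[symmetric]) auto
    also have "\<dots> = 1" using W(2) by (intro prod.neutral) blast
    finally show ?thesis .
  qed
  have Wle: "W e a \<le> 1" if "e \<in> ?E" "a \<in> L" for e a
    using member_le_sum[of a L "W e"] W(1)[OF that(1)] W(2)[OF that(1)] that(2) L by auto
  have g1: "\<bar>g \<kappa> \<alpha> x y\<bar> \<le> 1" if "x \<in> V" "y \<in> V" "\<alpha> \<in> L" for \<kappa> \<alpha> x y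
    using Wle[of "(x, y)" \<alpha>] W(1)[of "(x, y)" \<alpha>] that by (auto simp: g_def abs_le_iff)
  have quad: "(\<Sum>\<kappa>\<in>?K. wt \<kappa> * (g \<kappa> \<alpha> x y * g \<kappa> \<alpha> x' y * (g \<kappa> \<alpha> x y' * g \<kappa> \<alpha> x' y'))) \<le> of_bool (x = x') + of_bool (y = y')"
    if *: "\<alpha> \<in> L" "x \<in> V" "x' \<in> V" "y \<in> V" "y' \<in> V" for \<alpha> x x' y y'
  proof (cases "x = x' \<or> y = y'")
    case True
    have "(\<Sum>\<kappa>\<in>?K. wt \<kappa> * (g \<kappa> \<alpha> x y * g \<kappa> \<alpha> x' y * (g \<kappa> \<alpha> x y' * g \<kappa> \<alpha> x' y'))) \<le> (\<Sum>\<kappa>\<in>?K. wt \<kappa> * 1)"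
    proof (intro sum_mono mult_left_mono wt0)
      fix \<kappa>
      have "\<bar>g \<kappa> \<alpha> x y * g \<kappa> \<alpha> x' y * (g \<kappa> \<alpha> x y' * g \<kappa> \<alpha> x' y')\<bar> \<le> 1 * 1 * (1 * 1)"
        unfolding abs_mult using g1 * by (intro mult_mono) auto
      then show "g \<kappa> \<alpha> x y * g \<kappa> \<alpha> x' y * (g \<kappa> \<alpha> x y' * g \<kappa> \<alpha> x' y') \<le> 1" by simp
    qed
    also have "\<dots> \<le> of_bool (x = x') + of_bool (y = y')" using True wt1 by auto
    finally show ?thesis .
  next
    case False
    \<comment> \<open>Now \<open>(x, y)\<close> differs from the other three pairs, so its
      fluctuation is independent of theirs.\<close>
    have "(\<Sum>\<kappa>\<in>?K. (\<Prod>e\<in>?E. W e (\<kappa> e)) * ((of_bool (\<kappa> (x, y) = \<alpha>) - W (x, y) \<alpha>) *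
       (g \<kappa> \<alpha> x' y * (g \<kappa> \<alpha> x y' * g \<kappa> \<alpha> x' y')))) = 0"
      using V L * W(2) False by (intro weighted_fluctuation_eq_0) (auto simp: g_def)
    then show ?thesis by (simp add: wt_def g_def mult.assoc)
  qed
  have "(\<Sum>\<kappa>\<in>?K. wt \<kappa> * Z \<kappa>) =
      (\<Sum>\<kappa>\<in>?K. \<Sum>\<alpha>\<in>L. \<Sum>x\<in>V. \<Sum>x'\<in>V. \<Sum>y\<in>V. \<Sum>y'\<in>V. wt \<kappa> * (g \<kappa> \<alpha> x y * g \<kappa> \<alpha> x' y * (g \<kappa> \<alpha> x y' * g \<kappa> \<alpha> x' y')))"
    unfolding Z_def power2_eq_square sum_product by (simp only: sum_distrib_left)
  also have "\<dots> = (\<Sum>\<alpha>\<in>L. \<Sum>x\<in>V. \<Sum>x'\<in>V. \<Sum>y\<in>V. \<Sum>y'\<in>V. \<Sum>\<kappa>\<in>?K. wt \<kappa> * (g \<kappa> \<alpha> x y * g \<kappa> \<alpha> x' y * (g \<kappa> \<alpha> x y' * g \<kappa> \<alpha> x' y')))"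
    by (subst sum.swap, intro sum.cong refl, subst sum.swap, intro sum.cong refl, subst sum.swap, intro sum.cong refl,
        subst sum.swap, intro sum.cong refl, rule sum.swap)
  also have "\<dots> \<le> (\<Sum>\<alpha>\<in>L. \<Sum>x\<in>V. \<Sum>x'\<in>V. \<Sum>y\<in>V. \<Sum>y'\<in>V. of_bool (x = x') + of_bool (y = y'))"
    by (intro sum_mono quad)
  also have "\<dots> = C"
    using V by (simp add: sum.distrib of_bool_def C_def power3_eq_cube sum_distrib_left[symmetric] algebra_simps)
  finally have avg: "(\<Sum>\<kappa>\<in>?K. wt \<kappa> * Z \<kappa>) \<le> C" .
  \<comment> \<open>Positive weight is required along with the bound on \<open>Z\<close>: no pair
    may receive a colour of probability 0, for otherwise the new colours would not refine the old
    ones.\<close>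
  have "\<exists>\<kappa>\<in>?K. wt \<kappa> > 0 \<and> Z \<kappa> \<le> C"
  proof (rule ccontr)
    assume "\<not> ?thesis"
    then have big: "Z \<kappa> > C" if "\<kappa> \<in> ?K" "wt \<kappa> > 0" for \<kappa> using that by force
    have nn: "0 \<le> wt \<kappa> * (Z \<kappa> - C)" if "\<kappa> \<in> ?K" for \<kappa>
      using wt0[OF that] big[OF that] by (cases "wt \<kappa> = 0") auto
    have "(\<Sum>\<kappa>\<in>?K. wt \<kappa> * (Z \<kappa> - C)) = (\<Sum>\<kappa>\<in>?K. wt \<kappa> * Z \<kappa>) - (\<Sum>\<kappa>\<in>?K. wt \<kappa>) * C"
      by (simp add: right_diff_distrib sum_subtractf sum_distrib_right)
    then have "(\<Sum>\<kappa>\<in>?K. wt \<kappa> * (Z \<kappa> - C)) \<le> 0" using avg wt1 by simp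
    moreover have "0 \<le> (\<Sum>\<kappa>\<in>?K. wt \<kappa> * (Z \<kappa> - C))" using nn by (rule sum_nonneg)
    ultimately have "(\<Sum>\<kappa>\<in>?K. wt \<kappa> * (Z \<kappa> - C)) = 0" by linarith
    moreover have "finite ?K" using V L by (intro finite_PiE) auto
    ultimately have "wt \<kappa> * (Z \<kappa> - C) = 0" if "\<kappa> \<in> ?K" for \<kappa>
      using nn sum_nonneg_eq_0_iff[of ?K "\<lambda>\<kappa>. wt \<kappa> * (Z \<kappa> - C)"] that by blast
    then have "wt \<kappa> = 0" if "\<kappa> \<in> ?K" for \<kappa>
      using big[OF that] wt0[OF that] that by (metis eq_iff_diff_eq_0 less_irrefl mult_eq_0_iff order_le_less)
    then show False using wt1 by simp
  qed
  then obtain \<kappa> where \<kappa>: "\<kappa> \<in> ?K" "wt \<kappa> > 0" "Z \<kappa> \<le> C" by blast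
  have "0 < W e (\<kappa> e)" if "e \<in> ?E" for e
  proof -
    have "W e (\<kappa> e) \<noteq> 0" using \<kappa>(2) that V unfolding wt_def by (metis finite_cartesian_product less_irrefl prod_zero_iff)
    then show ?thesis using W(1)[OF that PiE_mem[OF \<kappa>(1) that]] by simp
  qed
  then show ?thesis using \<kappa> unfolding Z_def g_def C_def by blast
qed

text \<open>The second moment controls all cuts at once, without a union bound over \<open>U\<close>
  and \<open>U'\<close>. The fourth power of any cut error is at most
  \<open>n ^ 4 * (2 * card L * n ^ 3)\<close>, and the assumption \<open>big\<close> bounds this by
  \<open>(\<theta> * n ^ 2) ^ 4\<close>.\<close>

lemma random_rounding:
  fixes W :: "'a \<times> 'a \<Rightarrow> 'c \<Rightarrow> real"
  assumes V: "finite V" and L: "finite L" and \<theta>: "\<theta> > 0" and big: "2 * real (card L) / \<theta> ^ 4 \<le> real (card V)"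
    and W: "\<And>e a. e \<in> V \<times> V \<Longrightarrow> a \<in> L \<Longrightarrow> 0 \<le> W e a" "\<And>e. e \<in> V \<times> V \<Longrightarrow> (\<Sum>a\<in>L. W e a) = 1"
  shows "\<exists>\<kappa>. (\<forall>e\<in>V \<times> V. \<kappa> e \<in> L \<and> 0 < W e (\<kappa> e)) \<and>
    (\<forall>\<alpha>\<in>L. \<forall>U U'. U \<subseteq> V \<longrightarrow> U' \<subseteq> V \<longrightarrow>
      \<bar>\<Sum>x\<in>U. \<Sum>y\<in>U'. of_bool (\<kappa> (x, y) = \<alpha>) - W (x, y) \<alpha>\<bar> \<le> \<theta> * real (card V) ^ 2)"
proof -
  let ?n = "real (card V)"
  have "\<exists>\<kappa>\<in>PiE (V \<times> V) (\<lambda>_. L). (\<forall>e\<in>V \<times> V. 0 < W e (\<kappa> e)) \<and>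
    (\<Sum>\<alpha>\<in>L. \<Sum>x\<in>V. \<Sum>x'\<in>V. (\<Sum>y\<in>V. (of_bool (\<kappa> (x, y) = \<alpha>) - W (x, y) \<alpha>) * (of_bool (\<kappa> (x', y) = \<alpha>) - W (x', y) \<alpha>))\<^sup>2)
      \<le> 2 * real (card L) * ?n ^ 3"
  proof (rule rounding_second_moment)
    show "0 \<le> W e a" if "e \<in> V \<times> V" "a \<in> L" for e a using that by (rule W(1))
    show "(\<Sum>a\<in>L. W e a) = 1" if "e \<in> V \<times> V" for e using that by (rule W(2))
  qed (rule V L)+
  then obtain \<kappa> where \<kappa>: "\<kappa> \<in> PiE (V \<times> V) (\<lambda>_. L)" "\<forall>e\<in>V \<times> V. 0 < W e (\<kappa> e)" and
    Z: "(\<Sum>\<alpha>\<in>L. \<Sum>x\<in>V. \<Sum>x'\<in>V. (\<Sum>y\<in>V. (of_bool (\<kappa> (x, y) = \<alpha>) - W (x, y) \<alpha>) * (of_bool (\<kappa> (x', y) = \<alpha>) - W (x', y) \<alpha>))\<^sup>2)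
      \<le> 2 * real (card L) * ?n ^ 3"
    by (elim bexE conjE) (rule that)
  have "\<bar>\<Sum>x\<in>U. \<Sum>y\<in>U'. of_bool (\<kappa> (x, y) = \<alpha>) - W (x, y) \<alpha>\<bar> \<le> \<theta> * ?n ^ 2"
    if *: "\<alpha> \<in> L" "U \<subseteq> V" "U' \<subseteq> V" for \<alpha> U U'
  proof -
    let ?g = "\<lambda>x y. of_bool (\<kappa> (x, y) = \<alpha>) - W (x, y) \<alpha>"
    have "(\<Sum>x\<in>V. \<Sum>x'\<in>V. (\<Sum>y\<in>V. ?g x y * ?g x' y)\<^sup>2) \<le>
      (\<Sum>\<alpha>\<in>L. \<Sum>x\<in>V. \<Sum>x'\<in>V. (\<Sum>y\<in>V. (of_bool (\<kappa> (x, y) = \<alpha>) - W (x, y) \<alpha>) * (of_bool (\<kappa> (x', y) = \<alpha>) - W (x', y) \<alpha>))\<^sup>2)"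
      using *(1) L by (intro member_le_sum[where f = "\<lambda>\<alpha>. \<Sum>x\<in>V. \<Sum>x'\<in>V. (\<Sum>y\<in>V. (of_bool (\<kappa> (x, y) = \<alpha>) - W (x, y) \<alpha>) *
          (of_bool (\<kappa> (x', y) = \<alpha>) - W (x', y) \<alpha>))\<^sup>2"])
        (auto intro!: sum_nonneg)
    also note Z
    also have "2 * real (card L) * ?n ^ 3 \<le> \<theta> ^ 4 * ?n * ?n ^ 3"
      using big \<theta> by (intro mult_right_mono) (auto simp: divide_le_eq mult.commute)
    finally have "(\<Sum>x\<in>V. \<Sum>x'\<in>V. (\<Sum>y\<in>V. ?g x y * ?g x' y)\<^sup>2) \<le> \<theta> ^ 4 * ?n * ?n ^ 3" .
    then have "?n ^ 4 * (\<Sum>x\<in>V. \<Sum>x'\<in>V. (\<Sum>y\<in>V. ?g x y * ?g x' y)\<^sup>2) \<le> ?n ^ 4 * (\<theta> ^ 4 * ?n * ?n ^ 3)"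
      by (intro mult_left_mono) auto
    with cut_le_codegree[OF V *(2,3), of ?g]
    have "(\<Sum>x\<in>U. \<Sum>y\<in>U'. ?g x y) ^ 4 \<le> ?n ^ 4 * (\<theta> ^ 4 * ?n * ?n ^ 3)" by (rule order_trans)
    also have "\<dots> = (\<theta> * ?n ^ 2) ^ 4"
        by (simp add: power_mult_distrib power_mult[symmetric] power_add[symmetric] eval_nat_numeral)
    finally have "\<bar>\<Sum>x\<in>U. \<Sum>y\<in>U'. ?g x y\<bar> ^ 4 \<le> (\<theta> * ?n ^ 2) ^ 4" by (simp add: power_even_abs)
    moreover have "(\<theta> * ?n ^ 2) ^ 4 < \<bar>\<Sum>x\<in>U. \<Sum>y\<in>U'. ?g x y\<bar> ^ 4" if "\<theta> * ?n ^ 2 < \<bar>\<Sum>x\<in>U. \<Sum>y\<in>U'. ?g x y\<bar>"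
      using that \<theta> by (intro power_strict_mono) auto
    ultimately show ?thesis by linarith
  qed
  then show ?thesis
  proof (intro exI[of _ \<kappa>] conjI ballI allI impI)
    show "\<kappa> e \<in> L" if "e \<in> V \<times> V" for e using \<kappa>(1) that by (rule PiE_mem)
    show "0 < W e (\<kappa> e)" if "e \<in> V \<times> V" for e using \<kappa>(2) that by (rule bspec)
  qed
qed

text \<open>
  Cut the unit interval into consecutive intervals of lengths \<open>d 0, d 1, \<dots>\<close> on the one hand and
  into \<open>l\<close> intervals of equal length on the other hand; \<open>w c \<alpha>\<close> is the length of the overlap of the
  \<open>c\<close>-th of the former with the \<open>\<alpha>\<close>-th of the latter.
\<close>

lemma interval_splitting:
  fixes d :: "nat \<Rightarrow> real"
  assumes d: "\<And>c. c < m \<Longrightarrow> 0 \<le> d c" "(\<Sum>c<m. d c) = 1" and l: "l \<ge> 1"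
  shows "\<exists>w. (\<forall>c<m. \<forall>\<alpha>\<in>{1..l}. 0 \<le> w c \<alpha>) \<and> (\<forall>c<m. (\<Sum>\<alpha>\<in>{1..l}. w c \<alpha>) = d c) \<and>
    (\<forall>\<alpha>\<in>{1..l}. (\<Sum>c<m. w c \<alpha>) = 1 / real l) \<and>
    card {\<alpha> \<in> {1..l}. \<exists>c<m. \<exists>c'<m. c \<noteq> c' \<and> 0 < w c \<alpha> \<and> 0 < w c' \<alpha>} \<le> m"
proof -
  define D where "D c = (\<Sum>c'<c. d c')" for c
  \<comment> \<open>The length of the portion of the \<open>c\<close>-th interval that lies to the
    left of \<open>a / l\<close>.\<close>
  define h where "h c a = min (real a / real l) (D (Suc c)) - min (real a / real l) (D c)" for c a
  define w where "w c \<alpha> = h c \<alpha> - h c (\<alpha> - 1)" for c \<alpha>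
  have Dmono: "D c \<le> D c'" if "c \<le> c'" "c' \<le> m" for c c'
    unfolding D_def using that d(1) by (intro sum_mono2) auto
  have D0: "D 0 = 0" and Dm: "D m = 1" using d by (auto simp: D_def)
  have D01: "0 \<le> D c" "D c \<le> 1" if "c \<le> m" for c using Dmono[of 0 c] Dmono[of c m] that D0 Dm by auto
  have step: "real (\<alpha> - 1) / real l \<le> real \<alpha> / real l" for \<alpha> by (intro divide_right_mono) auto
  have nonneg: "0 \<le> w c \<alpha>" if "c < m" for c \<alpha>
    using Dmono[of c "Suc c"] step[of \<alpha>] that unfolding w_def h_def by (auto simp: min_def)
  have sum\<alpha>: "(\<Sum>\<alpha>\<in>{1..l}. w c \<alpha>) = d c" if "c < m" for c
  proof -
    have "(\<Sum>\<alpha>\<in>{1..l}. w c \<alpha>) = (\<Sum>a<l. w c (Suc a))"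
      by (rule sum.reindex_bij_witness[of _ Suc "\<lambda>a. a - 1"]) auto
    also have "\<dots> = (\<Sum>a<l. h c (Suc a) - h c a)" by (simp add: w_def)
    also have "\<dots> = h c l - h c 0" by (rule sum_lessThan_telescope)
    also have "h c l = D (Suc c) - D c" using D01[of c] D01[of "Suc c"] that l by (simp add: h_def)
    also have "h c 0 = 0" using D01[of c] D01[of "Suc c"] that by (simp add: h_def)
    finally show ?thesis by (simp add: D_def)
  qed
  have sumc: "(\<Sum>c<m. w c \<alpha>) = 1 / real l" if "\<alpha> \<in> {1..l}" for \<alpha>
  proof -
    have H: "(\<Sum>c<m. h c a) = real a / real l" if "a \<le> l" for a
    proof -
      have "(\<Sum>c<m. h c a) = min (real a / real l) (D m) - min (real a / real l) (D 0)"
        unfolding h_def by (rule sum_lessThan_telescope)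
      also have "\<dots> = real a / real l" using that l by (simp add: D0 Dm)
      finally show ?thesis .
    qed
    have "(\<Sum>c<m. w c \<alpha>) = real \<alpha> / real l - real (\<alpha> - 1) / real l"
      unfolding w_def sum_subtractf using that by (subst (1 2) H) auto
    also have "\<dots> = 1 / real l" using that by (simp add: diff_divide_distrib[symmetric] of_nat_diff)
    finally show ?thesis .
  qed
  define Imp where "Imp = {\<alpha> \<in> {1..l}. \<exists>c<m. \<exists>c'<m. c \<noteq> c' \<and> 0 < w c \<alpha> \<and> 0 < w c' \<alpha>}"
  \<comment> \<open>An interval of length \<open>1 / l\<close> that meets two of the others contains
    one of the division points \<open>D\<close> in its interior; different intervals contain
    different points.\<close>
  have bdry: "\<exists>c<m. real (\<alpha> - 1) / real l < D (Suc c) \<and> D (Suc c) < real \<alpha> / real l" if imp: "\<alpha> \<in> Imp" for \<alpha>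
  proof -
    obtain c c' where c: "c < m" "c' < m" "c < c'" "0 < w c \<alpha>" "0 < w c' \<alpha>"
    proof -
      obtain c c' where "c < m" "c' < m" "c \<noteq> c'" "0 < w c \<alpha>" "0 < w c' \<alpha>" using imp by (auto simp: Imp_def)
      then show ?thesis using that[of c c'] that[of c' c] by (cases "c < c'") auto
    qed
    have "D (Suc c) \<le> D c'" using c by (intro Dmono) auto
    moreover have "D c' < real \<alpha> / real l"
      using c(5) step[of \<alpha>] Dmono[of c' "Suc c'"] c(2) unfolding w_def h_def by (auto simp: min_def split: if_splits)
    moreover have "real (\<alpha> - 1) / real l < D (Suc c)"
      using c(4) step[of \<alpha>] Dmono[of c "Suc c"] c(1) unfolding w_def h_def by (auto simp: min_def split: if_splits)
    ultimately show ?thesis using c(1) by (intro exI[of _ c]) auto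
  qed
  then obtain \<phi> where \<phi>: "\<And>\<alpha>. \<alpha> \<in> Imp \<Longrightarrow> \<phi> \<alpha> < m \<and> real (\<alpha> - 1) / real l < D (Suc (\<phi> \<alpha>)) \<and> D (Suc (\<phi> \<alpha>)) < real \<alpha> / real l"
    by metis
  have "\<phi> \<alpha> \<noteq> \<phi> \<beta>" if "\<alpha> \<in> Imp" "\<beta> \<in> Imp" "\<alpha> < \<beta>" for \<alpha> \<beta>
  proof
    assume eq: "\<phi> \<alpha> = \<phi> \<beta>"
    have "\<alpha> \<le> \<beta> - 1" using that(3) by linarith
    then have "real \<alpha> / real l \<le> real (\<beta> - 1) / real l" by (intro divide_right_mono) auto
    then show False using \<phi>[OF that(1)] \<phi>[OF that(2)] unfolding eq by linarith
  qed
  then have "inj_on \<phi> Imp" by (intro inj_onI) (metis neq_iff)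
  moreover have "\<phi> ` Imp \<subseteq> {..<m}" using \<phi> by auto
  ultimately have "card Imp \<le> m" using card_inj_on_le[of \<phi> Imp "{..<m}"] by simp
  then show ?thesis using nonneg sum\<alpha> sumc unfolding Imp_def by (intro exI[of _ w]) blast
qed

subsection \<open>Triads\<close>

lemma card_filter_Times3:
  assumes "finite X" "finite Y" "finite Z"
  shows "real (card {(x, y, z) \<in> X \<times> Y \<times> Z. Q x y z}) = (\<Sum>x\<in>X. \<Sum>y\<in>Y. \<Sum>z\<in>Z. of_bool (Q x y z))"
proof -
  have "{(x, y, z) \<in> X \<times> Y \<times> Z. Q x y z} = {(x, p) \<in> X \<times> (Y \<times> Z). Q x (fst p) (snd p)}" by auto
  then show ?thesis using assms card_filter_Times[of X "Y \<times> Z" "\<lambda>x p. Q x (fst p) (snd p)"]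
    by (simp add: sum_Times)
qed

text \<open>The graphs are removed one after the other: \<open>P\<close> between the neighbourhoods
  of a fixed \<open>z\<close>, then \<open>Q\<close> between \<open>X\<close> and the neighbourhood
  of a fixed \<open>y\<close>, then \<open>R\<close>. The errors \<open>\<xi>\<close>,
  \<open>p * \<xi>\<close> and \<open>p ^ 2 * \<xi>\<close> add up to at most
  \<open>3 * \<xi>\<close>.\<close>

lemma triangle_count_le:
  fixes P Q R :: "'a \<Rightarrow> 'a \<Rightarrow> bool" and p \<xi> :: real
  assumes fin: "finite X" "finite Y" "finite Z" and p: "0 \<le> p" "p \<le> 1"
    and P: "\<And>U W. U \<subseteq> X \<Longrightarrow> W \<subseteq> Y \<Longrightarrow>
      real (card {(x, y) \<in> U \<times> W. P x y}) \<le> p * (real (card U) * real (card W)) + \<xi> * (real (card X) * real (card Y))"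
    and Q: "\<And>U W. U \<subseteq> X \<Longrightarrow> W \<subseteq> Z \<Longrightarrow>
      real (card {(x, y) \<in> U \<times> W. Q x y}) \<le> p * (real (card U) * real (card W)) + \<xi> * (real (card X) * real (card Z))"
    and R: "\<And>U W. U \<subseteq> Y \<Longrightarrow> W \<subseteq> Z \<Longrightarrow>
      real (card {(x, y) \<in> U \<times> W. R x y}) \<le> p * (real (card U) * real (card W)) + \<xi> * (real (card Y) * real (card Z))"
    and \<xi>: "0 \<le> \<xi>"
  shows "real (card {(x, y, z) \<in> X \<times> Y \<times> Z. P x y \<and> Q x z \<and> R y z}) \<le>
    (p ^ 3 + 3 * \<xi>) * (real (card X) * real (card Y) * real (card Z))"
proof -
  let ?x = "real (card X)" and ?y = "real (card Y)" and ?z = "real (card Z)"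
  define NX where "NX z = {x \<in> X. Q x z}" for z
  define NY where "NY z = {y \<in> Y. R y z}" for z
  define NZ where "NZ y = {z \<in> Z. R y z}" for y
  define XR where "XR = (\<Sum>y\<in>Y. \<Sum>z\<in>Z. of_bool (R y z) :: real)"
  have XR: "XR \<le> p * (?y * ?z) + \<xi> * (?y * ?z)"
    unfolding XR_def using R[of Y Z] card_filter_Times[OF fin(2,3), of R] by (simp add: sum_Times)
  define QR where "QR = (\<Sum>x\<in>X. \<Sum>y\<in>Y. \<Sum>z\<in>Z. of_bool (Q x z \<and> R y z) :: real)"
  have QR1: "QR = (\<Sum>z\<in>Z. real (card (NX z)) * real (card (NY z)))"
  proof -
    have "QR = (\<Sum>x\<in>X. \<Sum>z\<in>Z. \<Sum>y\<in>Y. of_bool (Q x z \<and> R y z))"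
      unfolding QR_def by (intro sum.cong refl sum.swap)
    also have "\<dots> = (\<Sum>z\<in>Z. \<Sum>x\<in>X. \<Sum>y\<in>Y. of_bool (Q x z \<and> R y z))" by (rule sum.swap)
    also have "\<dots> = (\<Sum>z\<in>Z. real (card (NX z)) * real (card (NY z)))"
    proof (rule sum.cong[OF refl])
      fix z
      have "{(x, y) \<in> X \<times> Y. Q x z \<and> R y z} = NX z \<times> NY z" by (auto simp: NX_def NY_def)
      then show "(\<Sum>x\<in>X. \<Sum>y\<in>Y. of_bool (Q x z \<and> R y z)) = real (card (NX z)) * real (card (NY z))"
        using card_filter_Times[OF fin(1,2), of "\<lambda>x y. Q x z \<and> R y z"] by (simp add: sum_Times card_cartesian_product)
    qed
    finally show ?thesis .
  qed
  have QR2: "QR \<le> p * ?x * XR + \<xi> * (?x * ?z) * ?y"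
  proof -
    have "QR = (\<Sum>y\<in>Y. \<Sum>x\<in>X. \<Sum>z\<in>Z. of_bool (Q x z \<and> R y z))" unfolding QR_def by (rule sum.swap)
    also have "\<dots> = (\<Sum>y\<in>Y. real (card {(x, z) \<in> X \<times> NZ y. Q x z}))"
    proof (rule sum.cong[OF refl])
      fix y
      have "{(x, z) \<in> X \<times> NZ y. Q x z} = {(x, z) \<in> X \<times> Z. Q x z \<and> R y z}" by (auto simp: NZ_def)
      then show "(\<Sum>x\<in>X. \<Sum>z\<in>Z. of_bool (Q x z \<and> R y z)) = real (card {(x, z) \<in> X \<times> NZ y. Q x z})"
        using card_filter_Times[OF fin(1,3), of "\<lambda>x z. Q x z \<and> R y z"] by (simp add: sum_Times)
    qed
    also have "\<dots> \<le> (\<Sum>y\<in>Y. p * (?x * real (card (NZ y))) + \<xi> * (?x * ?z))"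
      by (intro sum_mono Q) (auto simp: NZ_def)
    also have "\<dots> = p * ?x * (\<Sum>y\<in>Y. real (card (NZ y))) + \<xi> * (?x * ?z) * ?y"
      by (simp add: sum.distrib sum_distrib_left mult.assoc)
    also have "(\<Sum>y\<in>Y. real (card (NZ y))) = XR"
      unfolding XR_def NZ_def using fin by (simp add: of_bool_def sum.If_cases Int_def)
    finally show ?thesis .
  qed
  have "real (card {(x, y, z) \<in> X \<times> Y \<times> Z. P x y \<and> Q x z \<and> R y z}) =
      (\<Sum>x\<in>X. \<Sum>y\<in>Y. \<Sum>z\<in>Z. of_bool (P x y \<and> Q x z \<and> R y z))"
    by (rule card_filter_Times3[OF fin])
  also have "\<dots> = (\<Sum>x\<in>X. \<Sum>z\<in>Z. \<Sum>y\<in>Y. of_bool (P x y \<and> Q x z \<and> R y z))"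
    by (intro sum.cong refl sum.swap)
  also have "\<dots> = (\<Sum>z\<in>Z. \<Sum>x\<in>X. \<Sum>y\<in>Y. of_bool (P x y \<and> Q x z \<and> R y z))" by (rule sum.swap)
  also have "\<dots> = (\<Sum>z\<in>Z. real (card {(x, y) \<in> NX z \<times> NY z. P x y}))"
  proof (rule sum.cong[OF refl])
    fix z
    have "{(x, y) \<in> NX z \<times> NY z. P x y} = {(x, y) \<in> X \<times> Y. P x y \<and> Q x z \<and> R y z}" by (auto simp: NX_def NY_def)
    then show "(\<Sum>x\<in>X. \<Sum>y\<in>Y. of_bool (P x y \<and> Q x z \<and> R y z)) = real (card {(x, y) \<in> NX z \<times> NY z. P x y})"
      using card_filter_Times[OF fin(1,2), of "\<lambda>x y. P x y \<and> Q x z \<and> R y z"] by (simp add: sum_Times)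
  qed
  also have "\<dots> \<le> (\<Sum>z\<in>Z. p * (real (card (NX z)) * real (card (NY z))) + \<xi> * (?x * ?y))"
    by (intro sum_mono P) (auto simp: NX_def NY_def)
  also have "\<dots> = p * QR + \<xi> * (?x * ?y) * ?z"
    by (simp add: QR1 sum.distrib sum_distrib_left)
  also have "\<dots> \<le> p * (p * ?x * (p * (?y * ?z) + \<xi> * (?y * ?z)) + \<xi> * (?x * ?z) * ?y) + \<xi> * (?x * ?y) * ?z"
  proof -
    have "p * ?x * XR \<le> p * ?x * (p * (?y * ?z) + \<xi> * (?y * ?z))" using XR p by (intro mult_left_mono) auto
    then show ?thesis using QR2 p by (intro add_right_mono mult_left_mono) auto
  qed
  also have "\<dots> = (p ^ 3 + (p\<^sup>2 * \<xi> + p * \<xi> + \<xi>)) * (?x * ?y * ?z)"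
    by (simp add: power2_eq_square power3_eq_cube algebra_simps)
  also have "\<dots> \<le> (p ^ 3 + 3 * \<xi>) * (?x * ?y * ?z)"
  proof -
    have "p\<^sup>2 * \<xi> \<le> 1 * \<xi>" "p * \<xi> \<le> 1 * \<xi>" using p \<xi> by (intro mult_right_mono power_le_one; simp)+
    then show ?thesis by (intro mult_right_mono) auto
  qed
  finally show ?thesis .
qed

text \<open>If \<open>F\<close> is sparse on \<open>T\<close>, both terms of the difference lie
  between 0 and \<open>card (F \<inter> T)\<close>. If it is dense, passing to the complement of
  \<open>F\<close> only changes the sign of the difference.\<close>

lemma near_homogeneous_disc:
  assumes "finite T" "T' \<subseteq> T"
    and "real (card (F \<inter> T)) \<le> \<mu> * real (card T) \<or> real (card (T - F)) \<le> \<mu> * real (card T)"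
  shows "\<bar>real (card (F \<inter> T')) - real (card (F \<inter> T)) / real (card T) * real (card T')\<bar> \<le> \<mu> * real (card T)"
proof (cases "T = {}")
  case True
  then show ?thesis using assms by simp
next
  case False
  then have T: "real (card T) > 0" using assms by (simp add: card_gt_0_iff)
  have finT': "finite T'" using assms finite_subset by blast
  have le: "real (card T') \<le> real (card T)" using assms by (simp add: card_mono)
  have ratio: "a / real (card T) * real (card T') \<le> a" "0 \<le> a / real (card T) * real (card T')" if "0 \<le> a" for a
    using mult_left_mono[OF le that] T that by (auto simp: field_simps)
  from assms(3) show ?thesis
  proof
    assume *: "real (card (F \<inter> T)) \<le> \<mu> * real (card T)"
    have "card (F \<inter> T') \<le> card (F \<inter> T)" using assms by (intro card_mono) auto
    then show ?thesis using * ratio[of "real (card (F \<inter> T))"] by linarith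
  next
    assume *: "real (card (T - F)) \<le> \<mu> * real (card T)"
    have "card (T' - F) \<le> card (T - F)" using assms by (intro card_mono) auto
    moreover have "real (card (F \<inter> T')) = real (card T') - real (card (T' - F))"
      using card_Int_Diff[OF finT', of F] by (simp add: Int_commute)
    moreover have "real (card (F \<inter> T)) = real (card T) - real (card (T - F))"
      using card_Int_Diff[OF assms(1), of F] by (simp add: Int_commute)
    then have "real (card (F \<inter> T)) / real (card T) * real (card T') =
        real (card T') - real (card (T - F)) / real (card T) * real (card T')"
      using T by (simp add: diff_divide_distrib left_diff_distrib)
    ultimately show ?thesis using * ratio[of "real (card (T - F))"] by linarith
  qed
qed

text \<open>Markov's inequality for the fibres of \<open>h\<close>: in a bad fibre the errors
  outnumber \<open>\<mu>\<close> times its size, and different fibres have disjoint errors.\<close>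

lemma card_bad_classes:
  fixes h :: "'o \<Rightarrow> 'l"
  assumes "finite \<Omega>" "\<mu> > 0"
  shows "\<mu> * real (card {\<omega> \<in> \<Omega>. \<mu> * real (card {\<omega>' \<in> \<Omega>. h \<omega>' = h \<omega>}) < real (card {\<omega>' \<in> \<Omega>. h \<omega>' = h \<omega> \<and> Q \<omega>'})})
    \<le> real (card {\<omega> \<in> \<Omega>. Q \<omega>})"
proof -
  define cl where "cl b = {\<omega>' \<in> \<Omega>. h \<omega>' = b}" for b
  define er where "er b = {\<omega>' \<in> \<Omega>. h \<omega>' = b \<and> Q \<omega>'}" for b
  define B where "B = {b \<in> h ` \<Omega>. \<mu> * real (card (cl b)) < real (card (er b))}"
  have fin: "finite B" "finite (cl b)" "finite (er b)" for b using assms by (auto simp: B_def cl_def er_def)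
  have "{\<omega> \<in> \<Omega>. \<mu> * real (card {\<omega>' \<in> \<Omega>. h \<omega>' = h \<omega>}) < real (card {\<omega>' \<in> \<Omega>. h \<omega>' = h \<omega> \<and> Q \<omega>'})} = (\<Union>b\<in>B. cl b)"
    by (auto simp: B_def cl_def er_def)
  also have "card \<dots> = (\<Sum>b\<in>B. card (cl b))"
    using fin by (intro card_UN_disjoint) (auto simp: cl_def)
  finally have "\<mu> * real (card {\<omega> \<in> \<Omega>. \<mu> * real (card {\<omega>' \<in> \<Omega>. h \<omega>' = h \<omega>}) < real (card {\<omega>' \<in> \<Omega>. h \<omega>' = h \<omega> \<and> Q \<omega>'})})
     = (\<Sum>b\<in>B. \<mu> * real (card (cl b)))" by (simp add: sum_distrib_left)
  also have "\<dots> \<le> (\<Sum>b\<in>B. real (card (er b)))" by (intro sum_mono) (auto simp: B_def)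
  also have "\<dots> = real (card (\<Union>b\<in>B. er b))"
    using fin by (subst card_UN_disjoint) (auto simp: er_def)
  also have "\<dots> \<le> real (card {\<omega> \<in> \<Omega>. Q \<omega>})"
    using assms by (intro of_nat_mono card_mono) (auto simp: er_def)
  finally show ?thesis .
qed

lemma card_triples_bad_pair:
  assumes "finite V" and Q: "Q \<subseteq> V \<times> V" "real (card Q) \<le> \<rho> * real (card V) ^ 2"
  shows "real (card {(x, y, z) \<in> V \<times> V \<times> V. (x, y) \<in> Q \<or> (x, z) \<in> Q \<or> (y, z) \<in> Q}) \<le> 3 * \<rho> * real (card V) ^ 3"
proof -
  let ?n = "real (card V)"
  have finQ: "finite Q" using finite_subset[OF Q(1)] assms(1) by simp
  define A1 where "A1 = (\<lambda>((x, y), z). (x, y, z)) ` (Q \<times> V)"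
  define A2 where "A2 = (\<lambda>((x, z), y). (x, y, z)) ` (Q \<times> V)"
  define A3 where "A3 = (\<lambda>((y, z), x). (x, y, z)) ` (Q \<times> V)"
  have c: "card A1 \<le> card Q * card V" "card A2 \<le> card Q * card V" "card A3 \<le> card Q * card V"
    unfolding A1_def A2_def A3_def using card_image_le[of "Q \<times> V"] finQ assms(1)
    by (metis card_cartesian_product finite_cartesian_product)+
  have "{(x, y, z) \<in> V \<times> V \<times> V. (x, y) \<in> Q \<or> (x, z) \<in> Q \<or> (y, z) \<in> Q} \<subseteq> A1 \<union> A2 \<union> A3"
    unfolding A1_def A2_def A3_def by (force simp: image_iff)
  then have "card {(x, y, z) \<in> V \<times> V \<times> V. (x, y) \<in> Q \<or> (x, z) \<in> Q \<or> (y, z) \<in> Q} \<le> card (A1 \<union> A2 \<union> A3)"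
    using finQ assms(1) by (intro card_mono) (auto simp: A1_def A2_def A3_def)
  also have "\<dots> \<le> 3 * (card Q * card V)"
    using c card_Un_le[of "A1 \<union> A2" A3] card_Un_le[of A1 A2] by linarith
  finally have "real (card {(x, y, z) \<in> V \<times> V \<times> V. (x, y) \<in> Q \<or> (x, z) \<in> Q \<or> (y, z) \<in> Q}) \<le> real (3 * (card Q * card V))"
    by (simp only: of_nat_le_iff)
  also have "\<dots> = 3 * (real (card Q) * ?n)" by simp
  also have "\<dots> \<le> 3 * (\<rho> * ?n ^ 2 * ?n)" using Q(2) by (intro mult_left_mono mult_right_mono) auto
  finally show ?thesis by (simp add: power2_eq_square power3_eq_cube mult.assoc)
qed

section \<open>The graphs of a pair colouring and the triangles of a triad\<close>

text \<open>The index \<open>I\<close> is unordered, as \<open>decomposition\<close> requires,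
  whereas \<open>\<kappa>\<close> need not be symmetric; the order of the parts decides which of
  \<open>\<kappa> (x, y)\<close> and \<open>\<kappa> (y, x)\<close> is the colour of the
  edge.\<close>

definition pair_graph :: "'a set \<Rightarrow> ('a \<Rightarrow> nat) \<Rightarrow> ('a \<times> 'a \<Rightarrow> nat) \<Rightarrow> nat set \<Rightarrow> nat \<Rightarrow> 'a set set" where
  "pair_graph V \<pi> \<kappa> I \<alpha> = {{x, y} | x y. x \<in> V \<and> y \<in> V \<and> \<pi> x < \<pi> y \<and> {\<pi> x, \<pi> y} = I \<and> \<kappa> (x, y) = \<alpha>}"

lemma pair_graph_iff:
  assumes "i < j" "x \<in> part V \<pi> i" "y \<in> part V \<pi> j"
  shows "{x, y} \<in> pair_graph V \<pi> \<kappa> {i, j} \<alpha> \<longleftrightarrow> \<kappa> (x, y) = \<alpha>"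
proof
  assume "{x, y} \<in> pair_graph V \<pi> \<kappa> {i, j} \<alpha>"
  then obtain x' y' where *: "{x, y} = {x', y'}" "\<pi> x' < \<pi> y'" "\<kappa> (x', y') = \<alpha>"
    unfolding pair_graph_def by blast
  then have "x = x' \<and> y = y'" using assms by (auto simp: doubleton_eq_iff part_def)
  then show "\<kappa> (x, y) = \<alpha>" using * by simp
next
  assume "\<kappa> (x, y) = \<alpha>"
  moreover have "x \<in> V" "y \<in> V" "\<pi> x < \<pi> y" "{\<pi> x, \<pi> y} = {i, j}" using assms by (auto simp: part_def)
  ultimately show "{x, y} \<in> pair_graph V \<pi> \<kappa> {i, j} \<alpha>" unfolding pair_graph_def by blast
qed

lemma pair_graph_eq:
  assumes "i < j"
  shows "pair_graph V \<pi> \<kappa> {i, j} \<alpha> = {{x, y} | x y. x \<in> part V \<pi> i \<and> y \<in> part V \<pi> j \<and> \<kappa> (x, y) = \<alpha>}"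
proof (intro equalityI subsetI)
  fix e assume "e \<in> pair_graph V \<pi> \<kappa> {i, j} \<alpha>"
  then obtain x y where *: "e = {x, y}" "x \<in> V" "y \<in> V" "\<pi> x < \<pi> y" "{\<pi> x, \<pi> y} = {i, j}" "\<kappa> (x, y) = \<alpha>"
    unfolding pair_graph_def by blast
  then have "\<pi> x = i \<and> \<pi> y = j" using assms by (auto simp: doubleton_eq_iff)
  then show "e \<in> {{x, y} | x y. x \<in> part V \<pi> i \<and> y \<in> part V \<pi> j \<and> \<kappa> (x, y) = \<alpha>}"
    using * unfolding part_def by blast
next
  fix e assume "e \<in> {{x, y} | x y. x \<in> part V \<pi> i \<and> y \<in> part V \<pi> j \<and> \<kappa> (x, y) = \<alpha>}"
  then obtain x y where "e = {x, y}" "x \<in> part V \<pi> i" "y \<in> part V \<pi> j" "\<kappa> (x, y) = \<alpha>" by blast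
  then show "e \<in> pair_graph V \<pi> \<kappa> {i, j} \<alpha>" using pair_graph_iff[OF assms, of x V \<pi> y \<kappa> \<alpha>] by simp
qed

lemma pair_graph_Int_K2:
  assumes "i < j" "U \<subseteq> part V \<pi> i" "W \<subseteq> part V \<pi> j"
  shows "pair_graph V \<pi> \<kappa> {i, j} \<alpha> \<inter> K2 U W = (\<lambda>(x, y). {x, y}) ` {(x, y) \<in> U \<times> W. \<kappa> (x, y) = \<alpha>}"
proof (intro equalityI subsetI)
  fix e assume e: "e \<in> pair_graph V \<pi> \<kappa> {i, j} \<alpha> \<inter> K2 U W"
  then obtain x y where xy: "e = {x, y}" "x \<in> U" "y \<in> W" by (auto simp: K2_def)
  then have "\<kappa> (x, y) = \<alpha>" using e pair_graph_iff[of i j x V \<pi> y \<kappa> \<alpha>] assms by blast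
  then show "e \<in> (\<lambda>(x, y). {x, y}) ` {(x, y) \<in> U \<times> W. \<kappa> (x, y) = \<alpha>}" using xy by force
next
  fix e assume "e \<in> (\<lambda>(x, y). {x, y}) ` {(x, y) \<in> U \<times> W. \<kappa> (x, y) = \<alpha>}"
  then obtain x y where xy: "e = {x, y}" "x \<in> U" "y \<in> W" "\<kappa> (x, y) = \<alpha>" by auto
  moreover have "x \<in> part V \<pi> i" "y \<in> part V \<pi> j" using xy assms by auto
  moreover have "x \<noteq> y" using calculation assms(1) by (auto simp: part_def)
  ultimately show "e \<in> pair_graph V \<pi> \<kappa> {i, j} \<alpha> \<inter> K2 U W"
    using pair_graph_iff[OF assms(1), of x V \<pi> y \<kappa> \<alpha>] unfolding K2_def by blast
qed

lemma card_pair_graph_Int_K2: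
  assumes "i < j" "U \<subseteq> part V \<pi> i" "W \<subseteq> part V \<pi> j"
  shows "card (pair_graph V \<pi> \<kappa> {i, j} \<alpha> \<inter> K2 U W) = card {(x, y) \<in> U \<times> W. \<kappa> (x, y) = \<alpha>}"
proof -
  have "inj_on (\<lambda>(x, y). {x, y}) (part V \<pi> i \<times> part V \<pi> j)"
    using assms(1) by (auto simp: inj_on_def part_def doubleton_eq_iff)
  then have "inj_on (\<lambda>(x, y). {x, y}) {(x, y) \<in> U \<times> W. \<kappa> (x, y) = \<alpha>}"
    by (rule inj_on_subset) (use assms in auto)
  then show ?thesis unfolding pair_graph_Int_K2[OF assms] by (rule card_image)
qed

lemma pair_graph_subset_K2:
  assumes "i < j"
  shows "pair_graph V \<pi> \<kappa> {i, j} \<alpha> \<subseteq> K2 (part V \<pi> i) (part V \<pi> j)"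
proof
  fix e assume "e \<in> pair_graph V \<pi> \<kappa> {i, j} \<alpha>"
  then obtain x y where e: "e = {x, y}" and xy: "x \<in> part V \<pi> i" "y \<in> part V \<pi> j"
    unfolding pair_graph_eq[OF assms] by blast
  have "x \<noteq> y" using xy assms by (auto simp: part_def)
  then show "e \<in> K2 (part V \<pi> i) (part V \<pi> j)" using e xy unfolding K2_def by blast
qed

text \<open>\<open>disc2\<close> compares with the actual density. On nonempty parts the assumption
  for the full parts puts it within \<open>\<epsilon> / 2\<close> of \<open>p\<close>, whence the
  halved error in \<open>d\<close>.\<close>

lemma disc2_dens_pair_graph:
  assumes "finite V" "i < j"
    and d: "\<And>U W. U \<subseteq> part V \<pi> i \<Longrightarrow> W \<subseteq> part V \<pi> j \<Longrightarrow>
      \<bar>real (card {(x, y) \<in> U \<times> W. \<kappa> (x, y) = \<alpha>}) - p * (real (card U) * real (card W))\<bar>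
       \<le> \<epsilon> / 2 * (real (card (part V \<pi> i)) * real (card (part V \<pi> j)))"
  shows "disc2_dens (part V \<pi> i) (part V \<pi> j) (pair_graph V \<pi> \<kappa> {i, j} \<alpha>) \<epsilon> p"
proof -
  let ?X = "part V \<pi> i" and ?Y = "part V \<pi> j" and ?P = "pair_graph V \<pi> \<kappa> {i, j} \<alpha>"
  let ?a = "real (card ?X) * real (card ?Y)"
  have fin: "finite ?X" "finite ?Y" using assms(1) by (auto simp: part_def)
  have cP: "card ?P = card {(x, y) \<in> ?X \<times> ?Y. \<kappa> (x, y) = \<alpha>}"
    using card_pair_graph_Int_K2[OF assms(2) subset_refl subset_refl, of V \<pi> \<kappa> \<alpha>]
      pair_graph_subset_K2[OF assms(2), of V \<pi> \<kappa> \<alpha>] by (simp add: Int_absorb2)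
  have full: "\<bar>real (card ?P) - p * ?a\<bar> \<le> \<epsilon> / 2 * ?a" unfolding cP by (rule d) auto
  have dens: "\<bar>(bip_density ?X ?Y ?P - p) * ?a\<bar> \<le> \<epsilon> / 2 * ?a"
  proof (cases "?a = 0")
    case False
    then have "bip_density ?X ?Y ?P * ?a = real (card ?P)" by (simp add: bip_density_def)
    then show ?thesis using full by (simp add: left_diff_distrib)
  next
    case True
    then show ?thesis by (simp only: mult_zero_right abs_zero order_refl)
  qed
  have a0: "0 \<le> \<epsilon> / 2 * ?a" using dens by linarith
  have "disc2 ?X ?Y ?P \<epsilon>" unfolding disc2_def
  proof (intro allI impI)
    fix U W assume UW: "U \<subseteq> ?X" "W \<subseteq> ?Y"
    have b: "real (card U) * real (card W) \<le> ?a"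
      using card_mono[OF fin(1) UW(1)] card_mono[OF fin(2) UW(2)] by (intro mult_mono) simp_all
    have "\<bar>bip_density ?X ?Y ?P - p\<bar> * (real (card U) * real (card W)) \<le> \<bar>bip_density ?X ?Y ?P - p\<bar> * ?a"
      using b by (intro mult_left_mono) auto
    also have "\<dots> = \<bar>(bip_density ?X ?Y ?P - p) * ?a\<bar>" by (simp add: abs_mult)
    also note dens
    finally have "\<bar>bip_density ?X ?Y ?P * (real (card U) * real (card W)) - p * (real (card U) * real (card W))\<bar> \<le> \<epsilon> / 2 *
        ?a"
      by (simp add: left_diff_distrib[symmetric] abs_mult)
    moreover have "\<bar>real (card (?P \<inter> K2 U W)) - p * (real (card U) * real (card W))\<bar> \<le> \<epsilon> / 2 * ?a"
      unfolding card_pair_graph_Int_K2[OF assms(2) UW] by (rule d[OF UW])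
    ultimately show "\<bar>real (card (?P \<inter> K2 U W)) - bip_density ?X ?Y ?P * real (card U) * real (card W)\<bar>
        \<le> \<epsilon> * real (card ?X) * real (card ?Y)"
      unfolding mult.assoc by linarith
  qed
  moreover have "\<bar>real (card ?P) - p * real (card ?X) * real (card ?Y)\<bar> \<le> \<epsilon> * real (card ?X) * real (card ?Y)"
    using full a0 unfolding mult.assoc by linarith
  ultimately show ?thesis by (simp add: disc2_dens_def)
qed

text \<open>Ordered triples replace triangles as sets, so that counting takes place in products;
  \<open>K3_triad_edges\<close> and \<open>inj_on_triad_triples\<close> show that the two correspond
  bijectively for \<open>i < j < k\<close>.\<close>

definition triad_triples :: "'a set \<Rightarrow> ('a \<Rightarrow> nat) \<Rightarrow> ('a \<times> 'a \<Rightarrow> nat) \<Rightarrow> nat \<Rightarrow> nat \<Rightarrow> nat \<Rightarrow> nat \<Rightarrow> nat \<Rightarrow> nat \<Rightarrow>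
    ('a \<times> 'a \<times> 'a) set" where
  "triad_triples V \<pi> \<kappa> i j k \<alpha> \<beta> \<gamma> = {(x, y, z) \<in> part V \<pi> i \<times> part V \<pi> j \<times> part V \<pi> k.
     \<kappa> (x, y) = \<alpha> \<and> \<kappa> (x, z) = \<beta> \<and> \<kappa> (y, z) = \<gamma>}"

definition triad_edges :: "'a set \<Rightarrow> ('a \<Rightarrow> nat) \<Rightarrow> ('a \<times> 'a \<Rightarrow> nat) \<Rightarrow> nat \<Rightarrow> nat \<Rightarrow> nat \<Rightarrow> nat \<Rightarrow> nat \<Rightarrow> nat \<Rightarrow>
    'a set set" where
  "triad_edges V \<pi> \<kappa> i j k \<alpha> \<beta> \<gamma> = pair_graph V \<pi> \<kappa> {i, j} \<alpha> \<union> pair_graph V \<pi> \<kappa> {i, k} \<beta> \<union> pair_graph V \<pi> \<kappa> {j, k} \<gamma>"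

lemma triad_edges_Int_K2:
  assumes "i < j" "j < k"
  shows "triad_edges V \<pi> \<kappa> i j k \<alpha> \<beta> \<gamma> \<inter> K2 (part V \<pi> i) (part V \<pi> j) = pair_graph V \<pi> \<kappa> {i, j} \<alpha>"
    "triad_edges V \<pi> \<kappa> i j k \<alpha> \<beta> \<gamma> \<inter> K2 (part V \<pi> i) (part V \<pi> k) = pair_graph V \<pi> \<kappa> {i, k} \<beta>"
    "triad_edges V \<pi> \<kappa> i j k \<alpha> \<beta> \<gamma> \<inter> K2 (part V \<pi> j) (part V \<pi> k) = pair_graph V \<pi> \<kappa> {j, k} \<gamma>"
proof -
  have ik: "i < k" using assms by simp
  have disj: "K2 (part V \<pi> a) (part V \<pi> b) \<inter> K2 (part V \<pi> c) (part V \<pi> d) = {}" if "{a, b} \<noteq> {c, d}" for a b c d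
  proof (rule ccontr)
    assume "\<not> ?thesis"
    then obtain x y x' y' where eq: "{x, y} = {x', y'}" and *: "\<pi> x = a" "\<pi> y = b" "\<pi> x' = c" "\<pi> y' = d"
      by (auto simp: K2_def part_def)
    from eq have "\<pi> ` {x, y} = \<pi> ` {x', y'}" by (rule arg_cong)
    then have "{a, b} = {c, d}" unfolding image_insert image_empty * .
    then show False using that by contradiction
  qed
  note sub = pair_graph_subset_K2[OF assms(1), of V \<pi> \<kappa> \<alpha>] pair_graph_subset_K2[OF ik, of V \<pi> \<kappa> \<beta>]
    pair_graph_subset_K2[OF assms(2), of V \<pi> \<kappa> \<gamma>]
  have ne: "{i, j} \<noteq> {i, k}" "{i, j} \<noteq> {j, k}" "{i, k} \<noteq> {j, k}" using assms by (auto simp: doubleton_eq_iff)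
  show "triad_edges V \<pi> \<kappa> i j k \<alpha> \<beta> \<gamma> \<inter> K2 (part V \<pi> i) (part V \<pi> j) = pair_graph V \<pi> \<kappa> {i, j} \<alpha>"
    unfolding triad_edges_def using sub disj[OF ne(1)] disj[OF ne(2)] by blast
  show "triad_edges V \<pi> \<kappa> i j k \<alpha> \<beta> \<gamma> \<inter> K2 (part V \<pi> i) (part V \<pi> k) = pair_graph V \<pi> \<kappa> {i, k} \<beta>"
    unfolding triad_edges_def using sub disj[OF ne(1)] disj[OF ne(3)] by blast
  show "triad_edges V \<pi> \<kappa> i j k \<alpha> \<beta> \<gamma> \<inter> K2 (part V \<pi> j) (part V \<pi> k) = pair_graph V \<pi> \<kappa> {j, k} \<gamma>"
    unfolding triad_edges_def using sub disj[OF ne(2)] disj[OF ne(3)] by blast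
qed

lemma pair_graphD:
  assumes "{a, b} \<in> pair_graph V \<pi> \<kappa> I \<alpha>"
  shows "a \<in> V" "b \<in> V" "\<pi> a \<noteq> \<pi> b" "\<pi> a \<in> I" "\<pi> b \<in> I"
proof -
  obtain x y where *: "{a, b} = {x, y}" "x \<in> V" "y \<in> V" "\<pi> x < \<pi> y" "{\<pi> x, \<pi> y} = I"
    using assms unfolding pair_graph_def by blast
  from *(1) have "a = x \<and> b = y \<or> a = y \<and> b = x" by (simp add: doubleton_eq_iff)
  then show "a \<in> V" "b \<in> V" "\<pi> a \<noteq> \<pi> b" "\<pi> a \<in> I" "\<pi> b \<in> I" using *(2-5) by auto
qed

lemma triad_edges_D:
  assumes "{a, b} \<in> triad_edges V \<pi> \<kappa> i j k \<alpha> \<beta> \<gamma>"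
  shows "a \<in> V" "b \<in> V" "\<pi> a \<noteq> \<pi> b" "\<pi> a \<in> {i, j, k}" "\<pi> b \<in> {i, j, k}"
proof -
  obtain I \<alpha>' where "{a, b} \<in> pair_graph V \<pi> \<kappa> I \<alpha>'" "I \<subseteq> {i, j, k}"
    using assms unfolding triad_edges_def by blast
  from pair_graphD[OF this(1)] this(2)
  show "a \<in> V" "b \<in> V" "\<pi> a \<noteq> \<pi> b" "\<pi> a \<in> {i, j, k}" "\<pi> b \<in> {i, j, k}" by blast+
qed

lemma injection_3_cases:
  assumes "a \<in> {i, j, k}" "b \<in> {i, j, k}" "c \<in> {i, j, k}" "a \<noteq> b" "a \<noteq> c" "b \<noteq> c"
  shows "(a = i \<and> b = j \<and> c = k) \<or> (a = i \<and> c = j \<and> b = k) \<or> (b = i \<and> a = j \<and> c = k) \<or>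
    (b = i \<and> c = j \<and> a = k) \<or> (c = i \<and> a = j \<and> b = k) \<or> (c = i \<and> b = j \<and> a = k)"
  using assms unfolding insert_iff empty_iff by argo

text \<open>Edges join different parts among the three, so a triangle has one vertex in each part;
  the six cases are the possible assignments of its vertices to the parts.\<close>

lemma K3_triad_edges:
  assumes "i < j" "j < k"
  shows "K3 (triad_edges V \<pi> \<kappa> i j k \<alpha> \<beta> \<gamma>) = (\<lambda>(x, y, z). {x, y, z}) ` triad_triples V \<pi> \<kappa> i j k \<alpha> \<beta> \<gamma>"
proof (intro equalityI subsetI)
  let ?E = "triad_edges V \<pi> \<kappa> i j k \<alpha> \<beta> \<gamma>"
  have ik: "i < k" using assms by simp
  {
    fix e assume "e \<in> K3 ?E"
    then obtain a b c where e: "e = {a, b, c}" and E: "{a, b} \<in> ?E" "{a, c} \<in> ?E" "{b, c} \<in> ?E"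
      by (auto simp: K3_def)
    note D = triad_edges_D[OF E(1)] triad_edges_D[OF E(2)] triad_edges_D[OF E(3)]
    have V: "a \<in> V" "b \<in> V" "c \<in> V" by (rule D)+
    have main: "e \<in> (\<lambda>(x, y, z). {x, y, z}) ` triad_triples V \<pi> \<kappa> i j k \<alpha> \<beta> \<gamma>"
      if x: "e = {x, y, z}" "\<pi> x = i" "\<pi> y = j" "\<pi> z = k" "x \<in> V" "y \<in> V" "z \<in> V"
        and E': "{x, y} \<in> ?E" "{x, z} \<in> ?E" "{y, z} \<in> ?E" for x y z
    proof -
      have p: "x \<in> part V \<pi> i" "y \<in> part V \<pi> j" "z \<in> part V \<pi> k" using x by (simp_all add: part_def)
      have "x \<noteq> y" "x \<noteq> z" "y \<noteq> z" using x assms by auto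
      then have "{x, y} \<in> K2 (part V \<pi> i) (part V \<pi> j)" "{x, z} \<in> K2 (part V \<pi> i) (part V \<pi> k)"
        "{y, z} \<in> K2 (part V \<pi> j) (part V \<pi> k)" using p unfolding K2_def by blast+
      then have "{x, y} \<in> pair_graph V \<pi> \<kappa> {i, j} \<alpha>" "{x, z} \<in> pair_graph V \<pi> \<kappa> {i, k} \<beta>"
        "{y, z} \<in> pair_graph V \<pi> \<kappa> {j, k} \<gamma>"
        using E' triad_edges_Int_K2[OF assms, of V \<pi> \<kappa> \<alpha> \<beta> \<gamma>] by blast+
      then have "\<kappa> (x, y) = \<alpha>" "\<kappa> (x, z) = \<beta>" "\<kappa> (y, z) = \<gamma>"
        by (simp_all only: pair_graph_iff[OF assms(1) p(1,2)] pair_graph_iff[OF ik p(1,3)] pair_graph_iff[OF assms(2)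
            p(2,3)])
      then have "(x, y, z) \<in> triad_triples V \<pi> \<kappa> i j k \<alpha> \<beta> \<gamma>" using p by (simp add: triad_triples_def)
      then show ?thesis using x(1) by force
    qed
    have sym: "{b, a} \<in> ?E" "{c, a} \<in> ?E" "{c, b} \<in> ?E" using E by (simp_all add: insert_commute)
    have perm: "e = {a, c, b}" "e = {b, a, c}" "e = {b, c, a}" "e = {c, a, b}" "e = {c, b, a}" unfolding e by auto
    consider "\<pi> a = i" "\<pi> b = j" "\<pi> c = k" | "\<pi> a = i" "\<pi> c = j" "\<pi> b = k" | "\<pi> b = i" "\<pi> a = j" "\<pi> c = k"
      | "\<pi> b = i" "\<pi> c = j" "\<pi> a = k" | "\<pi> c = i" "\<pi> a = j" "\<pi> b = k" | "\<pi> c = i" "\<pi> b = j" "\<pi> a = k"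
      using injection_3_cases[OF D(4,5,10) D(3,8,13)] by argo
    then show "e \<in> (\<lambda>(x, y, z). {x, y, z}) ` triad_triples V \<pi> \<kappa> i j k \<alpha> \<beta> \<gamma>"
    proof cases
      case 1 show ?thesis by (rule main[OF e 1 V E])
    next
      case 2 show ?thesis by (rule main[OF perm(1) 2 V(1,3,2) E(2,1) sym(3)])
    next
      case 3 show ?thesis by (rule main[OF perm(2) 3 V(2,1,3) sym(1) E(3,2)])
    next
      case 4 show ?thesis by (rule main[OF perm(3) 4 V(2,3,1) E(3) sym(1,2)])
    next
      case 5 show ?thesis by (rule main[OF perm(4) 5 V(3,1,2) sym(2,3) E(1)])
    next
      case 6 show ?thesis by (rule main[OF perm(5) 6 V(3,2,1) sym(3,2,1)])
    qed
  next
    fix e assume "e \<in> (\<lambda>(x, y, z). {x, y, z}) ` triad_triples V \<pi> \<kappa> i j k \<alpha> \<beta> \<gamma>"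
    then obtain x y z where x: "e = {x, y, z}" "x \<in> part V \<pi> i" "y \<in> part V \<pi> j" "z \<in> part V \<pi> k"
      "\<kappa> (x, y) = \<alpha>" "\<kappa> (x, z) = \<beta>" "\<kappa> (y, z) = \<gamma>" by (auto simp: triad_triples_def)
    have ne: "x \<noteq> y" "x \<noteq> z" "y \<noteq> z" using x assms by (auto simp: part_def)
    have "{x, y} \<in> ?E" "{x, z} \<in> ?E" "{y, z} \<in> ?E"
      using pair_graph_iff[OF assms(1) x(2,3)] pair_graph_iff[OF ik x(2,4)] pair_graph_iff[OF assms(2) x(3,4)] x(5-7)
      unfolding triad_edges_def by blast+
    then show "e \<in> K3 ?E" using x(1) ne unfolding K3_def by blast
  }
qed

lemma inj_on_triad_triples:
  assumes "i < j" "j < k"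
  shows "inj_on (\<lambda>(x, y, z). {x, y, z}) (triad_triples V \<pi> \<kappa> i j k \<alpha> \<beta> \<gamma>)"
proof (rule inj_onI)
  fix p q
  assume pq: "p \<in> triad_triples V \<pi> \<kappa> i j k \<alpha> \<beta> \<gamma>" "q \<in> triad_triples V \<pi> \<kappa> i j k \<alpha> \<beta> \<gamma>"
    and eq': "(\<lambda>(x, y, z). {x, y, z}) p = (\<lambda>(x, y, z). {x, y, z}) q"
  obtain x y z x' y' z' where p: "p = (x, y, z)" and q: "q = (x', y', z')" by (metis prod_cases3)
  have eq: "{x, y, z} = {x', y', z'}" using eq' by (simp add: p q)
  have *: "\<pi> x = i" "\<pi> y = j" "\<pi> z = k" "\<pi> x' = i" "\<pi> y' = j" "\<pi> z' = k"
    using pq by (simp_all add: p q triad_triples_def part_def)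
  have "x \<in> {x', y', z'}" "y \<in> {x', y', z'}" "z \<in> {x', y', z'}" unfolding eq[symmetric] by simp_all
  moreover have "i \<noteq> j" "j \<noteq> k" "i \<noteq> k" using assms by simp_all
  ultimately have "x = x' \<and> y = y' \<and> z = z'" using * by (metis insertE emptyE)
  then show "p = q" by (simp add: p q)
qed

section \<open>Quasirandom and nearly homogeneous triads\<close>

definition near_homogeneous :: "'a set set \<Rightarrow> real \<Rightarrow> ('a \<times> 'a \<times> 'a) set \<Rightarrow> bool" where
  "near_homogeneous F \<mu> T \<longleftrightarrow>
     real (card {(x, y, z) \<in> T. {x, y, z} \<in> F}) \<le> \<mu> * real (card T) \<or>
     real (card {(x, y, z) \<in> T. {x, y, z} \<notin> F}) \<le> \<mu> * real (card T)"

definition uniform_pair :: "'a set \<Rightarrow> ('a \<Rightarrow> nat) \<Rightarrow> ('a \<times> 'a \<Rightarrow> nat) \<Rightarrow> nat \<Rightarrow> real \<Rightarrow> nat \<Rightarrow> nat \<Rightarrow> bool" where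
  "uniform_pair V \<pi> \<kappa> l \<xi> i j \<longleftrightarrow> (\<forall>\<alpha>\<in>{1..l}. \<forall>U W. U \<subseteq> part V \<pi> i \<longrightarrow> W \<subseteq> part V \<pi> j \<longrightarrow>
     \<bar>real (card {(x, y) \<in> U \<times> W. \<kappa> (x, y) = \<alpha>}) - 1 / real l * (real (card U) * real (card W))\<bar>
       \<le> \<xi> * (real (card (part V \<pi> i)) * real (card (part V \<pi> j))))"

lemma K3_mono:
  assumes "E' \<subseteq> E"
  shows "K3 E' \<subseteq> K3 E"
proof
  fix e assume "e \<in> K3 E'"
  then obtain x y z where e: "e = {x, y, z}" "x \<noteq> y" "x \<noteq> z" "y \<noteq> z"
    and E': "{x, y} \<in> E'" "{x, z} \<in> E'" "{y, z} \<in> E'" unfolding K3_def by blast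
  then have "{x, y} \<in> E" "{x, z} \<in> E" "{y, z} \<in> E" using assms by blast+
  then show "e \<in> K3 E" using e unfolding K3_def by blast
qed

lemma uniform_pair_disc2_dens:
  assumes "finite V" "i < j" "uniform_pair V \<pi> \<kappa> l (\<epsilon> / 2) i j" "\<alpha> \<in> {1..l}"
  shows "disc2_dens (part V \<pi> i) (part V \<pi> j) (pair_graph V \<pi> \<kappa> {i, j} \<alpha>) \<epsilon> (1 / real l)"
proof (rule disc2_dens_pair_graph[OF assms(1,2)])
  fix U W assume "U \<subseteq> part V \<pi> i" "W \<subseteq> part V \<pi> j"
  then show "\<bar>real (card {(x, y) \<in> U \<times> W. \<kappa> (x, y) = \<alpha>}) - 1 / real l * (real (card U) * real (card W))\<bar>
       \<le> \<epsilon> / 2 * (real (card (part V \<pi> i)) * real (card (part V \<pi> j)))"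
    using assms(3)[unfolded uniform_pair_def, rule_format, OF assms(4)] by simp
qed

lemma uniform_pair_mono:
  assumes "uniform_pair V \<pi> \<kappa> l \<xi> i j" "\<xi> \<le> \<xi>'"
  shows "uniform_pair V \<pi> \<kappa> l \<xi>' i j"
proof -
  have "\<xi> * (real (card (part V \<pi> i)) * real (card (part V \<pi> j))) \<le> \<xi>' * (real (card (part V \<pi> i)) * real (card (part V \<pi>
      j)))"
    using assms(2) by (intro mult_right_mono) auto
  then show ?thesis using assms(1) unfolding uniform_pair_def by (meson order_trans)
qed

text \<open>
  A triad of quasirandom pairs has at most about \<open>1 / l\<^sup>3\<close> of all triples as triangles, so an error of
  \<open>\<mu>\<close> times the number of triangles is admissible in \<open>disc23\<close>: near homogeneity already implies
  regularity.
\<close>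

lemma good_triad:
  fixes \<epsilon>1 \<epsilon>2 \<xi> \<mu> :: real
  assumes V: "finite V" and ijk: "i < j" "j < k" and l: "l \<ge> 1"
    and col: "\<alpha> \<in> {1..l}" "\<beta> \<in> {1..l}" "\<gamma> \<in> {1..l}"
    and u: "uniform_pair V \<pi> \<kappa> l \<xi> i j" "uniform_pair V \<pi> \<kappa> l \<xi> i k" "uniform_pair V \<pi> \<kappa> l \<xi> j k"
    and \<xi>: "0 \<le> \<xi>" "2 * \<xi> \<le> \<epsilon>2" "3 * \<xi> \<le> (1 / real l) ^ 3" and \<mu>: "0 < \<mu>" "2 * \<mu> \<le> \<epsilon>1"
    and hom: "near_homogeneous F \<mu> (triad_triples V \<pi> \<kappa> i j k \<alpha> \<beta> \<gamma>)"
    and ne: "triad_triples V \<pi> \<kappa> i j k \<alpha> \<beta> \<gamma> \<noteq> {}"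
  shows "disc23 (part V \<pi> i) (part V \<pi> j) (part V \<pi> k) (triad_edges V \<pi> \<kappa> i j k \<alpha> \<beta> \<gamma>)
      (F \<inter> K3 (triad_edges V \<pi> \<kappa> i j k \<alpha> \<beta> \<gamma>)) \<epsilon>1 \<epsilon>2" (is ?disc)
    and "tri_density F (triad_edges V \<pi> \<kappa> i j k \<alpha> \<beta> \<gamma>) \<in> {0..<\<epsilon>1} \<union> {1 - \<epsilon>1<..1}" (is ?dens)
proof -
  let ?E = "triad_edges V \<pi> \<kappa> i j k \<alpha> \<beta> \<gamma>" and ?TT = "triad_triples V \<pi> \<kappa> i j k \<alpha> \<beta> \<gamma>"
  let ?X = "part V \<pi> i" and ?Y = "part V \<pi> j" and ?Z = "part V \<pi> k"
  let ?T = "K3 ?E" and ?s = "\<lambda>(x, y, z). {x, y, z}"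
  have ik: "i < k" using ijk by simp
  have fin: "finite ?X" "finite ?Y" "finite ?Z" using V by (auto simp: part_def)
  have finTT: "finite ?TT"
    by (rule finite_subset[of _ "?X \<times> ?Y \<times> ?Z"]) (use fin in \<open>auto simp: triad_triples_def\<close>)
  have T: "?T = ?s ` ?TT" by (rule K3_triad_edges[OF ijk])
  have inj: "inj_on ?s ?TT" by (rule inj_on_triad_triples[OF ijk])
  have finT: "finite ?T" using finTT T by simp
  have cT: "card ?T = card ?TT" unfolding T by (rule card_image[OF inj])
  have cTpos: "real (card ?T) > 0" using cT ne finTT by (simp add: card_gt_0_iff)
  have sub: "card {(x, y, z) \<in> ?TT. Q {x, y, z}} = card {e \<in> ?T. Q e}" for Q
  proof -
    have "{e \<in> ?T. Q e} = ?s ` {(x, y, z) \<in> ?TT. Q {x, y, z}}" unfolding T by auto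
    moreover have "inj_on ?s {(x, y, z) \<in> ?TT. Q {x, y, z}}" by (rule inj_on_subset[OF inj]) auto
    ultimately show ?thesis by (simp only: card_image)
  qed
  have "{e \<in> ?T. e \<in> F} = F \<inter> ?T" "{e \<in> ?T. e \<notin> F} = ?T - F" by auto
  then have homT: "real (card (F \<inter> ?T)) \<le> \<mu> * real (card ?T) \<or> real (card (?T - F)) \<le> \<mu> * real (card ?T)"
    using hom sub[of "\<lambda>e. e \<in> F"] sub[of "\<lambda>e. e \<notin> F"] unfolding near_homogeneous_def cT by simp
  \<comment> \<open>The factor 2 absorbs the counting error, as
    \<open>3 * \<xi> \<le> (1 / l) ^ 3\<close>.\<close>
  have count: "real (card ?T) \<le> 2 * (1 / real l) ^ 3 * (real (card ?X) * real (card ?Y) * real (card ?Z))"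
  proof -
    have b: "real (card {(x, y) \<in> U \<times> W. \<kappa> (x, y) = c}) \<le>
        1 / real l * (real (card U) * real (card W)) + \<xi> * (real (card (part V \<pi> a)) * real (card (part V \<pi> b)))"
      if "uniform_pair V \<pi> \<kappa> l \<xi> a b" "c \<in> {1..l}" "U \<subseteq> part V \<pi> a" "W \<subseteq> part V \<pi> b" for a b c U W
    proof -
      have "\<bar>real (card {(x, y) \<in> U \<times> W. \<kappa> (x, y) = c}) - 1 / real l * (real (card U) * real (card W))\<bar>
         \<le> \<xi> * (real (card (part V \<pi> a)) * real (card (part V \<pi> b)))"
        using that unfolding uniform_pair_def by blast
      then show ?thesis by linarith
    qed
    have "real (card {(x, y, z) \<in> ?X \<times> ?Y \<times> ?Z. \<kappa> (x, y) = \<alpha> \<and> \<kappa> (x, z) = \<beta> \<and> \<kappa> (y, z) = \<gamma>}) \<le>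
        ((1 / real l) ^ 3 + 3 * \<xi>) * (real (card ?X) * real (card ?Y) * real (card ?Z))"
    proof (rule triangle_count_le)
      show "0 \<le> 1 / real l" "1 / real l \<le> 1" "0 \<le> \<xi>" using l \<xi> by simp_all
    qed (rule fin b u col | assumption)+
    also have "\<dots> \<le> (2 * (1 / real l) ^ 3) * (real (card ?X) * real (card ?Y) * real (card ?Z))"
      using \<xi> by (intro mult_right_mono) auto
    finally show ?thesis unfolding cT triad_triples_def .
  qed
  have "\<xi> \<le> \<epsilon>2 / 2" using \<xi> by simp
  note u' = u[THEN uniform_pair_mono, OF this]
  show ?disc
    unfolding disc23_def Let_def
  proof (intro exI[of _ "1 / real l"] conjI allI impI)
    show "0 < 1 / real l" "1 / real l \<le> 1" using l by simp_all
    show "disc2_dens ?X ?Y (?E \<inter> K2 ?X ?Y) \<epsilon>2 (1 / real l)"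
      unfolding triad_edges_Int_K2[OF ijk] by (rule uniform_pair_disc2_dens[OF V ijk(1) u'(1) col(1)])
    show "disc2_dens ?X ?Z (?E \<inter> K2 ?X ?Z) \<epsilon>2 (1 / real l)"
      unfolding triad_edges_Int_K2[OF ijk] by (rule uniform_pair_disc2_dens[OF V ik u'(2) col(2)])
    show "disc2_dens ?Y ?Z (?E \<inter> K2 ?Y ?Z) \<epsilon>2 (1 / real l)"
      unfolding triad_edges_Int_K2[OF ijk] by (rule uniform_pair_disc2_dens[OF V ijk(2) u'(3) col(3)])
    fix E' assume "E' \<subseteq> ?E"
    then have E': "K3 E' \<subseteq> ?T" by (rule K3_mono)
    have "F \<inter> ?T \<inter> K3 E' = F \<inter> K3 E'" "F \<inter> ?T \<inter> ?T = F \<inter> ?T" using E' by auto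
    then have "\<bar>real (card (F \<inter> ?T \<inter> K3 E')) - tri_density (F \<inter> ?T) ?E * real (card (K3 E'))\<bar> \<le> \<mu> * real (card ?T)"
      using near_homogeneous_disc[OF finT E' homT] by (simp add: tri_density_def)
    also have "\<dots> \<le> \<mu> * (2 * (1 / real l) ^ 3 * (real (card ?X) * real (card ?Y) * real (card ?Z)))"
      using count \<mu> by (intro mult_left_mono) auto
    also have "\<dots> = 2 * \<mu> * ((1 / real l) ^ 3 * (real (card ?X) * real (card ?Y) * real (card ?Z)))"
      by (simp add: mult.assoc)
    also have "\<dots> \<le> \<epsilon>1 * ((1 / real l) ^ 3 * (real (card ?X) * real (card ?Y) * real (card ?Z)))"
      using \<mu> by (intro mult_right_mono) auto
    finally show "\<bar>real (card (F \<inter> ?T \<inter> K3 E')) - tri_density (F \<inter> ?T) ?E * real (card (K3 E'))\<bar>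
        \<le> \<epsilon>1 * (1 / real l) ^ 3 * real (card ?X) * real (card ?Y) * real (card ?Z)"
      by (simp only: mult.assoc)
  qed
  have td: "tri_density F ?E * real (card ?T) = real (card (F \<inter> ?T))" using cTpos by (simp add: tri_density_def)
  have "card (F \<inter> ?T) \<le> card ?T" using finT by (intro card_mono) auto
  then have td01: "0 \<le> tri_density F ?E" "tri_density F ?E \<le> 1" using cTpos by (auto simp: tri_density_def)
  have cD: "real (card (F \<inter> ?T)) + real (card (?T - F)) = real (card ?T)"
    using card_Int_Diff[OF finT, of F] by (simp add: Int_commute)
  from homT show ?dens
  proof
    assume "real (card (F \<inter> ?T)) \<le> \<mu> * real (card ?T)"
    then have "tri_density F ?E \<le> \<mu>" unfolding td[symmetric] using cTpos mult_le_cancel_right_pos by blast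
    then have "tri_density F ?E < \<epsilon>1" using \<mu> by linarith
    then show ?thesis using td01 by simp
  next
    assume "real (card (?T - F)) \<le> \<mu> * real (card ?T)"
    then have "(1 - \<mu>) * real (card ?T) \<le> tri_density F ?E * real (card ?T)"
      using cD unfolding td left_diff_distrib by linarith
    then have "1 - \<mu> \<le> tri_density F ?E" using cTpos mult_le_cancel_right_pos by blast
    then have "1 - \<epsilon>1 < tri_density F ?E" using \<mu> by linarith
    then show ?thesis using td01 by simp
  qed
qed

section \<open>From a pair colouring to the decomposition\<close>

lemma sorted_triple:
  fixes f :: "'a \<Rightarrow> nat"
  shows "\<exists>x y z. {a, b, c} = {x, y, z} \<and> f x \<le> f y \<and> f y \<le> f z"
proof -
  have p: "{a, b, c} = {a, c, b}" "{a, b, c} = {b, a, c}" "{a, b, c} = {b, c, a}" "{a, b, c} = {c, a, b}" "{a, b, c} = {c, b,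
      a}"
    by auto
  consider "f a \<le> f b" "f b \<le> f c" | "f a \<le> f c" "f c \<le> f b" | "f b \<le> f a" "f a \<le> f c" | "f b \<le> f c" "f c \<le> f a"
    | "f c \<le> f a" "f a \<le> f b" | "f c \<le> f b" "f b \<le> f a" by linarith
  then show ?thesis
  proof cases
    case 1 then show ?thesis by blast
  next
    case 2 then show ?thesis using p(1) by blast
  next
    case 3 then show ?thesis using p(2) by blast
  next
    case 4 then show ?thesis using p(3) by blast
  next
    case 5 then show ?thesis using p(4) by blast
  next
    case 6 then show ?thesis using p(5) by blast
  qed
qed

definition good_triple :: "'a set \<Rightarrow> 'a set set \<Rightarrow> ('a \<Rightarrow> nat) \<Rightarrow> ('a \<times> 'a \<Rightarrow> nat) \<Rightarrow> nat \<Rightarrow> real \<Rightarrow> real \<Rightarrow> 'a \<Rightarrow> 'a \<Rightarrow> 'a \<Rightarrow> bool"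
    where
  "good_triple V F \<pi> \<kappa> l \<xi> \<mu> x y z \<longleftrightarrow> \<pi> x < \<pi> y \<and> \<pi> y < \<pi> z \<and>
     uniform_pair V \<pi> \<kappa> l \<xi> (\<pi> x) (\<pi> y) \<and> uniform_pair V \<pi> \<kappa> l \<xi> (\<pi> x) (\<pi> z) \<and> uniform_pair V \<pi> \<kappa> l \<xi> (\<pi> y) (\<pi> z) \<and>
     near_homogeneous F \<mu> (triad_triples V \<pi> \<kappa> (\<pi> x) (\<pi> y) (\<pi> z) (\<kappa> (x, y)) (\<kappa> (x, z)) (\<kappa> (y, z)))"

text \<open>Every 3-set can be listed with nondecreasing \<open>f\<close>, so only such lists have
  to be counted. Equality is allowed in order to include 3-sets with two vertices in the same
  part.\<close>

lemma card_nsets3_bad_le: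
  assumes V: "finite V"
    and bad: "real (card {(x, y, z) \<in> V \<times> V \<times> V. f x \<le> (f y :: nat) \<and> f y \<le> f z \<and> \<not> G x y z}) \<le> B"
    and G: "\<And>x y z. x \<in> V \<Longrightarrow> y \<in> V \<Longrightarrow> z \<in> V \<Longrightarrow> G x y z \<Longrightarrow> Q {x, y, z}"
  shows "real (card {e \<in> nsets V 3. \<not> Q e}) \<le> B"
proof -
  let ?A = "{(x, y, z) \<in> V \<times> V \<times> V. f x \<le> f y \<and> f y \<le> f z \<and> \<not> G x y z}"
  have finA: "finite ?A" by (rule finite_subset[of _ "V \<times> V \<times> V"]) (use V in auto)
  have "{e \<in> nsets V 3. \<not> Q e} \<subseteq> (\<lambda>(x, y, z). {x, y, z}) ` ?A"
  proof
    fix e assume "e \<in> {e \<in> nsets V 3. \<not> Q e}"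
    then obtain a b c where e: "e = {a, b, c}" "e \<subseteq> V" "\<not> Q e" by (auto simp: nsets_3_eq)
    obtain x y z where xyz: "e = {x, y, z}" "f x \<le> f y" "f y \<le> f z" using sorted_triple[of a b c f] e(1) by metis
    then have m: "x \<in> V" "y \<in> V" "z \<in> V" using e(2) by auto
    then have "\<not> G x y z" using G e(3) xyz(1) by blast
    then have "(x, y, z) \<in> ?A" using m xyz by simp
    then show "e \<in> (\<lambda>(x, y, z). {x, y, z}) ` ?A" using xyz(1) by force
  qed
  then have "card {e \<in> nsets V 3. \<not> Q e} \<le> card ((\<lambda>(x, y, z). {x, y, z}) ` ?A)"
    using finA by (intro card_mono) auto
  also have "\<dots> \<le> card ?A" using finA by (rule card_image_le)
  finally show ?thesis using bad by linarith
qed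

text \<open>A single count suffices for all three properties: each of their exceptional 3-sets comes
  from a triple that is not good. The two bounds on \<open>B\<close> match the two normalisations,
  by \<open>card V ^ 3\<close> and by the number of 3-sets.\<close>

lemma decomposition_of_colouring:
  fixes \<epsilon>1 \<epsilon>2 \<xi> \<mu> :: real
  assumes V: "finite V" and l: "l \<ge> 1" and t: "t \<ge> 1" and \<pi>: "\<And>x. x \<in> V \<Longrightarrow> \<pi> x \<in> {1..t}"
    and sz: "\<And>i j. i \<in> {1..t} \<Longrightarrow> j \<in> {1..t} \<Longrightarrow> i \<le> j \<Longrightarrow> card (part V \<pi> i) \<le> card (part V \<pi> j)"
      "card (part V \<pi> t) \<le> card (part V \<pi> 1) + 1"
    and \<kappa>: "\<And>x y. x \<in> V \<Longrightarrow> y \<in> V \<Longrightarrow> \<kappa> (x, y) \<in> {1..l}"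
    and \<xi>: "0 \<le> \<xi>" "2 * \<xi> \<le> \<epsilon>2" "3 * \<xi> \<le> (1 / real l) ^ 3" and \<mu>: "0 < \<mu>" "2 * \<mu> \<le> \<epsilon>1"
    and bad: "real (card {(x, y, z) \<in> V \<times> V \<times> V. \<pi> x \<le> \<pi> y \<and> \<pi> y \<le> \<pi> z \<and> \<not> good_triple V F \<pi> \<kappa> l \<xi> \<mu> x y z}) \<le> B"
    and B: "B \<le> \<epsilon>1 * real (card V) ^ 3" "B \<le> \<epsilon>1 * real (card V choose 3)"
  shows "decomposition V t l \<epsilon>1 \<epsilon>2 (part V \<pi>) (pair_graph V \<pi> \<kappa>)"
    and "regular_wrt V F t l (part V \<pi>) (pair_graph V \<pi> \<kappa>) \<epsilon>1 \<epsilon>2"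
    and "homogeneous_wrt V F t l (part V \<pi>) (pair_graph V \<pi> \<kappa>) \<epsilon>1"
proof -
  let ?Vs = "part V \<pi>" and ?P = "pair_graph V \<pi> \<kappa>"
  define G where "G = good_triple V F \<pi> \<kappa> l \<xi> \<mu>"
  note bad' = bad[folded G_def]
  have n3: "{\<pi> x, \<pi> y, \<pi> z} \<in> nsets {1..t} 3" if "x \<in> V" "y \<in> V" "z \<in> V" "\<pi> x < \<pi> y" "\<pi> y < \<pi> z" for x y z
    using that \<pi>[of x] \<pi>[of y] \<pi>[of z] by (auto simp: nsets_def)
  have self: "x \<in> ?Vs (\<pi> x)" if "x \<in> V" for x using that by (simp add: part_def)
  have core: "triad t l ?Vs ?P (?Vs (\<pi> x)) (?Vs (\<pi> y)) (?Vs (\<pi> z)) E \<and> {x, y, z} \<in> K3 E \<and>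
      disc23 (?Vs (\<pi> x)) (?Vs (\<pi> y)) (?Vs (\<pi> z)) E (F \<inter> K3 E) \<epsilon>1 \<epsilon>2 \<and> tri_density F E \<in> {0..<\<epsilon>1} \<union> {1 - \<epsilon>1<..1}"
    if xyz: "x \<in> V" "y \<in> V" "z \<in> V" and g: "G x y z"
      and E: "E = triad_edges V \<pi> \<kappa> (\<pi> x) (\<pi> y) (\<pi> z) (\<kappa> (x, y)) (\<kappa> (x, z)) (\<kappa> (y, z))" for x y z E
  proof -
    have lt: "\<pi> x < \<pi> y" "\<pi> y < \<pi> z" and
      u: "uniform_pair V \<pi> \<kappa> l \<xi> (\<pi> x) (\<pi> y)" "uniform_pair V \<pi> \<kappa> l \<xi> (\<pi> x) (\<pi> z)"
        "uniform_pair V \<pi> \<kappa> l \<xi> (\<pi> y) (\<pi> z)" and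
      hom: "near_homogeneous F \<mu> (triad_triples V \<pi> \<kappa> (\<pi> x) (\<pi> y) (\<pi> z) (\<kappa> (x, y)) (\<kappa> (x, z)) (\<kappa> (y, z)))"
      using g unfolding G_def good_triple_def by iprover+
    have mem: "(x, y, z) \<in> triad_triples V \<pi> \<kappa> (\<pi> x) (\<pi> y) (\<pi> z) (\<kappa> (x, y)) (\<kappa> (x, z)) (\<kappa> (y, z))"
      using xyz by (simp add: triad_triples_def part_def)
    then have ne: "triad_triples V \<pi> \<kappa> (\<pi> x) (\<pi> y) (\<pi> z) (\<kappa> (x, y)) (\<kappa> (x, z)) (\<kappa> (y, z)) \<noteq> {}" by blast
    have K: "{x, y, z} \<in> K3 E" unfolding E K3_triad_edges[OF lt] using mem by force
    have "triad t l ?Vs ?P (?Vs (\<pi> x)) (?Vs (\<pi> y)) (?Vs (\<pi> z)) E"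
      unfolding triad_def
      by (rule exI[of _ "\<pi> x"], rule exI[of _ "\<pi> y"], rule exI[of _ "\<pi> z"], rule exI[of _ "\<kappa> (x, y)"],
          rule exI[of _ "\<kappa> (x, z)"], rule exI[of _ "\<kappa> (y, z)"])
        (intro conjI refl n3 \<kappa> xyz lt, simp add: E triad_edges_def)
    moreover have "disc23 (?Vs (\<pi> x)) (?Vs (\<pi> y)) (?Vs (\<pi> z)) E (F \<inter> K3 E) \<epsilon>1 \<epsilon>2"
      unfolding E by (rule good_triad(1)[OF V lt l \<kappa>[OF xyz(1,2)] \<kappa>[OF xyz(1,3)] \<kappa>[OF xyz(2,3)] u \<xi> \<mu> hom ne])
    moreover have "tri_density F E \<in> {0..<\<epsilon>1} \<union> {1 - \<epsilon>1<..1}"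
      unfolding E by (rule good_triad(2)[OF V lt l \<kappa>[OF xyz(1,2)] \<kappa>[OF xyz(1,3)] \<kappa>[OF xyz(2,3)] u \<xi> \<mu> hom ne])
    ultimately show ?thesis using K by blast
  qed
  show "regular_wrt V F t l ?Vs ?P \<epsilon>1 \<epsilon>2"
    unfolding regular_wrt_def
  proof (rule order_trans[OF card_nsets3_bad_le[OF V bad'] B(1)])
    fix x y z assume "x \<in> V" "y \<in> V" "z \<in> V" "G x y z"
    from core[OF this refl] show "\<exists>X Y Z E. triad t l ?Vs ?P X Y Z E \<and> {x, y, z} \<in> K3 E \<and> disc23 X Y Z E (F \<inter> K3 E) \<epsilon>1 \<epsilon>2"
      by blast
  qed
  let ?H = "\<lambda>e. \<exists>X Y Z E. triad t l ?Vs ?P X Y Z E \<and> e \<in> K3 E \<and> tri_density F E \<in> {0..<\<epsilon>1} \<union> {1 - \<epsilon>1<..1}"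
  have "real (card {e \<in> nsets V 3. \<not> ?H e}) \<le> \<epsilon>1 * real (card V choose 3)"
  proof (rule order_trans[OF card_nsets3_bad_le[OF V bad'] B(2)])
    fix x y z assume "x \<in> V" "y \<in> V" "z \<in> V" "G x y z"
    from core[OF this refl] show "?H {x, y, z}" by blast
  qed
  moreover have "real (card {e \<in> nsets V 3. ?H e}) + real (card {e \<in> nsets V 3. \<not> ?H e}) = real (card V choose 3)"
  proof -
    have fn: "finite (nsets V 3)" using V by (rule finite_imp_finite_nsets)
    have "nsets V 3 = {B. B \<subseteq> V \<and> card B = 3}" using V by (auto simp: nsets_def finite_subset)
    then have "card (nsets V 3) = card V choose 3" using n_subsets[OF V] by simp
    moreover have "card {e \<in> nsets V 3. ?H e} + card {e \<in> nsets V 3. \<not> ?H e} = card ({e \<in> nsets V 3. ?H e} \<union> {e \<in> nsets V 3.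
        \<not> ?H e})"
      by (rule card_Un_disjoint[symmetric]) (use fn in auto)
    moreover have "{e \<in> nsets V 3. ?H e} \<union> {e \<in> nsets V 3. \<not> ?H e} = nsets V 3" by blast
    ultimately show ?thesis by (simp only: of_nat_add[symmetric])
  qed
  ultimately show "homogeneous_wrt V F t l ?Vs ?P \<epsilon>1"
    unfolding homogeneous_wrt_def left_diff_distrib by linarith
  show "decomposition V t l \<epsilon>1 \<epsilon>2 ?Vs ?P"
    unfolding decomposition_def
  proof (intro conjI)
    show "(\<Union>i\<in>{1..t}. ?Vs i) = V" using \<pi> by (auto simp: part_def)
    show "disjoint_family_on ?Vs {1..t}" by (auto simp: disjoint_family_on_def part_def)
    show "\<forall>i\<in>{1..t}. \<forall>j\<in>{1..t}. i \<le> j \<longrightarrow> card (?Vs i) \<le> card (?Vs j)" using sz(1) by blast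
    show "card (?Vs t) \<le> card (?Vs 1) + 1" by (rule sz(2))
    show "\<forall>i\<in>{1..t}. \<forall>j\<in>{1..t}. i \<noteq> j \<longrightarrow> (\<Union>\<alpha>\<in>{1..l}. ?P {i, j} \<alpha>) = K2 (?Vs i) (?Vs j)
        \<and> disjoint_family_on (?P {i, j}) {1..l}"
    proof (intro ballI impI)
      have *: "(\<Union>\<alpha>\<in>{1..l}. ?P {i, j} \<alpha>) = K2 (?Vs i) (?Vs j) \<and> disjoint_family_on (?P {i, j}) {1..l}" if ij: "i < j" for i j
      proof
        show "(\<Union>\<alpha>\<in>{1..l}. ?P {i, j} \<alpha>) = K2 (?Vs i) (?Vs j)"
        proof (intro equalityI subsetI)
          fix e assume "e \<in> (\<Union>\<alpha>\<in>{1..l}. ?P {i, j} \<alpha>)"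
          then show "e \<in> K2 (?Vs i) (?Vs j)" using pair_graph_subset_K2[OF ij] by blast
        next
          fix e assume "e \<in> K2 (?Vs i) (?Vs j)"
          then obtain x y where e: "e = {x, y}" and xy: "x \<in> ?Vs i" "y \<in> ?Vs j" by (auto simp: K2_def)
          have "e \<in> ?P {i, j} (\<kappa> (x, y))" unfolding e using pair_graph_iff[OF ij xy] by blast
          moreover have "\<kappa> (x, y) \<in> {1..l}" using xy \<kappa> by (simp add: part_def)
          ultimately show "e \<in> (\<Union>\<alpha>\<in>{1..l}. ?P {i, j} \<alpha>)" by blast
        qed
        show "disjoint_family_on (?P {i, j}) {1..l}"
          unfolding disjoint_family_on_def
        proof (intro ballI impI equals0I)
          fix \<alpha> \<beta> e assume ab: "\<alpha> \<noteq> \<beta>" and "e \<in> ?P {i, j} \<alpha> \<inter> ?P {i, j} \<beta>"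
          then obtain x y where "x \<in> ?Vs i" "y \<in> ?Vs j" "e = {x, y}" "\<kappa> (x, y) = \<alpha>" "e \<in> ?P {i, j} \<beta>"
            using pair_graph_eq[OF ij, of V \<pi> \<kappa> \<alpha>] by blast
          then show False using pair_graph_iff[OF ij, of x V \<pi> y \<kappa> \<beta>] ab by simp
        qed
      qed
      fix i j :: nat assume "i \<noteq> j"
      then consider "i < j" | "j < i" by linarith
      then show "(\<Union>\<alpha>\<in>{1..l}. ?P {i, j} \<alpha>) = K2 (?Vs i) (?Vs j) \<and> disjoint_family_on (?P {i, j}) {1..l}"
      proof cases
        case 1 then show ?thesis by (rule *)
      next
        case 2
        have "K2 (?Vs i) (?Vs j) = K2 (?Vs j) (?Vs i)" unfolding K2_def by (auto simp: insert_commute)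
        then show ?thesis using *[OF 2] by (simp add: insert_commute)
      qed
    qed
    show "real (card {e \<in> nsets V 3. \<not> (\<exists>x y z i j k \<alpha> \<beta> \<gamma>.
        e = {x, y, z} \<and> {i, j, k} \<in> nsets {1..t} 3 \<and>
        \<alpha> \<in> {1..l} \<and> \<beta> \<in> {1..l} \<and> \<gamma> \<in> {1..l} \<and>
        {x, y} \<in> ?P {i, j} \<alpha> \<and> {x, z} \<in> ?P {i, k} \<beta> \<and> {y, z} \<in> ?P {j, k} \<gamma> \<and>
        disc2_dens (?Vs i) (?Vs j) (?P {i, j} \<alpha>) \<epsilon>2 (1 / real l) \<and>
        disc2_dens (?Vs i) (?Vs k) (?P {i, k} \<beta>) \<epsilon>2 (1 / real l) \<and>
        disc2_dens (?Vs j) (?Vs k) (?P {j, k} \<gamma>) \<epsilon>2 (1 / real l))}) \<le> \<epsilon>1 * real (card V) ^ 3"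
    proof (rule order_trans[OF card_nsets3_bad_le[OF V bad'] B(1)])
      fix x y z assume xyz: "x \<in> V" "y \<in> V" "z \<in> V" and g: "G x y z"
      have lt: "\<pi> x < \<pi> y" "\<pi> y < \<pi> z" and lt': "\<pi> x < \<pi> z" using g by (auto simp: G_def good_triple_def)
      have u: "uniform_pair V \<pi> \<kappa> l \<xi> (\<pi> x) (\<pi> y)" "uniform_pair V \<pi> \<kappa> l \<xi> (\<pi> x) (\<pi> z)"
        "uniform_pair V \<pi> \<kappa> l \<xi> (\<pi> y) (\<pi> z)" using g unfolding G_def good_triple_def by blast+
      have "\<xi> \<le> \<epsilon>2 / 2" using \<xi> by simp
      note u' = u[THEN uniform_pair_mono, OF this]
      have m: "{x, y} \<in> ?P {\<pi> x, \<pi> y} (\<kappa> (x, y))" "{x, z} \<in> ?P {\<pi> x, \<pi> z} (\<kappa> (x, z))" "{y, z} \<in> ?P {\<pi> y, \<pi> z} (\<kappa> (y, z))"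
        using pair_graph_iff[OF lt(1) self[OF xyz(1)] self[OF xyz(2)]] pair_graph_iff[OF lt' self[OF xyz(1)] self[OF xyz(3)]]
          pair_graph_iff[OF lt(2) self[OF xyz(2)] self[OF xyz(3)]] by blast+
      show "\<exists>x' y' z' i j k \<alpha> \<beta> \<gamma>.
        {x, y, z} = {x', y', z'} \<and> {i, j, k} \<in> nsets {1..t} 3 \<and>
        \<alpha> \<in> {1..l} \<and> \<beta> \<in> {1..l} \<and> \<gamma> \<in> {1..l} \<and>
        {x', y'} \<in> ?P {i, j} \<alpha> \<and> {x', z'} \<in> ?P {i, k} \<beta> \<and> {y', z'} \<in> ?P {j, k} \<gamma> \<and>
        disc2_dens (?Vs i) (?Vs j) (?P {i, j} \<alpha>) \<epsilon>2 (1 / real l) \<and>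
        disc2_dens (?Vs i) (?Vs k) (?P {i, k} \<beta>) \<epsilon>2 (1 / real l) \<and>
        disc2_dens (?Vs j) (?Vs k) (?P {j, k} \<gamma>) \<epsilon>2 (1 / real l)"
        by (rule exI[of _ x], rule exI[of _ y], rule exI[of _ z], rule exI[of _ "\<pi> x"], rule exI[of _ "\<pi> y"],
            rule exI[of _ "\<pi> z"], rule exI[of _ "\<kappa> (x, y)"], rule exI[of _ "\<kappa> (x, z)"], rule exI[of _ "\<kappa> (y, z)"])
          (intro conjI refl n3 \<kappa> xyz lt m uniform_pair_disc2_dens V lt' u')
    qed
  qed
qed

subsection \<open>The decomposition\<close>

text \<open>
  Each of the \<open>l\<close> new colours outside \<open>imp i j\<close> refines a single old colour on the pair \<open>(i, j)\<close>.
\<close>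

lemma uniform_colouring:
  fixes V :: "'a set" and \<tau> :: "'a \<Rightarrow> 'a \<Rightarrow> nat" and e \<theta> :: real
  assumes V: "finite V" and l: "l \<ge> 1" and \<theta>: "\<theta> > 0" "2 * real l / \<theta> ^ 4 \<le> real (card V)"
    and \<tau>: "\<And>x y. \<tau> x y < m" and e: "0 \<le> e"
    and size: "\<forall>i\<in>{1..t}. \<forall>j\<in>{1..t}.
      real (card V) ^ 2 \<le> 4 * real t ^ 2 * (real (card (part V \<pi> i)) * real (card (part V \<pi> j)))"
  shows "\<exists>\<kappa> imp. (\<forall>x\<in>V. \<forall>y\<in>V. \<kappa> (x, y) \<in> {1..l}) \<and>
    (\<forall>i j. imp i j \<subseteq> {1..l} \<and> card (imp i j) \<le> m) \<and>
    (\<forall>i\<in>{1..t}. \<forall>j\<in>{1..t}. reg_pair e (part V \<pi> i) (part V \<pi> j) \<tau> \<longrightarrow>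
       uniform_pair V \<pi> \<kappa> l (4 * real t ^ 2 * \<theta> + real m * e) i j) \<and>
    (\<forall>x\<in>V. \<forall>y\<in>V. \<forall>x'\<in>V. \<forall>y'\<in>V. \<pi> x = \<pi> x' \<longrightarrow> \<pi> y = \<pi> y' \<longrightarrow> \<kappa> (x, y) = \<kappa> (x', y') \<longrightarrow>
       \<kappa> (x, y) \<notin> imp (\<pi> x) (\<pi> y) \<longrightarrow> \<tau> x y = \<tau> x' y')"
proof -
  define d where "d i j c = pair_dens (part V \<pi> i) (part V \<pi> j) \<tau> c" for i j c
  have fin: "finite (part V \<pi> i)" for i using V by (auto simp: part_def)
  have d0: "0 \<le> d i j c" for i j c by (simp add: d_def pair_dens_def)
  have d1: "(\<Sum>c<m. d i j c) = 1" if "part V \<pi> i \<noteq> {}" "part V \<pi> j \<noteq> {}" for i j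
  proof -
    let ?A = "part V \<pi> i \<times> part V \<pi> j"
    have a: "real (card (part V \<pi> i)) * real (card (part V \<pi> j)) > 0" using that fin by (simp add: card_gt_0_iff)
    have "(\<Sum>c<m. real (card {(x, y) \<in> ?A. \<tau> x y = c})) = (\<Sum>c<m. \<Sum>p\<in>?A. of_bool (\<tau> (fst p) (snd p) = c))"
      using fin by (intro sum.cong refl card_filter_Times) auto
    also have "\<dots> = (\<Sum>p\<in>?A. \<Sum>c<m. of_bool (\<tau> (fst p) (snd p) = c))" by (rule sum.swap)
    also have "\<dots> = (\<Sum>p\<in>?A. 1)"
      using \<tau> by (intro sum.cong refl) (simp add: of_bool_def)
    also have "\<dots> = real (card (part V \<pi> i)) * real (card (part V \<pi> j))" by (simp add: card_cartesian_product)
    finally show ?thesis using a that fin unfolding d_def pair_dens_def sum_divide_distrib[symmetric]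
      by (simp add: card_gt_0_iff)
  qed
  define good where "good i j w \<longleftrightarrow> (\<forall>c<m. \<forall>\<alpha>\<in>{1..l}. 0 \<le> w c \<alpha>) \<and> (\<forall>c<m. (\<Sum>\<alpha>\<in>{1..l}. w c \<alpha>) = d i j c) \<and>
    (\<forall>\<alpha>\<in>{1..l}. (\<Sum>c<m. w c \<alpha>) = 1 / real l) \<and>
    card {\<alpha> \<in> {1..l}. \<exists>c<m. \<exists>c'<m. c \<noteq> c' \<and> 0 < w c \<alpha> \<and> 0 < w c' \<alpha>} \<le> m" for i j and w :: "nat \<Rightarrow> nat \<Rightarrow> real"
  \<comment> \<open>If a part is empty, its densities are 0 by the convention for division and do
    not add up to 1, so no splitting is asked for.\<close>
  have "\<exists>w. part V \<pi> i \<noteq> {} \<longrightarrow> part V \<pi> j \<noteq> {} \<longrightarrow> good i j w" for i j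
  proof (cases "part V \<pi> i \<noteq> {} \<and> part V \<pi> j \<noteq> {}")
    case True
    then have "(\<Sum>c<m. d i j c) = 1" using d1 by blast
    then have "\<exists>w. good i j w" unfolding good_def by (intro interval_splitting d0 l)
    then show ?thesis by blast
  qed auto
  then obtain w where w: "\<And>i j. part V \<pi> i \<noteq> {} \<Longrightarrow> part V \<pi> j \<noteq> {} \<Longrightarrow> good i j (w i j)" by metis
  \<comment> \<open>The conditional distribution of the new colour given the old one. It is a
    probability vector because the overlaps of one old colour add up to its density, which is
    positive if that colour occurs on the pair of parts.\<close>
  define W where "W p \<alpha> = w (\<pi> (fst p)) (\<pi> (snd p)) (\<tau> (fst p) (snd p)) \<alpha> / d (\<pi> (fst p)) (\<pi> (snd p)) (\<tau> (fst p) (snd p))"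
    for p :: "'a \<times> 'a" and \<alpha>
  have self: "x \<in> part V \<pi> (\<pi> x)" if "x \<in> V" for x using that by (simp add: part_def)
  have gd: "good (\<pi> x) (\<pi> y) (w (\<pi> x) (\<pi> y))" if "x \<in> V" "y \<in> V" for x y
    using w[of "\<pi> x" "\<pi> y"] self that by blast
  have dpos: "d (\<pi> x) (\<pi> y) (\<tau> x y) > 0" if "x \<in> V" "y \<in> V" for x y
  proof -
    let ?A = "{(x', y') \<in> part V \<pi> (\<pi> x) \<times> part V \<pi> (\<pi> y). \<tau> x' y' = \<tau> x y}"
    have "(x, y) \<in> ?A" using self that by simp
    moreover have "finite ?A" by (rule finite_subset[of _ "part V \<pi> (\<pi> x) \<times> part V \<pi> (\<pi> y)"]) (use fin in auto)
    ultimately have "real (card ?A) > 0" by (simp only: of_nat_0_less_iff card_gt_0_iff) blast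
    moreover have "real (card (part V \<pi> (\<pi> x))) > 0" "real (card (part V \<pi> (\<pi> y))) > 0"
      using self[OF that(1)] self[OF that(2)] fin by (simp_all only: of_nat_0_less_iff card_gt_0_iff) blast+
    ultimately show ?thesis unfolding d_def pair_dens_def by (intro divide_pos_pos mult_pos_pos)
  qed
  have W0: "0 \<le> W p \<alpha>" if "p \<in> V \<times> V" "\<alpha> \<in> {1..l}" for p \<alpha>
  proof -
    from that obtain x y where p: "p = (x, y)" "x \<in> V" "y \<in> V" by auto
    have "0 \<le> w (\<pi> x) (\<pi> y) (\<tau> x y) \<alpha>" using gd[OF p(2,3)] \<tau>[of x y] that(2) unfolding good_def by blast
    then show ?thesis using d0 by (simp add: W_def p)
  qed
  have W1: "(\<Sum>\<alpha>\<in>{1..l}. W p \<alpha>) = 1" if "p \<in> V \<times> V" for p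
  proof -
    from that obtain x y where p: "p = (x, y)" "x \<in> V" "y \<in> V" by auto
    have "(\<Sum>\<alpha>\<in>{1..l}. W p \<alpha>) = (\<Sum>\<alpha>\<in>{1..l}. w (\<pi> x) (\<pi> y) (\<tau> x y) \<alpha>) / d (\<pi> x) (\<pi> y) (\<tau> x y)"
      by (simp add: W_def p sum_divide_distrib)
    also have "(\<Sum>\<alpha>\<in>{1..l}. w (\<pi> x) (\<pi> y) (\<tau> x y) \<alpha>) = d (\<pi> x) (\<pi> y) (\<tau> x y)"
      using gd[OF p(2,3)] \<tau>[of x y] unfolding good_def by blast
    finally show ?thesis using dpos[OF p(2,3)] by simp
  qed
  have "\<exists>\<kappa>. (\<forall>p\<in>V \<times> V. \<kappa> p \<in> {1..l} \<and> 0 < W p (\<kappa> p)) \<and>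
    (\<forall>\<alpha>\<in>{1..l}. \<forall>U U'. U \<subseteq> V \<longrightarrow> U' \<subseteq> V \<longrightarrow>
      \<bar>\<Sum>x\<in>U. \<Sum>y\<in>U'. of_bool (\<kappa> (x, y) = \<alpha>) - W (x, y) \<alpha>\<bar> \<le> \<theta> * real (card V) ^ 2)"
  proof (rule random_rounding)
    show "2 * real (card {1..l}) / \<theta> ^ 4 \<le> real (card V)" using \<theta> by simp
  qed (rule V \<theta> finite_atLeastAtMost W0 W1 | assumption)+
  then obtain \<kappa> where \<kappa>0: "\<forall>p\<in>V \<times> V. \<kappa> p \<in> {1..l} \<and> 0 < W p (\<kappa> p)" and
    cut0: "\<forall>\<alpha>\<in>{1..l}. \<forall>U U'. U \<subseteq> V \<longrightarrow> U' \<subseteq> V \<longrightarrow>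
      \<bar>\<Sum>x\<in>U. \<Sum>y\<in>U'. of_bool (\<kappa> (x, y) = \<alpha>) - W (x, y) \<alpha>\<bar> \<le> \<theta> * real (card V) ^ 2"
    by (elim exE conjE) (rule that)
  note \<kappa> = \<kappa>0[THEN bspec] and cut = cut0[rule_format]
  define imp where "imp i j = (if part V \<pi> i \<noteq> {} \<and> part V \<pi> j \<noteq> {} then
     {\<alpha> \<in> {1..l}. \<exists>c<m. \<exists>c'<m. c \<noteq> c' \<and> 0 < w i j c \<alpha> \<and> 0 < w i j c' \<alpha>} else {})" for i j
  have imp: "imp i j \<subseteq> {1..l} \<and> card (imp i j) \<le> m" for i j
    using w[of i j] by (auto simp: imp_def good_def)
  have pure: "\<tau> x y = \<tau> x' y'"
    if xy: "x \<in> V" "y \<in> V" "x' \<in> V" "y' \<in> V" and eq: "\<pi> x = \<pi> x'" "\<pi> y = \<pi> y'" "\<kappa> (x, y) = \<kappa> (x', y')"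
      and ni: "\<kappa> (x, y) \<notin> imp (\<pi> x) (\<pi> y)" for x y x' y'
  proof (rule ccontr)
    assume ne: "\<tau> x y \<noteq> \<tau> x' y'"
    have "0 < W (x, y) (\<kappa> (x, y))" "0 < W (x', y') (\<kappa> (x, y))" using \<kappa>[of "(x, y)"] \<kappa>[of "(x', y')"] xy eq by auto
    then have "0 < w (\<pi> x) (\<pi> y) (\<tau> x y) (\<kappa> (x, y))" "0 < w (\<pi> x) (\<pi> y) (\<tau> x' y') (\<kappa> (x, y))"
      using dpos[OF xy(1,2)] dpos[OF xy(3,4)] by (simp_all add: W_def eq zero_less_divide_iff)
    moreover have "\<kappa> (x, y) \<in> {1..l}" using \<kappa>[of "(x, y)"] xy by simp
    moreover have "part V \<pi> (\<pi> x) \<noteq> {}" "part V \<pi> (\<pi> y) \<noteq> {}" using self xy by blast+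
    then have "imp (\<pi> x) (\<pi> y) = {\<alpha> \<in> {1..l}. \<exists>c<m. \<exists>c'<m. c \<noteq> c' \<and>
        0 < w (\<pi> x) (\<pi> y) c \<alpha> \<and> 0 < w (\<pi> x) (\<pi> y) c' \<alpha>}" by (simp add: imp_def)
    moreover have "\<tau> x y < m" "\<tau> x' y' < m" by (rule \<tau>)+
    ultimately have "\<kappa> (x, y) \<in> imp (\<pi> x) (\<pi> y)" using ne by blast
    then show False using ni by contradiction
  qed
  \<comment> \<open>There are two errors: the rounding contributes \<open>\<theta> * n ^ 2\<close>,
    measured against the size of a pair of parts, and the regularity contributes \<open>e\<close>
    for each of the \<open>m\<close> old colours, whose weights \<open>\<rho> c\<close> are at most
    1.\<close>
  have unif: "uniform_pair V \<pi> \<kappa> l (4 * real t ^ 2 * \<theta> + real m * e) i j"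
    if ij: "i \<in> {1..t}" "j \<in> {1..t}" and reg: "reg_pair e (part V \<pi> i) (part V \<pi> j) \<tau>" for i j
    unfolding uniform_pair_def
  proof (intro ballI allI impI)
    fix \<alpha> U W' assume \<alpha>: "\<alpha> \<in> {1..l}" and UW: "U \<subseteq> part V \<pi> i" "W' \<subseteq> part V \<pi> j"
    let ?a = "real (card (part V \<pi> i)) * real (card (part V \<pi> j))"
    let ?u = "real (card U) * real (card W')"
    have PV: "part V \<pi> i \<subseteq> V" "part V \<pi> j \<subseteq> V" by (auto simp: part_def)
    have finUW: "finite U" "finite W'" using UW fin finite_subset by blast+
    show "\<bar>real (card {(x, y) \<in> U \<times> W'. \<kappa> (x, y) = \<alpha>}) - 1 / real l * ?u\<bar> \<le> (4 * real t ^ 2 * \<theta> + real m * e) * ?a"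
    proof (cases "part V \<pi> i \<noteq> {} \<and> part V \<pi> j \<noteq> {}")
      case False
      then have "U \<times> W' = {}" "?u = 0" "?a = 0" using UW by auto
      then show ?thesis by (auto simp: card_eq_0_iff)
    next
      case True
      then have g: "good i j (w i j)" using w by blast
      define N where "N c = real (card {(x, y) \<in> U \<times> W'. \<tau> x y = c})" for c
      define \<rho> where "\<rho> c = w i j c \<alpha> / d i j c" for c
      have wle: "w i j c \<alpha> \<le> d i j c" "0 \<le> w i j c \<alpha>" if "c < m" for c
      proof -
        have nn: "0 \<le> w i j c \<beta>" if "\<beta> \<in> {1..l}" for \<beta> using g \<open>c < m\<close> that unfolding good_def by blast
        then show "0 \<le> w i j c \<alpha>" using \<alpha> by blast
        have "w i j c \<alpha> \<le> (\<Sum>\<beta>\<in>{1..l}. w i j c \<beta>)" using \<alpha> nn by (intro member_le_sum) auto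
        then show "w i j c \<alpha> \<le> d i j c" using g that unfolding good_def by metis
      qed
      \<comment> \<open>For \<open>d i j c = 0\<close> the quotient \<open>\<rho> c\<close> is 0 by
        convention, and \<open>w i j c \<alpha> \<le> d i j c\<close> forces the overlap to vanish,
        so the equation persists.\<close>
      have \<rho>: "0 \<le> \<rho> c" "\<rho> c \<le> 1" "\<rho> c * d i j c = w i j c \<alpha>" if "c < m" for c
        using wle[OF that] d0[of i j c] by (auto simp: \<rho>_def divide_le_eq_1)
      have sumW: "(\<Sum>x\<in>U. \<Sum>y\<in>W'. W (x, y) \<alpha>) = (\<Sum>c<m. \<rho> c * N c)"
      proof -
        have "(\<Sum>x\<in>U. \<Sum>y\<in>W'. W (x, y) \<alpha>) = (\<Sum>p\<in>U \<times> W'. \<rho> (\<tau> (fst p) (snd p)))"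
          unfolding sum_Times using UW by (intro sum.cong refl) (auto simp: W_def \<rho>_def part_def)
        also have "\<dots> = (\<Sum>p\<in>U \<times> W'. \<Sum>c<m. \<rho> c * of_bool (\<tau> (fst p) (snd p) = c))"
          using \<tau> by (intro sum.cong refl) (simp add: of_bool_def if_distrib[of "\<lambda>x. _ * x"] cong: if_cong)
        also have "\<dots> = (\<Sum>c<m. \<Sum>p\<in>U \<times> W'. \<rho> c * of_bool (\<tau> (fst p) (snd p) = c))" by (rule sum.swap)
        also have "\<dots> = (\<Sum>c<m. \<rho> c * N c)"
          unfolding N_def card_filter_Times[OF finUW] sum_distrib_left ..
        finally show ?thesis .
      qed
      have "\<bar>(\<Sum>c<m. \<rho> c * N c) - 1 / real l * ?u\<bar> \<le> real m * (e * ?a)"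
      proof -
        have "1 / real l = (\<Sum>c<m. \<rho> c * d i j c)"
          using g \<alpha> \<rho>(3) unfolding good_def by (metis (no_types, lifting) lessThan_iff sum.cong)
        then have "(\<Sum>c<m. \<rho> c * N c) - 1 / real l * ?u = (\<Sum>c<m. \<rho> c * (N c - d i j c * ?u))"
          by (simp add: sum_subtractf right_diff_distrib sum_distrib_right mult.assoc)
        also have "\<bar>\<dots>\<bar> \<le> (\<Sum>c<m. e * ?a)"
        proof (rule order_trans[OF sum_abs sum_mono])
          fix c assume "c \<in> {..<m}"
          then have r: "0 \<le> \<rho> c" "\<rho> c \<le> 1" using \<rho> by auto
          have "\<bar>N c - d i j c * ?u\<bar> \<le> e * ?a"
            using reg[unfolded reg_pair_def, rule_format, OF UW, of c] by (simp add: N_def d_def mult.assoc)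
          then have "\<rho> c * \<bar>N c - d i j c * ?u\<bar> \<le> 1 * (e * ?a)" using r by (intro mult_mono) auto
          then show "\<bar>\<rho> c * (N c - d i j c * ?u)\<bar> \<le> e * ?a" using r by (simp add: abs_mult)
        qed
        finally show ?thesis by simp
      qed
      moreover have "\<bar>real (card {(x, y) \<in> U \<times> W'. \<kappa> (x, y) = \<alpha>}) - (\<Sum>c<m. \<rho> c * N c)\<bar> \<le> 4 * real t ^ 2 * \<theta> * ?a"
      proof -
        have "real (card {(x, y) \<in> U \<times> W'. \<kappa> (x, y) = \<alpha>}) = (\<Sum>x\<in>U. \<Sum>y\<in>W'. of_bool (\<kappa> (x, y) = \<alpha>))"
          unfolding card_filter_Times[OF finUW] sum_Times by simp
        then have "\<bar>real (card {(x, y) \<in> U \<times> W'. \<kappa> (x, y) = \<alpha>}) - (\<Sum>c<m. \<rho> c * N c)\<bar> =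
            \<bar>\<Sum>x\<in>U. \<Sum>y\<in>W'. of_bool (\<kappa> (x, y) = \<alpha>) - W (x, y) \<alpha>\<bar>"
          by (simp add: sumW[symmetric] sum_subtractf)
        also have "\<dots> \<le> \<theta> * real (card V) ^ 2" using UW PV by (intro cut \<alpha>) auto
        also have "\<dots> \<le> \<theta> * (4 * real t ^ 2 * ?a)" using size[rule_format, OF ij] \<theta> by (intro mult_left_mono) auto
        finally show ?thesis by (simp add: mult_ac)
      qed
      ultimately show ?thesis unfolding distrib_right by (simp only: mult.assoc)
    qed
  qed
  have \<kappa>l: "\<kappa> (x, y) \<in> {1..l}" if "x \<in> V" "y \<in> V" for x y using \<kappa>[of "(x, y)"] that by simp
  show ?thesis
    by (rule exI[of _ \<kappa>], rule exI[of _ imp], intro conjI ballI allI impI)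
      (rule \<kappa>l imp[THEN conjunct1] imp[THEN conjunct2] unif pure; assumption)+
qed

text \<open>A bad triple has a pair inside one part (\<open>Q1\<close>), in a pair of parts
  violating \<open>R\<close> (\<open>Q2\<close>) or of a mixed colour (\<open>Q3\<close>), or its
  triad contains too many errors of the approximation (\<open>Rb\<close>). The first three
  contribute \<open>2 / t\<close>, \<open>4 * e\<close> and \<open>2 * m / l\<close> for each of its
  three pairs, the last \<open>\<delta> / \<mu>\<close>. Otherwise the new colours determine the old
  ones on the whole triad.\<close>

lemma card_bad_triples:
  fixes V :: "'a set" and \<tau> :: "'a \<Rightarrow> 'a \<Rightarrow> nat" and e \<xi> \<mu> \<delta> :: real
  assumes V: "finite V" and l: "l \<ge> 1" and t: "t \<ge> 1" and \<pi>: "\<And>x. x \<in> V \<Longrightarrow> \<pi> x \<in> {1..t}"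
    and size: "\<And>i. i \<in> {1..t} \<Longrightarrow> real t * real (card (part V \<pi> i)) \<le> 2 * real (card V)"
    and irr: "real (card {(i, j) \<in> {1..t} \<times> {1..t}. \<not> R i j}) \<le> e * real t ^ 2"
    and unif: "\<And>i j. i \<in> {1..t} \<Longrightarrow> j \<in> {1..t} \<Longrightarrow> R i j \<Longrightarrow> uniform_pair V \<pi> \<kappa> l \<xi> i j"
    and \<xi>: "\<xi> \<le> 1 / real l"
    and imp: "\<And>i j. imp i j \<subseteq> {1..l}" "\<And>i j. card (imp i j) \<le> m"
    and pure: "\<And>x y x' y'. x \<in> V \<Longrightarrow> y \<in> V \<Longrightarrow> x' \<in> V \<Longrightarrow> y' \<in> V \<Longrightarrow> \<pi> x = \<pi> x' \<Longrightarrow> \<pi> y = \<pi> y' \<Longrightarrow>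
      \<kappa> (x, y) = \<kappa> (x', y') \<Longrightarrow> \<kappa> (x, y) \<notin> imp (\<pi> x) (\<pi> y) \<Longrightarrow> \<tau> x y = \<tau> x' y'"
    and approx: "real (card {(x, y, z) \<in> V \<times> V \<times> V. ({x, y, z} \<in> F) \<noteq> ((\<tau> x y, \<tau> x z, \<tau> y z) \<in> D)}) \<le> \<delta> * real (card V) ^ 3"
    and \<mu>: "\<mu> > 0"
  shows "real (card {(x, y, z) \<in> V \<times> V \<times> V. \<pi> x \<le> \<pi> y \<and> \<pi> y \<le> \<pi> z \<and> \<not> good_triple V F \<pi> \<kappa> l \<xi> \<mu> x y z})
    \<le> (3 * (2 / real t + 4 * e + 2 * real m / real l) + \<delta> / \<mu>) * real (card V) ^ 3"
proof -
  let ?n = "real (card V)"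
  let ?a = "\<lambda>i. real (card (part V \<pi> i))"
  have fin: "finite (part V \<pi> i)" for i using V by (auto simp: part_def)
  have finV2: "finite (V \<times> V)" and finV3: "finite (V \<times> V \<times> V)" using V by auto
  define Q1 where "Q1 = {(x, y) \<in> V \<times> V. \<pi> x = \<pi> y}"
  define Q2 where "Q2 = {(x, y) \<in> V \<times> V. \<not> R (\<pi> x) (\<pi> y)}"
  define Q3 where "Q3 = {(x, y) \<in> V \<times> V. R (\<pi> x) (\<pi> y) \<and> \<kappa> (x, y) \<in> imp (\<pi> x) (\<pi> y)}"
  define Q where "Q = Q1 \<union> Q2 \<union> Q3"
  have size': "?a i \<le> 2 * ?n / real t" if "i \<in> {1..t}" for i
    using size[OF that] t by (simp add: pos_le_divide_eq mult.commute)
  have Q1: "real (card Q1) \<le> 2 / real t * ?n ^ 2"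
  proof -
    have "Q1 = Sigma V (\<lambda>x. part V \<pi> (\<pi> x))" by (auto simp: Q1_def part_def)
    then have "real (card Q1) = (\<Sum>x\<in>V. ?a (\<pi> x))" using V fin by (simp add: card_SigmaI)
    also have "\<dots> \<le> (\<Sum>x\<in>V. 2 * ?n / real t)" by (intro sum_mono size' \<pi>)
    finally show ?thesis by (simp add: power2_eq_square mult_ac)
  qed
  have Q2: "real (card Q2) \<le> 4 * e * ?n ^ 2"
  proof -
    let ?B = "{(i, j) \<in> {1..t} \<times> {1..t}. \<not> R i j}"
    have finB: "finite ?B" by (rule finite_subset[of _ "{1..t} \<times> {1..t}"]) auto
    have "Q2 \<subseteq> (\<Union>p\<in>?B. part V \<pi> (fst p) \<times> part V \<pi> (snd p))"
    proof
      fix q assume "q \<in> Q2"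
      then obtain x y where q: "q = (x, y)" "x \<in> V" "y \<in> V" "\<not> R (\<pi> x) (\<pi> y)" by (auto simp: Q2_def)
      then have "(\<pi> x, \<pi> y) \<in> ?B" using \<pi>[OF q(2)] \<pi>[OF q(3)] by simp
      moreover have "q \<in> part V \<pi> (fst (\<pi> x, \<pi> y)) \<times> part V \<pi> (snd (\<pi> x, \<pi> y))" using q by (simp add: part_def)
      ultimately show "q \<in> (\<Union>p\<in>?B. part V \<pi> (fst p) \<times> part V \<pi> (snd p))" by (rule UN_I)
    qed
    then have "card Q2 \<le> card (\<Union>p\<in>?B. part V \<pi> (fst p) \<times> part V \<pi> (snd p))"
      using finB fin by (intro card_mono) auto
    also have "\<dots> \<le> (\<Sum>p\<in>?B. card (part V \<pi> (fst p) \<times> part V \<pi> (snd p)))" by (rule card_UN_le[OF finB])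
    finally have "real (card Q2) \<le> real (\<Sum>p\<in>?B. card (part V \<pi> (fst p) \<times> part V \<pi> (snd p)))" by (simp only: of_nat_le_iff)
    also have "\<dots> = (\<Sum>p\<in>?B. ?a (fst p) * ?a (snd p))" by (simp add: card_cartesian_product)
    also have "\<dots> \<le> (\<Sum>p\<in>?B. (2 * ?n / real t) * (2 * ?n / real t))"
      by (intro sum_mono mult_mono size') auto
    also have "\<dots> = real (card ?B) * ((2 * ?n / real t) * (2 * ?n / real t))" by simp
    also have "\<dots> \<le> (e * real t ^ 2) * ((2 * ?n / real t) * (2 * ?n / real t))" using irr by (intro mult_right_mono) auto
    also have "\<dots> = 4 * e * ?n ^ 2" using t by (simp add: power2_eq_square)
    finally show ?thesis .
  qed
  have sum_a: "(\<Sum>i\<in>{1..t}. ?a i) = ?n"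
  proof -
    have "V = (\<Union>i\<in>{1..t}. part V \<pi> i)" using \<pi> by (auto simp: part_def)
    then have "card V = card (\<Union>i\<in>{1..t}. part V \<pi> i)" by (rule arg_cong)
    also have "\<dots> = (\<Sum>i\<in>{1..t}. card (part V \<pi> i))"
      using fin by (intro card_UN_disjoint) (auto simp: part_def)
    finally show ?thesis by simp
  qed
  have Q3: "real (card Q3) \<le> 2 * real m / real l * ?n ^ 2"
  proof -
    let ?B = "{(i, j) \<in> {1..t} \<times> {1..t}. R i j}"
    let ?C = "\<lambda>i j \<alpha>. {(x, y) \<in> part V \<pi> i \<times> part V \<pi> j. \<kappa> (x, y) = \<alpha>}"
    have finB: "finite ?B" by (rule finite_subset[of _ "{1..t} \<times> {1..t}"]) auto
    have finI: "finite (imp i j)" for i j using finite_subset[OF imp(1)] by simp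
    have finC: "finite (?C i j \<alpha>)" for i j \<alpha>
      by (rule finite_subset[of _ "part V \<pi> i \<times> part V \<pi> j"]) (use fin in auto)
    have cC: "real (card (?C i j \<alpha>)) \<le> 2 / real l * (?a i * ?a j)"
      if "i \<in> {1..t}" "j \<in> {1..t}" "R i j" "\<alpha> \<in> imp i j" for i j \<alpha>
    proof -
      have "\<alpha> \<in> {1..l}" using imp(1) that(4) by blast
      from unif[OF that(1-3), unfolded uniform_pair_def, rule_format, OF this subset_refl subset_refl]
      have "real (card (?C i j \<alpha>)) \<le> (1 / real l + \<xi>) * (?a i * ?a j)" by (simp only: abs_le_iff distrib_right) linarith
      also have "\<dots> \<le> (2 / real l) * (?a i * ?a j)" using \<xi> by (intro mult_right_mono) auto
      finally show ?thesis .
    qed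
    have "Q3 \<subseteq> (\<Union>p\<in>?B. \<Union>\<alpha>\<in>imp (fst p) (snd p). ?C (fst p) (snd p) \<alpha>)"
    proof
      fix q assume "q \<in> Q3"
      then obtain x y where q: "q = (x, y)" "x \<in> V" "y \<in> V" "R (\<pi> x) (\<pi> y)" "\<kappa> (x, y) \<in> imp (\<pi> x) (\<pi> y)"
        by (auto simp: Q3_def)
      then have 1: "(\<pi> x, \<pi> y) \<in> ?B" using \<pi>[OF q(2)] \<pi>[OF q(3)] by simp
      have 2: "q \<in> (\<Union>\<alpha>\<in>imp (fst (\<pi> x, \<pi> y)) (snd (\<pi> x, \<pi> y)). ?C (fst (\<pi> x, \<pi> y)) (snd (\<pi> x, \<pi> y)) \<alpha>)"
        using q by (simp add: part_def)
      show "q \<in> (\<Union>p\<in>?B. \<Union>\<alpha>\<in>imp (fst p) (snd p). ?C (fst p) (snd p) \<alpha>)" using 1 2 by (rule UN_I)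
    qed
    then have "card Q3 \<le> card (\<Union>p\<in>?B. \<Union>\<alpha>\<in>imp (fst p) (snd p). ?C (fst p) (snd p) \<alpha>)"
      by (intro card_mono finite_UN_I finB finI finC)
    also have "\<dots> \<le> (\<Sum>p\<in>?B. card (\<Union>\<alpha>\<in>imp (fst p) (snd p). ?C (fst p) (snd p) \<alpha>))" by (rule card_UN_le[OF finB])
    also have "\<dots> \<le> (\<Sum>p\<in>?B. \<Sum>\<alpha>\<in>imp (fst p) (snd p). card (?C (fst p) (snd p) \<alpha>))"
      by (intro sum_mono card_UN_le finI)
    finally have "real (card Q3) \<le> real (\<Sum>p\<in>?B. \<Sum>\<alpha>\<in>imp (fst p) (snd p). card (?C (fst p) (snd p) \<alpha>))"
      by (simp only: of_nat_le_iff)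
    also have "\<dots> = (\<Sum>p\<in>?B. \<Sum>\<alpha>\<in>imp (fst p) (snd p). real (card (?C (fst p) (snd p) \<alpha>)))" by simp
    also have "\<dots> \<le> (\<Sum>p\<in>?B. \<Sum>\<alpha>\<in>imp (fst p) (snd p). 2 / real l * (?a (fst p) * ?a (snd p)))"
      by (intro sum_mono cC) auto
    also have "\<dots> = (\<Sum>p\<in>?B. real (card (imp (fst p) (snd p))) * (2 / real l * (?a (fst p) * ?a (snd p))))" by simp
    also have "\<dots> \<le> (\<Sum>p\<in>?B. real m * (2 / real l * (?a (fst p) * ?a (snd p))))"
      using imp(2) by (intro sum_mono mult_right_mono) auto
    also have "\<dots> \<le> (\<Sum>p\<in>{1..t} \<times> {1..t}. real m * (2 / real l * (?a (fst p) * ?a (snd p))))"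
      by (intro sum_mono2) auto
    also have "\<dots> = real m * (2 / real l) * (\<Sum>p\<in>{1..t} \<times> {1..t}. ?a (fst p) * ?a (snd p))"
      by (simp only: sum_distrib_left mult.assoc)
    also have "(\<Sum>p\<in>{1..t} \<times> {1..t}. ?a (fst p) * ?a (snd p)) = (\<Sum>i\<in>{1..t}. ?a i) * (\<Sum>j\<in>{1..t}. ?a j)"
      unfolding sum_Times sum_product by simp
    also have "\<dots> = ?n * ?n" by (simp only: sum_a)
    finally show ?thesis by (simp add: power2_eq_square mult_ac)
  qed
  have cQ: "real (card Q) \<le> (2 / real t + 4 * e + 2 * real m / real l) * ?n ^ 2"
  proof -
    have "card Q \<le> card Q1 + card Q2 + card Q3"
      unfolding Q_def using card_Un_le[of "Q1 \<union> Q2" Q3] card_Un_le[of Q1 Q2] by linarith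
    then have "real (card Q) \<le> real (card Q1) + real (card Q2) + real (card Q3)"
      by (simp only: of_nat_add[symmetric] of_nat_le_iff)
    then show ?thesis using Q1 Q2 Q3 unfolding distrib_right by linarith
  qed
  have QV: "Q \<subseteq> V \<times> V" by (auto simp: Q_def Q1_def Q2_def Q3_def)
  \<comment> \<open>The fibres of \<open>h\<close> over triples in increasing parts are the triads,
    so Markov's inequality for fibres applies to them.\<close>
  define h where "h = (\<lambda>(x, y, z). (\<pi> x, \<pi> y, \<pi> z, \<kappa> (x, y), \<kappa> (x, z), \<kappa> (y, z)))"
  define err where "err = (\<lambda>(x, y, z). ({x, y, z} \<in> F) \<noteq> ((\<tau> x y, \<tau> x z, \<tau> y z) \<in> D))"
  let ?\<Omega> = "V \<times> V \<times> V"
  define Rb where "Rb = {\<omega> \<in> ?\<Omega>. \<mu> * real (card {\<omega>' \<in> ?\<Omega>. h \<omega>' = h \<omega>}) < real (card {\<omega>' \<in> ?\<Omega>. h \<omega>' = h \<omega> \<and> err \<omega>'})}"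
  have cR: "real (card Rb) \<le> \<delta> / \<mu> * ?n ^ 3"
  proof -
    have "{\<omega> \<in> ?\<Omega>. err \<omega>} = {(x, y, z) \<in> ?\<Omega>. ({x, y, z} \<in> F) \<noteq> ((\<tau> x y, \<tau> x z, \<tau> y z) \<in> D)}"
      unfolding err_def by auto
    then have "\<mu> * real (card Rb) \<le> \<delta> * ?n ^ 3"
      using card_bad_classes[OF finV3 \<mu>, of h err] approx unfolding Rb_def by simp
    then show ?thesis using \<mu> by (simp add: pos_le_divide_eq mult.commute)
  qed
  let ?Bad = "{(x, y, z) \<in> ?\<Omega>. \<pi> x \<le> \<pi> y \<and> \<pi> y \<le> \<pi> z \<and> \<not> good_triple V F \<pi> \<kappa> l \<xi> \<mu> x y z}"
  let ?BQ = "{(x, y, z) \<in> ?\<Omega>. (x, y) \<in> Q \<or> (x, z) \<in> Q \<or> (y, z) \<in> Q}"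
  have good: "good_triple V F \<pi> \<kappa> l \<xi> \<mu> x y z"
    if xyz: "x \<in> V" "y \<in> V" "z \<in> V" and le: "\<pi> x \<le> \<pi> y" "\<pi> y \<le> \<pi> z"
      and nQ: "(x, y) \<notin> Q" "(x, z) \<notin> Q" "(y, z) \<notin> Q" and nR: "(x, y, z) \<notin> Rb" for x y z
  proof -
    let ?T = "triad_triples V \<pi> \<kappa> (\<pi> x) (\<pi> y) (\<pi> z) (\<kappa> (x, y)) (\<kappa> (x, z)) (\<kappa> (y, z))"
    have lt: "\<pi> x < \<pi> y" "\<pi> y < \<pi> z" using nQ xyz le by (auto simp: Q_def Q1_def)
    have R: "R (\<pi> x) (\<pi> y)" "R (\<pi> x) (\<pi> z)" "R (\<pi> y) (\<pi> z)" using nQ xyz by (auto simp: Q_def Q2_def)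
    have ni: "\<kappa> (x, y) \<notin> imp (\<pi> x) (\<pi> y)" "\<kappa> (x, z) \<notin> imp (\<pi> x) (\<pi> z)" "\<kappa> (y, z) \<notin> imp (\<pi> y) (\<pi> z)"
      using nQ xyz R by (auto simp: Q_def Q3_def)
    have cls: "{\<omega>' \<in> ?\<Omega>. h \<omega>' = h (x, y, z)} = ?T" by (auto simp: h_def triad_triples_def part_def)
    have cls': "{\<omega>' \<in> ?\<Omega>. h \<omega>' = h (x, y, z) \<and> err \<omega>'} = {\<omega>' \<in> ?T. err \<omega>'}" unfolding cls[symmetric] by blast
    have "real (card {\<omega>' \<in> ?T. err \<omega>'}) \<le> \<mu> * real (card ?T)"
      using nR xyz unfolding Rb_def cls[symmetric] cls'[symmetric] by auto
    \<comment> \<open>Membership in \<open>D\<close> is therefore constant on the triad, and the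
      errors of the approximation are exactly the triples on which \<open>F\<close> deviates from
      this constant.\<close>
    moreover have \<tau>eq: "(\<tau> x' y', \<tau> x' z', \<tau> y' z') = (\<tau> x y, \<tau> x z, \<tau> y z)" if "(x', y', z') \<in> ?T" for x' y' z'
    proof -
      have m: "x' \<in> V" "y' \<in> V" "z' \<in> V" "\<pi> x = \<pi> x'" "\<pi> y = \<pi> y'" "\<pi> z = \<pi> z'"
        "\<kappa> (x, y) = \<kappa> (x', y')" "\<kappa> (x, z) = \<kappa> (x', z')" "\<kappa> (y, z) = \<kappa> (y', z')"
        using that by (auto simp: triad_triples_def part_def)
      show ?thesis
        using pure[OF xyz(1,2) m(1,2,4,5,7) ni(1)] pure[OF xyz(1,3) m(1,3,4,6,8) ni(2)] pure[OF xyz(2,3) m(2,3,5,6,9) ni(3)]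
        by simp
    qed
    moreover have "near_homogeneous F \<mu> ?T" if "real (card {\<omega>' \<in> ?T. err \<omega>'}) \<le> \<mu> * real (card ?T)"
    proof (cases "(\<tau> x y, \<tau> x z, \<tau> y z) \<in> D")
      case True
      have "{\<omega>' \<in> ?T. err \<omega>'} = {(x, y, z) \<in> ?T. {x, y, z} \<notin> F}"
        using \<tau>eq True unfolding err_def by auto
      then show ?thesis using that by (simp add: near_homogeneous_def)
    next
      case False
      have "{\<omega>' \<in> ?T. err \<omega>'} = {(x, y, z) \<in> ?T. {x, y, z} \<in> F}"
        using \<tau>eq False unfolding err_def by auto
      then show ?thesis using that by (simp add: near_homogeneous_def)
    qed
    ultimately have "near_homogeneous F \<mu> ?T" by blast
    moreover have "uniform_pair V \<pi> \<kappa> l \<xi> (\<pi> x) (\<pi> y)" "uniform_pair V \<pi> \<kappa> l \<xi> (\<pi> x) (\<pi> z)" "uniform_pair V \<pi> \<kappa> l \<xi> (\<pi> y) (\<pi>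
        z)"
      by (intro unif \<pi> xyz R)+
    ultimately show ?thesis using lt unfolding good_triple_def by blast
  qed
  have "?Bad \<subseteq> ?BQ \<union> Rb"
  proof
    fix \<omega> assume "\<omega> \<in> ?Bad"
    then obtain x y z where \<omega>: "\<omega> = (x, y, z)" and xyz: "x \<in> V" "y \<in> V" "z \<in> V" "\<pi> x \<le> \<pi> y" "\<pi> y \<le> \<pi> z"
      and ng: "\<not> good_triple V F \<pi> \<kappa> l \<xi> \<mu> x y z" by auto
    then have "(x, y) \<in> Q \<or> (x, z) \<in> Q \<or> (y, z) \<in> Q \<or> (x, y, z) \<in> Rb" using good[OF xyz] by blast
    then show "\<omega> \<in> ?BQ \<union> Rb" using xyz \<omega> by blast
  qed
  moreover have "finite ?BQ" by (rule finite_subset[OF _ finV3]) auto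
  moreover have "finite Rb" by (rule finite_subset[OF _ finV3]) (auto simp: Rb_def)
  ultimately have "card ?Bad \<le> card (?BQ \<union> Rb)" by (intro card_mono) auto
  also have "\<dots> \<le> card ?BQ + card Rb" by (rule card_Un_le)
  finally have "real (card ?Bad) \<le> real (card ?BQ) + real (card Rb)" by (simp only: of_nat_add[symmetric] of_nat_le_iff)
  moreover have "real (card ?BQ) \<le> 3 * (2 / real t + 4 * e + 2 * real m / real l) * ?n ^ 3"
    by (rule card_triples_bad_pair[OF V QV cQ])
  ultimately show ?thesis using cR unfolding distrib_right[of _ "\<delta> / \<mu>"] by linarith
qed

section \<open>Elementary estimates and the choice of the constants\<close>

text \<open>The inequality \<open>(n - 1) * (n - 2) \<ge> n ^ 2 / 2\<close> amounts to
  \<open>(n - 6) * n + 4 \<ge> 0\<close>.\<close>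

lemma binomial_3_ge:
  assumes "n \<ge> 6"
  shows "real n ^ 3 / 12 \<le> real (n choose 3)"
proof -
  have 2: "real (n choose 2) = real n * (real n - 1) / 2" for n
    by (induction n) (auto simp: numeral_2_eq_2 field_simps)
  have 3: "real (n choose 3) = real n * (real n - 1) * (real n - 2) / 6" for n
  proof (induction n)
    case (Suc n)
    have "Suc n choose 3 = (n choose 2) + (n choose 3)" by (simp add: numeral_3_eq_3 numeral_2_eq_2)
    then have "real (Suc n choose 3) = real n * (real n - 1) / 2 + real n * (real n - 1) * (real n - 2) / 6"
      using Suc 2[of n] by simp
    then show ?case by (simp add: field_simps)
  qed simp
  have "0 \<le> real n * ((real n - 6) * real n + 4)" using assms by (intro mult_nonneg_nonneg add_nonneg_nonneg) auto
  then show ?thesis unfolding 3 by (simp add: power3_eq_cube field_simps)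
qed

lemma not_VC2_realised:
  assumes "finite V" "VC2 V F < k"
  shows "\<not> VC2_realised V F k"
proof
  assume "VC2_realised V F k"
  then have "k \<le> VC2 V F"
    unfolding VC2_def using finite_VC2_realised[OF assms(1), of F] by (intro cSup_upper bdd_above_finite) auto
  then show False using assms(2) by simp
qed

lemma equitable_sizes:
  assumes t: "1 \<le> t" "t \<le> n" and a: "n div t \<le> a" "a \<le> n div t + 1"
  shows "real n \<le> 2 * real t * real a" "real t * real a \<le> 2 * real n"
proof -
  define s where "s = n div t"
  have s: "s \<ge> 1" using t by (simp add: s_def div_greater_zero_iff Suc_leI)
  have n: "n = t * s + n mod t" by (simp add: s_def)
  have "n mod t \<le> t" using t(1) by (simp add: less_imp_le)
  also have "t \<le> t * s" using s by simp
  finally have "n \<le> 2 * (t * s)" using n by linarith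
  also have "\<dots> \<le> 2 * (t * a)" using a by (simp add: s_def)
  finally have "real n \<le> real (2 * (t * a))" by (simp only: of_nat_le_iff)
  then show "real n \<le> 2 * real t * real a" by simp
  have "t * a \<le> t * (s + s)" using a s by (intro mult_left_mono) (auto simp: s_def)
  also have "\<dots> \<le> 2 * n" using n by (simp add: algebra_simps)
  finally have "real (t * a) \<le> real (2 * n)" by (simp only: of_nat_le_iff)
  then show "real t * real a \<le> 2 * real n" by simp
qed

theorem theorem2p25:
  fixes k l0 t0 :: nat and \<epsilon>1 :: real and \<epsilon>2 :: "nat \<Rightarrow> real"
  assumes "k \<ge> 1" and "\<epsilon>1 > 0" and "\<And>n. \<epsilon>2 n \<in> {0<..1}" and "l0 \<ge> 1" and "t0 \<ge> 1"
  shows "\<exists>N T L :: nat. N \<ge> 1 \<and> T \<ge> 1 \<and> L \<ge> 1 \<and>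
    (\<forall>(V :: 'a set) F. three_graph V F \<longrightarrow> card V \<ge> N \<longrightarrow> VC2 V F < k \<longrightarrow>
       (\<exists>t l Vs P. t0 \<le> t \<and> t \<le> T \<and> l0 \<le> l \<and> l \<le> L \<and>
          decomposition V t l \<epsilon>1 (\<epsilon>2 l) Vs P \<and>
          regular_wrt V F t l Vs P \<epsilon>1 (\<epsilon>2 l) \<and>
          homogeneous_wrt V F t l Vs P \<epsilon>1))"
proof -
  define \<epsilon> where "\<epsilon> = min \<epsilon>1 1"
  define \<mu> where "\<mu> = \<epsilon> / 4"
  \<comment> \<open>Bad triples may amount to \<open>\<epsilon> / 12 * n ^ 3\<close>, because
    \<open>n choose 3\<close> is at least \<open>n ^ 3 / 12\<close>. Half of this is
    \<open>\<delta> / \<mu> = \<epsilon> / 24\<close>; the other half is three times the sum of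
    three terms of at most \<open>\<epsilon> / 216\<close>, which gives the constants 432 and 864
    below.\<close>
  define \<delta> where "\<delta> = \<mu> * (\<epsilon> / 24)"
  have \<epsilon>: "0 < \<epsilon>" "\<epsilon> \<le> 1" "\<epsilon> \<le> \<epsilon>1" using assms(2) by (auto simp: \<epsilon>_def)
  have \<mu>: "0 < \<mu>" "2 * \<mu> \<le> \<epsilon>1" using \<epsilon> by (auto simp: \<mu>_def)
  have \<delta>: "0 < \<delta>" using \<epsilon> \<mu> by (simp add: \<delta>_def)
  from VC2_binary_approximation[OF \<delta>, where k = k] obtain m0 where m0: "\<forall>(V :: 'a set) F. finite V \<longrightarrow> V \<noteq> {}
      \<longrightarrow> \<not> VC2_realised V F k \<longrightarrow>
    (\<exists>(\<tau> :: 'a \<Rightarrow> 'a \<Rightarrow> nat) D. (\<forall>x y. \<tau> x y < m0) \<and>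
       real (card {(x, y, z) \<in> V \<times> V \<times> V. ({x, y, z} \<in> F) \<noteq> ((\<tau> x y, \<tau> x z, \<tau> y z) \<in> D)})
         \<le> \<delta> * real (card V) ^ 3)" by (rule exE)
  \<comment> \<open>The increment ensures \<open>m \<ge> 1\<close>.\<close>
  define m where "m = m0 + 1"
  define l where "l = max l0 (nat \<lceil>432 * real m / \<epsilon>\<rceil>)"
  have l1: "l \<ge> 1" and ll0: "l0 \<le> l" using assms(4) by (auto simp: l_def)
  have lm: "2 * real m / real l \<le> \<epsilon> / 216"
  proof -
    have "432 * real m / \<epsilon> \<le> real l" unfolding l_def by linarith
    then show ?thesis using \<epsilon> l1 by (simp add: field_simps)
  qed
  define \<xi> where "\<xi> = min (\<epsilon>2 l / 2) ((1 / real l) ^ 3 / 3)"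
  have \<xi>0: "\<xi> > 0" using assms(3)[of l] l1 by (simp add: \<xi>_def)
  have \<xi>: "0 \<le> \<xi>" "2 * \<xi> \<le> \<epsilon>2 l" "3 * \<xi> \<le> (1 / real l) ^ 3" using \<xi>0 by (auto simp: \<xi>_def)
  have \<xi>l: "\<xi> \<le> 1 / real l"
  proof -
    have "(1 / real l) ^ 3 \<le> (1 / real l) ^ 1" using l1 by (intro power_decreasing) auto
    then show ?thesis using \<xi> by simp
  qed
  \<comment> \<open>Half of \<open>\<xi>\<close> is reserved for the regularity error
    \<open>m * e\<close>, the other half for the rounding error governed by
    \<open>\<theta>\<close>.\<close>
  define e where "e = min (\<epsilon> / 864) (\<xi> / (2 * real m))"
  have m1: "m \<ge> 1" by (simp add: m_def)
  have e: "0 < e" "4 * e \<le> \<epsilon> / 216" "real m * e \<le> \<xi> / 2"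
  proof -
    show "0 < e" using \<epsilon> \<xi>0 m1 by (simp add: e_def)
    show "4 * e \<le> \<epsilon> / 216" by (simp add: e_def min_def)
    have "real m * e \<le> real m * (\<xi> / (2 * real m))" unfolding e_def by (intro mult_left_mono) auto
    then show "real m * e \<le> \<xi> / 2" using m1 by simp
  qed
  define t1 where "t1 = max t0 (nat \<lceil>432 / \<epsilon>\<rceil>)"
  from graph_regularity[OF e(1) m1, of t1] obtain T0 where T0: "\<forall>(V :: 'a set) (\<tau> :: 'a \<Rightarrow> 'a \<Rightarrow> nat). finite V \<longrightarrow> T0 \<le> card V
      \<longrightarrow> V \<noteq> {} \<longrightarrow> (\<forall>x\<in>V. \<forall>y\<in>V. \<tau> x y < m) \<longrightarrow>
    (\<exists>t \<pi>. t1 \<le> t \<and> 1 \<le> t \<and> t \<le> T0 \<and> regular_partition e V \<tau> t \<pi>)"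
    by (rule exE)
  define T where "T = max T0 1"
  have T1: "T \<ge> 1" by (simp add: T_def)
  \<comment> \<open>The number \<open>t\<close> of parts is only known later, so its bound
    \<open>T\<close> is used: \<open>4 * t ^ 2 * \<theta> \<le> \<xi> / 2\<close>.\<close>
  define \<theta> where "\<theta> = \<xi> / (8 * real T ^ 2)"
  have \<theta>: "\<theta> > 0" using \<xi>0 T1 by (simp add: \<theta>_def)
  \<comment> \<open>\<open>T\<close> makes the regularity lemma applicable, 6 is for the binomial
    estimate, and the last term is the size required for random rounding.\<close>
  define N where "N = max (max T 6) (nat \<lceil>2 * real l / \<theta> ^ 4\<rceil>)"
  have main: "\<exists>t l' Vs P. t0 \<le> t \<and> t \<le> T \<and> l0 \<le> l' \<and> l' \<le> l \<and> decomposition V t l' \<epsilon>1 (\<epsilon>2 l') Vs P \<and>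
          regular_wrt V F t l' Vs P \<epsilon>1 (\<epsilon>2 l') \<and> homogeneous_wrt V F t l' Vs P \<epsilon>1"
    if H: "three_graph V F" "N \<le> card V" "VC2 V F < k" for V :: "'a set" and F
  proof -
    let ?n = "real (card V)"
    have V: "finite V" using H(1) by (simp add: three_graph_def)
    have n6: "card V \<ge> 6" and nT0: "T0 \<le> card V" and n\<theta>: "2 * real l / \<theta> ^ 4 \<le> ?n"
      using H(2) unfolding N_def T_def by linarith+
    have Vne: "V \<noteq> {}" using n6 by auto
    from m0[rule_format, OF V Vne not_VC2_realised[OF V H(3)]]
    obtain \<tau> :: "'a \<Rightarrow> 'a \<Rightarrow> nat" and D where \<tau>0: "\<forall>x y. \<tau> x y < m0" and
      approx: "real (card {(x, y, z) \<in> V \<times> V \<times> V. ({x, y, z} \<in> F) \<noteq> ((\<tau> x y, \<tau> x z, \<tau> y z) \<in> D)}) \<le> \<delta> * ?n ^ 3"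
      by (elim exE conjE) (rule that)
    have \<tau>: "\<tau> x y < m" for x y using \<tau>0[rule_format, of x y] by (simp add: m_def)
    from \<tau> have "\<forall>x\<in>V. \<forall>y\<in>V. \<tau> x y < m" by blast
    from T0[THEN spec, THEN spec, THEN mp, OF V, THEN mp, OF nT0, THEN mp, OF Vne, THEN mp, OF this]
    obtain t \<pi> where t: "t1 \<le> t" "1 \<le> t" "t \<le> T0" and rp: "regular_partition e V \<tau> t \<pi>"
      by (elim exE conjE) (rule that)
    have \<pi>: "\<forall>x\<in>V. \<pi> x \<in> {1..t}"
      and sz0: "\<forall>i\<in>{1..t}. card V div t \<le> card (part V \<pi> i) \<and> card (part V \<pi> i) \<le> card V div t + 1"
      and srt0: "\<forall>i\<in>{1..t}. \<forall>j\<in>{1..t}. i \<le> j \<longrightarrow> card (part V \<pi> i) \<le> card (part V \<pi> j)"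
      and irr: "real (card {(i, j) \<in> {1..t} \<times> {1..t}. \<not> reg_pair e (part V \<pi> i) (part V \<pi> j) \<tau>}) \<le> e * real t ^ 2"
      using rp unfolding regular_partition_def by blast+
    note \<pi>' = \<pi>[rule_format] and sz = sz0[rule_format] and srt = srt0[rule_format]
    have tn: "t \<le> card V" using t nT0 by simp
    have size1: "?n \<le> 2 * real t * real (card (part V \<pi> i))" and size2: "real t * real (card (part V \<pi> i)) \<le> 2 * ?n"
      if "i \<in> {1..t}" for i
      using equitable_sizes[OF t(2) tn, of "card (part V \<pi> i)"] sz[OF that] by blast+
    have size3: "?n ^ 2 \<le> 4 * real t ^ 2 * (real (card (part V \<pi> i)) * real (card (part V \<pi> j)))"
      if "i \<in> {1..t}" "j \<in> {1..t}" for i j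
    proof -
      have "?n * ?n \<le> (2 * real t * real (card (part V \<pi> i))) * (2 * real t * real (card (part V \<pi> j)))"
        using size1[OF that(1)] size1[OF that(2)] by (intro mult_mono) auto
      then show ?thesis by (simp add: power2_eq_square mult_ac)
    qed
    have e0: "0 \<le> e" using e(1) by simp
    have size4: "\<forall>i\<in>{1..t}. \<forall>j\<in>{1..t}. ?n ^ 2 \<le> 4 * real t ^ 2 * (real (card (part V \<pi> i)) * real (card (part V \<pi> j)))"
      by (intro ballI size3)
    from uniform_colouring[where \<tau> = \<tau> and t = t and \<pi> = \<pi>, OF V l1 \<theta> n\<theta> \<tau> e0 size4]
    obtain \<kappa> imp where \<kappa>0: "\<forall>x\<in>V. \<forall>y\<in>V. \<kappa> (x, y) \<in> {1..l}"
      and imp0: "\<forall>i j. imp i j \<subseteq> {1..l} \<and> card (imp i j) \<le> m"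
      and unif0: "\<forall>i\<in>{1..t}. \<forall>j\<in>{1..t}. reg_pair e (part V \<pi> i) (part V \<pi> j) \<tau> \<longrightarrow>
         uniform_pair V \<pi> \<kappa> l (4 * real t ^ 2 * \<theta> + real m * e) i j"
      and pure0: "\<forall>x\<in>V. \<forall>y\<in>V. \<forall>x'\<in>V. \<forall>y'\<in>V. \<pi> x = \<pi> x' \<longrightarrow> \<pi> y = \<pi> y' \<longrightarrow> \<kappa> (x, y) = \<kappa> (x', y') \<longrightarrow>
         \<kappa> (x, y) \<notin> imp (\<pi> x) (\<pi> y) \<longrightarrow> \<tau> x y = \<tau> x' y'"
      by (elim exE conjE) (rule that)
    note \<kappa> = \<kappa>0[rule_format] and pure = pure0[rule_format]
    have tT: "t \<le> T" using t by (simp add: T_def)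
    have "4 * real t ^ 2 * \<theta> \<le> 4 * real T ^ 2 * \<theta>" using tT \<theta> by (intro mult_right_mono mult_left_mono power_mono) auto
    also have "\<dots> = \<xi> / 2" using T1 by (simp add: \<theta>_def)
    finally have "4 * real t ^ 2 * \<theta> + real m * e \<le> \<xi>" using e(3) by linarith
    then have unif: "uniform_pair V \<pi> \<kappa> l \<xi> i j"
      if "i \<in> {1..t}" "j \<in> {1..t}" "reg_pair e (part V \<pi> i) (part V \<pi> j) \<tau>" for i j
      using unif0[rule_format, OF that] uniform_pair_mono by blast
    define c where "c = 3 * (2 / real t + 4 * e + 2 * real m / real l) + \<delta> / \<mu>"
    have bad: "real (card {(x, y, z) \<in> V \<times> V \<times> V. \<pi> x \<le> \<pi> y \<and> \<pi> y \<le> \<pi> z \<and> \<not> good_triple V F \<pi> \<kappa> l \<xi> \<mu> x y z}) \<le> c * ?n ^ 3"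
      unfolding c_def
      by (rule card_bad_triples[where R = "\<lambda>i j. reg_pair e (part V \<pi> i) (part V \<pi> j) \<tau>" and imp = imp and \<tau> = \<tau> and D = D])
        (rule V l1 t \<pi>' size2 irr unif \<xi>l imp0[rule_format, THEN conjunct1] imp0[rule_format, THEN conjunct2] pure approx \<mu> |
            assumption)+
    have c: "c \<le> \<epsilon> / 12"
    proof -
      have "432 / \<epsilon> \<le> real t" using t(1) unfolding t1_def by linarith
      then have "2 / real t \<le> \<epsilon> / 216" using \<epsilon> t(2) by (simp add: field_simps)
      moreover have "\<delta> / \<mu> = \<epsilon> / 24" using \<mu> by (simp add: \<delta>_def)
      moreover have "3 * (a + b + c) + d \<le> \<epsilon> / 12" if "a \<le> \<epsilon> / 216" "b \<le> \<epsilon> / 216" "c \<le> \<epsilon> / 216" "d = \<epsilon> / 24"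
        for a b c d :: real using that by simp
      ultimately show ?thesis using e(2) lm unfolding c_def by blast
    qed
    have B1: "c * ?n ^ 3 \<le> \<epsilon>1 * ?n ^ 3" using c \<epsilon> by (intro mult_right_mono) auto
    have "c * ?n ^ 3 \<le> \<epsilon> / 12 * ?n ^ 3" using c by (intro mult_right_mono) auto
    also have "\<dots> = \<epsilon> * (?n ^ 3 / 12)" by simp
    also have "\<dots> \<le> \<epsilon>1 * real (card V choose 3)"
      using binomial_3_ge[OF n6] \<epsilon> by (intro mult_mono) auto
    finally have B2: "c * ?n ^ 3 \<le> \<epsilon>1 * real (card V choose 3)" .
    have tt: "t \<in> {1..t}" and tt1: "1 \<in> {1..t}" using t by auto
    have sz1: "card (part V \<pi> t) \<le> card (part V \<pi> 1) + 1"
      using sz[OF tt] sz[OF tt1] by linarith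
    have dec: "decomposition V t l \<epsilon>1 (\<epsilon>2 l) (part V \<pi>) (pair_graph V \<pi> \<kappa>)"
      by (rule decomposition_of_colouring(1)[OF V l1 t(2) _ _ sz1 _ \<xi> \<mu> bad B1 B2]) (rule \<pi>' srt \<kappa>; assumption)+
    have reg: "regular_wrt V F t l (part V \<pi>) (pair_graph V \<pi> \<kappa>) \<epsilon>1 (\<epsilon>2 l)"
      by (rule decomposition_of_colouring(2)[OF V l1 t(2) _ _ sz1 _ \<xi> \<mu> bad B1 B2]) (rule \<pi>' srt \<kappa>; assumption)+
    have hom: "homogeneous_wrt V F t l (part V \<pi>) (pair_graph V \<pi> \<kappa>) \<epsilon>1"
      by (rule decomposition_of_colouring(3)[OF V l1 t(2) _ _ sz1 _ \<xi> \<mu> bad B1 B2]) (rule \<pi>' srt \<kappa>; assumption)+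
    have "t0 \<le> t" using t(1) by (simp add: t1_def)
    then show ?thesis using tT ll0 dec reg hom
      by (intro exI[of _ t] exI[of _ l] exI[of _ "part V \<pi>"] exI[of _ "pair_graph V \<pi> \<kappa>"] conjI) simp_all
  qed
  have "N \<ge> 1" by (simp add: N_def)
  then show ?thesis using T1 l1 main
    by (intro exI[of _ N] exI[of _ T] exI[of _ l]) blast
qed

end
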